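(* Let $\Psi$ be the quiver with three vertices $\tilde{\mathrm e}_3,\tilde{\mathrm e}_4,\tilde{\mathrm e}_5$ and five arrows $$\tilde\tau_1:\tilde{\mathrm e}_5\to\tilde{\mathrm e}_3,\quad\tilde\tau_2:\tilde{\mathrm e}_3\to\tilde{\mathrm e}_5,\quad\tilde\tau_3:\tilde{\mathrm e}_5\to\tilde{\mathrm e}_4,\quad\tilde\tau_4:\tilde{\mathrm e}_4\to\tilde{\mathrm e}_5,\quad\tilde\tau_7:\tilde{\mathrm e}_5\to\tilde{\mathrm e}_5.$$ As $\mathbb F_2$-algebras, $$\Lambda'_{(2)}/2\Lambda'_{(2)}\;\cong\;\mathbb F_2\Psi/\big(\tilde\tau_2\tilde\tau_1,\ \tilde\tau_2\tilde\tau_3,\ \tilde\tau_2\tilde\tau_7,\ \tilde\tau_4\tilde\tau_1,\ \tilde\tau_4\tilde\tau_3,\ \tilde\tau_4\tilde\tau_7,\ \tilde\tau_7\tilde\tau_1,\ \tilde\tau_7\tilde\tau_3,\ \tilde\tau_7^2-\tilde\tau_1\tilde\tau_2\big).$$ Moreover, $\mathrm{B}_{\mathbb F_2}(S_3,S_3)$ is Morita equivalent to $\Lambda'_{(2)}/2\Lambda'_{(2)}$.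
   Context: **Double Burnside algebra.** For a finite group $G$ and a commutative ring $R$, $\mathrm{B}_R(G,G)$ is the $R$-module generated by the isomorphism classes $[M]$ of finite $(G,G)$-bisets (finite sets with commuting left and right $G$-actions) modulo $[M\sqcup N]=[M]+[N]$, with multiplication induced by $[M]\cdot[N]=[M\times_G N]$, where $M\times_G N$ is the set of $G$-orbits on $M\times N$ under $g(m,n)=(mg^{-1},gn)$, with biset structure induced by $h(m,n)p=(hm,np)$. **The algebra $A$.** Let $\mathbb Q[\bar\eta,\bar\xi]=\mathbb Q[\eta,\xi]/(\eta^2,\eta\xi,\xi^2)$, with $\mathbb Q$-basis $1,\bar\eta,\bar\xi$. $A$ consists of arrays $[a_{i,j}]_{i,j\in\{1,2,3,4\}}$ with $a_{i,j}\in A_{i,j}$, where $A_{1,1}=\mathbb Q^{3\times3}$, $A_{1,4}=\mathbb Q^{3\times1}$, $A_{4,1}=\mathbb Q^{1\times3}$, $A_{2,2}=A_{2,4}=A_{3,3}=A_{4,2}=\mathbb Q$, $A_{4,4}=\mathbb Q[\bar\eta,\bar\xi]$, and all other $A_{i,j}=0$. Addition is entrywise; the product of $[a_{i,j}]$ and $[a'_{i,j}]$ has $(i,j)$ entry $\sum_r\alpha_{i,r,j}(a_{i,r},a'_{r,j})$, where the bilinear maps $\alpha_{i,j,k}:A_{i,j}\times A_{j,k}\to A_{i,k}$ are: zero whenever one of $A_{i,j},A_{j,k},A_{i,k}$ is zero; $\alpha_{1,4,1}=0$, $\alpha_{2,4,2}=0$; $\alpha_{4,1,4}(x,y)=(xy)\bar\eta$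 (row times column); $\alpha_{4,2,4}(x,y)=xy(\bar\xi-12\bar\eta)$; $\alpha_{4,4,4}$ is multiplication in $\mathbb Q[\bar\eta,\bar\xi]$; in $\alpha_{1,4,4},\alpha_{2,4,4},\alpha_{4,4,1},\alpha_{4,4,2}$ an element $a+b\bar\eta+c\bar\xi\in A_{4,4}$ acts as multiplication by its constant term $a$; and $\alpha_{1,1,1},\alpha_{1,1,4},\alpha_{4,1,1},\alpha_{2,2,2},\alpha_{2,2,4},\alpha_{4,2,2},\alpha_{3,3,3}$ are the usual (matrix) products. Elements of $A$ are written as $6\times6$ arrays with block sizes $3,1,1,1$. **The order $\Lambda_{(2)}$.** With $R=\mathbb Z_{(2)}$, $\Lambda_{(2)}$ is the $R$-subalgebra of $A$ consisting of all $$\begin{bmatrix} s_{1,1}&s_{1,2}&s_{1,3}&0&0&t_1\\ s_{2,1}&s_{2,2}&s_{2,3}&0&0&t_2\\ s_{3,1}&s_{3,2}&s_{3,3}&0&0&t_3\\ 0&0&0&u&0&v\\ 0&0&0&0&w&0\\ x_1&x_2&x_3&y&0&z_1+z_2\bar\eta+z_3\bar\xi\end{bmatrix}$$ with $s_{i,j},t_i,u,v,w,x_i,y,z_i\in R$ satisfying $2w-2z_1\equiv z_2\pmod 8$, $z_2\equiv z_3\pmod4$, $z_3\equiv0\pmod 4$; $x_1\equiv x_2\equiv x_3\equiv0\pmod 4$; $y\equiv t_1\equiv t_2\equiv t_3\equiv v\equiv0\pmod2$. **The algebra $\Lambda'_{(2)}$.** Let $\mathrm e_3,\mathrm e_4,\mathrm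 e_5\in\Lambda_{(2)}$ be the elements whose only nonzero entries are: $1$ at $(3,3)$ for $\mathrm e_3$; $1$ at $(4,4)$ for $\mathrm e_4$; $1$ at $(5,5)$ and $1$ at $(6,6)$ for $\mathrm e_5$. Put $\Lambda'_{(2)}=(\mathrm e_3+\mathrm e_4+\mathrm e_5)\Lambda_{(2)}(\mathrm e_3+\mathrm e_4+\mathrm e_5)$. **Path algebra convention.** Paths are composed from left to right: $\alpha\beta$ means first the arrow $\alpha$, then $\beta$; an arrow $\alpha:x\to y$ satisfies $x\alpha y=\alpha$, where the vertices also denote the corresponding idempotents (trivial paths). Parentheses denote the two-sided ideal generated. *)

theory Defs
  imports
    "HOL-Algebra.Sym_Groups"
    "HOL-Algebra.Group_Action"
    "HOL-Algebra.QuotRing"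
    "HOL-Algebra.Module"
    "HOL-Analysis.Finite_Cartesian_Product"
    "HOL-Library.Z2"
    "Graph_Theory.Arc_Walk"
begin

section \<open>Algebras with a distinguished basis\<close>

text \<open>
  Algebras over a commutative ring \<open>'k\<close> (a type; \<^typ>\<open>bit\<close> is the field with two elements) are
  given by the record type \<^typ>\<open>('k, 'b) module\<close>, which provides ring operations and a
  scalar multiplication.

  In \<open>basis_alg S mul u\<close> the underlying module is the free module on the set \<open>S\<close>, i.e. the
  finitely supported functions on \<open>S\<close> (extended by zero).  The product of two basis elements
  \<open>p\<close>, \<open>q\<close> is the basis element \<open>r\<close> if \<open>mul p q = Some r\<close>, and zero if \<open>mul p q = None\<close>.
  The function \<open>u\<close> is the unit element.
\<close>

definition basis_alg ::
    "'s set \<Rightarrow> ('s \<Rightarrow> 's \<Rightarrow> 's option) \<Rightarrow> ('s \<Rightarrow> 'k) \<Rightarrow> ('k::comm_ring_1, 's \<Rightarrow> 'k) module" where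
  "basis_alg S mul u =
     \<lparr>carrier = {f. finite {s. f s \<noteq> 0} \<and> {s. f s \<noteq> 0} \<subseteq> S},
      mult = (\<lambda>f g r. \<Sum>(p, q) \<in> {(p, q). f p \<noteq> 0 \<and> g q \<noteq> 0 \<and> mul p q = Some r}. f p * g q),
      one = u,
      zero = (\<lambda>_. 0),
      add = (\<lambda>f g s. f s + g s),
      smult = (\<lambda>c f s. c * f s)\<rparr>"

definition basis_elem :: "'s \<Rightarrow> 's \<Rightarrow> 'k::comm_ring_1" where
  "basis_elem s = (\<lambda>t. if t = s then 1 else 0)"

definition module_span :: "('k, 'b) module \<Rightarrow> 'b set \<Rightarrow> 'b set" where
  "module_span A X = \<Inter>{W. X \<subseteq> W \<and> W \<subseteq> carrier A \<and> \<zero>\<^bsub>A\<^esub> \<in> W \<and>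
     (\<forall>x\<in>W. \<forall>y\<in>W. x \<oplus>\<^bsub>A\<^esub> y \<in> W) \<and> (\<forall>c. \<forall>x\<in>W. c \<odot>\<^bsub>A\<^esub> x \<in> W)}"

definition quot_alg :: "('k, 'b) module \<Rightarrow> 'b set \<Rightarrow> ('k, 'b set) module" where
  "quot_alg A I = ring.extend (A Quot I)
     (module.fields (\<lambda>c X. \<Union>x\<in>X. I +>\<^bsub>A\<^esub> (c \<odot>\<^bsub>A\<^esub> x)))"

definition alg_iso :: "('k, 'a) module \<Rightarrow> ('k, 'b) module \<Rightarrow> ('a \<Rightarrow> 'b) set" where
  "alg_iso A B = {h \<in> ring_iso A B. \<forall>c. \<forall>x\<in>carrier A. h (c \<odot>\<^bsub>A\<^esub> x) = c \<odot>\<^bsub>B\<^esub> h x}"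


section \<open>Finite bisets and the double Burnside algebra\<close>

record ('g, 'x) biset =
  points :: "'x set"
  lact :: "'g \<Rightarrow> 'x \<Rightarrow> 'x"
  ract :: "'x \<Rightarrow> 'g \<Rightarrow> 'x"

definition finite_biset :: "('g, 'z) monoid_scheme \<Rightarrow> ('g, 'x) biset \<Rightarrow> bool" where
  "finite_biset G M \<longleftrightarrow> finite (points M) \<and>
     (\<forall>g\<in>carrier G. \<forall>m\<in>points M. lact M g m \<in> points M \<and> ract M m g \<in> points M) \<and>
     (\<forall>m\<in>points M. lact M \<one>\<^bsub>G\<^esub> m = m \<and> ract M m \<one>\<^bsub>G\<^esub> = m) \<and>
     (\<forall>g\<in>carrier G. \<forall>h\<in>carrier G. \<forall>m\<in>points M.
        lact M (g \<otimes>\<^bsub>G\<^esub> h) m = lact M g (lact M h m) \<and>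
        ract M m (g \<otimes>\<^bsub>G\<^esub> h) = ract M (ract M m g) h \<and>
        ract M (lact M g m) h = lact M g (ract M m h))"

definition biset_isomorphic ::
    "('g, 'z) monoid_scheme \<Rightarrow> ('g, 'x) biset \<Rightarrow> ('g, 'y) biset \<Rightarrow> bool" where
  "biset_isomorphic G M N \<longleftrightarrow> (\<exists>f. bij_betw f (points M) (points N) \<and>
     (\<forall>g\<in>carrier G. \<forall>m\<in>points M.
        f (lact M g m) = lact N g (f m) \<and> f (ract M m g) = ract N (f m) g))"

text \<open>
  Every finite biset is isomorphic to one whose points are natural numbers.  The isomorphism
  class of \<open>M\<close> is therefore represented by the set of all such bisets isomorphic to \<open>M\<close>,
  whatever the type of the points of \<open>M\<close> is.
\<close>

type_synonym 'g biset_class = "('g, nat) biset set"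

definition biset_class :: "('g, 'z) monoid_scheme \<Rightarrow> ('g, 'x) biset \<Rightarrow> 'g biset_class" where
  "biset_class G M = {N. finite_biset G N \<and> biset_isomorphic G M N}"

definition biset_classes :: "('g, 'z) monoid_scheme \<Rightarrow> 'g biset_class set" where
  "biset_classes G = {biset_class G M | M :: ('g, nat) biset. finite_biset G M}"

definition biset_sum :: "('g, 'x) biset \<Rightarrow> ('g, 'y) biset \<Rightarrow> ('g, 'x + 'y) biset" where
  "biset_sum M N =
     \<lparr>points = points M <+> points N,
      lact = (\<lambda>g. map_sum (lact M g) (lact N g)),
      ract = (\<lambda>x g. map_sum (\<lambda>m. ract M m g) (\<lambda>n. ract N n g) x)\<rparr>"

definition biset_tensor ::
    "('g, 'z) monoid_scheme \<Rightarrow> ('g, 'x) biset \<Rightarrow> ('g, 'y) biset \<Rightarrow> ('g, ('x \<times> 'y) set) biset" where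
  "biset_tensor G M N =
     \<lparr>points = orbits G (points M \<times> points N) (\<lambda>g (m, n). (ract M m (inv\<^bsub>G\<^esub> g), lact N g n)),
      lact = (\<lambda>h. image (\<lambda>(m, n). (lact M h m, n))),
      ract = (\<lambda>X p. (\<lambda>(m, n). (m, ract N n p)) ` X)\<rparr>"

definition regular_biset :: "('g, 'z) monoid_scheme \<Rightarrow> ('g, 'g) biset" where
  "regular_biset G = \<lparr>points = carrier G, lact = mult G, ract = mult G\<rparr>"

definition biset_class_mult ::
    "('g, 'z) monoid_scheme \<Rightarrow> 'g biset_class \<Rightarrow> 'g biset_class \<Rightarrow> 'g biset_class" where
  "biset_class_mult G C D = (\<Union>M\<in>C. \<Union>N\<in>D. biset_class G (biset_tensor G M N))"

text \<open>
  The unit element is the class of \<open>G\<close> itself, viewed as a biset by left and right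
  multiplication.
\<close>

definition free_biset_alg ::
    "('g, 'z) monoid_scheme \<Rightarrow> ('k::comm_ring_1, 'g biset_class \<Rightarrow> 'k) module" where
  "free_biset_alg G = basis_alg (biset_classes G)
     (\<lambda>C D. Some (biset_class_mult G C D)) (basis_elem (biset_class G (regular_biset G)))"

definition biset_sum_relations ::
    "('g, 'z) monoid_scheme \<Rightarrow> ('g biset_class \<Rightarrow> 'k::comm_ring_1) set" where
  "biset_sum_relations G =
     {basis_elem (biset_class G (biset_sum M N)) \<ominus>\<^bsub>free_biset_alg G\<^esub>
        (basis_elem (biset_class G M) \<oplus>\<^bsub>free_biset_alg G\<^esub> basis_elem (biset_class G N))
      | (M :: ('g, nat) biset) (N :: ('g, nat) biset). finite_biset G M \<and> finite_biset G N}"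

definition double_burnside ::
    "('g, 'z) monoid_scheme \<Rightarrow> ('k::comm_ring_1, ('g biset_class \<Rightarrow> 'k) set) module" where
  "double_burnside G =
     quot_alg (free_biset_alg G) (module_span (free_biset_alg G) (biset_sum_relations G))"


section \<open>The algebra \<open>A\<close> and its orders\<close>

text \<open>
  \<open>LocEl a b c\<close> stands for $a + b\bar\eta + c\bar\xi$ in
  $\mathbb{Q}[\eta,\xi]/(\eta^2,\eta\xi,\xi^2)$.
\<close>

datatype loc_alg = LocEl (cf_one: rat) (cf_eta: rat) (cf_xi: rat)

definition loc_add :: "loc_alg \<Rightarrow> loc_alg \<Rightarrow> loc_alg" where
  "loc_add p q = LocEl (cf_one p + cf_one q) (cf_eta p + cf_eta q) (cf_xi p + cf_xi q)"

definition loc_mult :: "loc_alg \<Rightarrow> loc_alg \<Rightarrow> loc_alg" where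
  "loc_mult p q = LocEl (cf_one p * cf_one q)
     (cf_one p * cf_eta q + cf_eta p * cf_one q)
     (cf_one p * cf_xi q + cf_xi p * cf_one q)"

definition loc_scale :: "rat \<Rightarrow> loc_alg \<Rightarrow> loc_alg" where
  "loc_scale r p = LocEl (r * cf_one p) (r * cf_eta p) (r * cf_xi p)"

text \<open>
  \<open>blkij\<close> is the entry in $A_{i,j}$ for $i, j \in \{1,2,3,4\}$; the blocks with
  $A_{i,j} = 0$ are omitted.  Note that the index type \<open>3\<close> has the elements \<open>1, 2, 3\<close>
  (with \<open>3 = 0\<close>).
\<close>

record arr =
  blk11 :: "rat^3^3"
  blk14 :: "rat^3"
  blk22 :: rat
  blk24 :: rat
  blk33 :: rat
  blk41 :: "rat^3"
  blk42 :: rat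
  blk44 :: loc_alg

text \<open>
  In the product below, the maps $\alpha_{1,4,1}$ and $\alpha_{2,4,2}$ contribute nothing, and
  all the other maps $\alpha_{i,j,k}$ between nonzero blocks occur exactly once.
\<close>

definition alg_A :: "arr ring" where
  "alg_A =
     \<lparr>carrier = UNIV,
      mult = (\<lambda>x y.
        \<lparr>blk11 = blk11 x ** blk11 y,
         blk14 = blk11 x *v blk14 y + cf_one (blk44 y) *s blk14 x,
         blk22 = blk22 x * blk22 y,
         blk24 = blk22 x * blk24 y + blk24 x * cf_one (blk44 y),
         blk33 = blk33 x * blk33 y,
         blk41 = blk41 x v* blk11 y + cf_one (blk44 x) *s blk41 y,
         blk42 = blk42 x * blk22 y + cf_one (blk44 x) * blk42 y,
         blk44 = loc_add (loc_scale (scalar_product (blk41 x) (blk14 y)) (LocEl 0 1 0))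
           (loc_add (loc_scale (blk42 x * blk24 y) (LocEl 0 (-12) 1))
             (loc_mult (blk44 x) (blk44 y)))\<rparr>),
      one = \<lparr>blk11 = mat 1, blk14 = 0, blk22 = 1, blk24 = 0, blk33 = 1, blk41 = 0, blk42 = 0,
         blk44 = LocEl 1 0 0\<rparr>,
      zero = \<lparr>blk11 = 0, blk14 = 0, blk22 = 0, blk24 = 0, blk33 = 0, blk41 = 0, blk42 = 0,
         blk44 = LocEl 0 0 0\<rparr>,
      add = (\<lambda>x y.
        \<lparr>blk11 = blk11 x + blk11 y, blk14 = blk14 x + blk14 y, blk22 = blk22 x + blk22 y,
         blk24 = blk24 x + blk24 y, blk33 = blk33 x + blk33 y, blk41 = blk41 x + blk41 y,
         blk42 = blk42 x + blk42 y, blk44 = loc_add (blk44 x) (blk44 y)\<rparr>)\<rparr>"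

definition Z_loc2 :: "rat set" where
  "Z_loc2 = {of_int a / of_int b | a b. odd b}"

definition cong_loc2 :: "rat \<Rightarrow> rat \<Rightarrow> rat \<Rightarrow> bool" where
  "cong_loc2 x y m \<longleftrightarrow> (\<exists>r\<in>Z_loc2. x - y = m * r)"

definition Lambda2 :: "arr set" where
  "Lambda2 = {\<lparr>blk11 = s, blk14 = t, blk22 = u, blk24 = v, blk33 = w, blk41 = x, blk42 = y,
                blk44 = LocEl z1 z2 z3\<rparr>
     | s t u v w x y z1 z2 z3.
       (\<forall>i j. s $ i $ j \<in> Z_loc2) \<and> (\<forall>i. t $ i \<in> Z_loc2) \<and> (\<forall>i. x $ i \<in> Z_loc2) \<and>
       {u, v, w, y, z1, z2, z3} \<subseteq> Z_loc2 \<and>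
       cong_loc2 (2 * w - 2 * z1) z2 8 \<and> cong_loc2 z2 z3 4 \<and> cong_loc2 z3 0 4 \<and>
       (\<forall>i. cong_loc2 (x $ i) 0 4) \<and>
       cong_loc2 y 0 2 \<and> (\<forall>i. cong_loc2 (t $ i) 0 2) \<and> cong_loc2 v 0 2}"

definition idem3 :: arr where
  "idem3 = \<zero>\<^bsub>alg_A\<^esub>\<lparr>blk11 := (\<chi> i j. if i = 3 \<and> j = 3 then 1 else 0)\<rparr>"

definition idem4 :: arr where
  "idem4 = \<zero>\<^bsub>alg_A\<^esub>\<lparr>blk22 := 1\<rparr>"

definition idem5 :: arr where
  "idem5 = \<zero>\<^bsub>alg_A\<^esub>\<lparr>blk33 := 1, blk44 := LocEl 1 0 0\<rparr>"

definition idem345 :: arr where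
  "idem345 = idem3 \<oplus>\<^bsub>alg_A\<^esub> idem4 \<oplus>\<^bsub>alg_A\<^esub> idem5"

definition Lambda2' :: "arr ring" where
  "Lambda2' = alg_A
     \<lparr>carrier := {idem345 \<otimes>\<^bsub>alg_A\<^esub> x \<otimes>\<^bsub>alg_A\<^esub> idem345 | x. x \<in> Lambda2}, one := idem345\<rparr>"

definition two_Lambda2' :: "arr set" where
  "two_Lambda2' = {x \<oplus>\<^bsub>Lambda2'\<^esub> x | x. x \<in> carrier Lambda2'}"

text \<open>
  The scalar multiplication is the only one possible: \<open>0\<close> maps everything to zero (the coset
  \<^term>\<open>two_Lambda2'\<close>) and \<open>1\<close> acts as the identity.
\<close>

definition Lambda2'_mod2 :: "(bit, arr set) module" where
  "Lambda2'_mod2 = ring.extend (Lambda2' Quot two_Lambda2')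
     (module.fields (\<lambda>c X. if c = 1 then X else two_Lambda2'))"


section \<open>Path algebras\<close>

text \<open>
  A quiver is a \<^typ>\<open>('v, 'e) pre_digraph\<close> (which admits loops and multiple arrows).  A path
  from \<open>x\<close> to \<open>y\<close> is a triple \<open>(x, p, y)\<close>, where \<open>p\<close> lists the arrows in the order in which
  they are traversed; \<open>(x, [], x)\<close> is the trivial path at \<open>x\<close>.
\<close>

type_synonym ('v, 'e) path = "'v \<times> 'e list \<times> 'v"

definition paths :: "('v, 'e) pre_digraph \<Rightarrow> ('v, 'e) path set" where
  "paths Q = {(x, p, y). pre_digraph.awalk Q x p y}"

fun path_comp :: "('v, 'e) path \<Rightarrow> ('v, 'e) path \<Rightarrow> ('v, 'e) path option" where
  "path_comp (x, p, y) (x', p', y') = (if y = x' then Some (x, p @ p', y') else None)"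

definition path_alg :: "('v, 'e) pre_digraph \<Rightarrow> ('k::comm_ring_1, ('v, 'e) path \<Rightarrow> 'k) module" where
  "path_alg Q = basis_alg (paths Q) path_comp
     (\<lambda>(x, p, y). if x \<in> verts Q \<and> p = [] \<and> x = y then 1 else 0)"

definition arrow :: "('v, 'e) pre_digraph \<Rightarrow> 'e \<Rightarrow> ('v, 'e) path \<Rightarrow> 'k::comm_ring_1" where
  "arrow Q a = basis_elem (tail Q a, [a], head Q a)"

datatype Psi_vertex = E3 | E4 | E5

datatype Psi_arrow = T1 | T2 | T3 | T4 | T7

fun Psi_tail :: "Psi_arrow \<Rightarrow> Psi_vertex" where
  "Psi_tail T1 = E5" | "Psi_tail T2 = E3" | "Psi_tail T3 = E5" | "Psi_tail T4 = E4"
| "Psi_tail T7 = E5"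

fun Psi_head :: "Psi_arrow \<Rightarrow> Psi_vertex" where
  "Psi_head T1 = E3" | "Psi_head T2 = E5" | "Psi_head T3 = E4" | "Psi_head T4 = E5"
| "Psi_head T7 = E5"

definition Psi :: "(Psi_vertex, Psi_arrow) pre_digraph" where
  "Psi = \<lparr>verts = UNIV, arcs = UNIV, tail = Psi_tail, head = Psi_head\<rparr>"

definition F2Psi :: "(bit, (Psi_vertex, Psi_arrow) path \<Rightarrow> bit) module" where
  "F2Psi = path_alg Psi"

definition Psi_relations :: "((Psi_vertex, Psi_arrow) path \<Rightarrow> bit) set" where
  "Psi_relations = (let t = arrow Psi in
     {t T2 \<otimes>\<^bsub>F2Psi\<^esub> t T1, t T2 \<otimes>\<^bsub>F2Psi\<^esub> t T3, t T2 \<otimes>\<^bsub>F2Psi\<^esub> t T7,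
      t T4 \<otimes>\<^bsub>F2Psi\<^esub> t T1, t T4 \<otimes>\<^bsub>F2Psi\<^esub> t T3, t T4 \<otimes>\<^bsub>F2Psi\<^esub> t T7,
      t T7 \<otimes>\<^bsub>F2Psi\<^esub> t T1, t T7 \<otimes>\<^bsub>F2Psi\<^esub> t T3,
      (t T7 \<otimes>\<^bsub>F2Psi\<^esub> t T7) \<ominus>\<^bsub>F2Psi\<^esub> (t T1 \<otimes>\<^bsub>F2Psi\<^esub> t T2)})"


section \<open>Morita equivalence\<close>

locale left_module = R?: ring R + M?: abelian_group M
    for R (structure) and M (structure) +
  assumes smult_closed: "\<lbrakk>a \<in> carrier R; x \<in> carrier M\<rbrakk> \<Longrightarrow> a \<odot>\<^bsub>M\<^esub> x \<in> carrier M"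
    and smult_l_distr: "\<lbrakk>a \<in> carrier R; b \<in> carrier R; x \<in> carrier M\<rbrakk> \<Longrightarrow>
      (a \<oplus> b) \<odot>\<^bsub>M\<^esub> x = a \<odot>\<^bsub>M\<^esub> x \<oplus>\<^bsub>M\<^esub> b \<odot>\<^bsub>M\<^esub> x"
    and smult_r_distr: "\<lbrakk>a \<in> carrier R; x \<in> carrier M; y \<in> carrier M\<rbrakk> \<Longrightarrow>
      a \<odot>\<^bsub>M\<^esub> (x \<oplus>\<^bsub>M\<^esub> y) = a \<odot>\<^bsub>M\<^esub> x \<oplus>\<^bsub>M\<^esub> a \<odot>\<^bsub>M\<^esub> y"
    and smult_assoc: "\<lbrakk>a \<in> carrier R; b \<in> carrier R; x \<in> carrier M\<rbrakk> \<Longrightarrow>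
      (a \<otimes> b) \<odot>\<^bsub>M\<^esub> x = a \<odot>\<^bsub>M\<^esub> (b \<odot>\<^bsub>M\<^esub> x)"
    and smult_one: "x \<in> carrier M \<Longrightarrow> \<one> \<odot>\<^bsub>M\<^esub> x = x"

text \<open>
  The objects of the category of left \<open>R\<close>-modules on the type \<open>'m\<close> are the left \<open>R\<close>-modules whose
  elements have type \<open>'m\<close> (only carrier, zero, addition and scalar multiplication of the record
  matter).  Morphisms are extensional functions, so that equal morphisms are equal functions.
\<close>

definition lmod_hom ::
    "('a, 'z) ring_scheme \<Rightarrow> ('a, 'm) module \<Rightarrow> ('a, 'n) module \<Rightarrow> ('m \<Rightarrow> 'n) set" where
  "lmod_hom R M N = {f \<in> carrier M \<rightarrow>\<^sub>E carrier N.
     (\<forall>x\<in>carrier M. \<forall>y\<in>carrier M. f (x \<oplus>\<^bsub>M\<^esub> y) = f x \<oplus>\<^bsub>N\<^esub> f y) \<and>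
     (\<forall>a\<in>carrier R. \<forall>x\<in>carrier M. f (a \<odot>\<^bsub>M\<^esub> x) = a \<odot>\<^bsub>N\<^esub> f x)}"

text \<open>
  A functor consists of a map \<open>Fo\<close> on objects and a map \<open>Fm\<close> on morphisms; \<open>Fm M N\<close> acts on the
  morphisms from \<open>M\<close> to \<open>N\<close>.
\<close>

definition additive_functor ::
    "('a, 'y) ring_scheme \<Rightarrow> ('b, 'z) ring_scheme \<Rightarrow> (('a, 'm) module \<Rightarrow> ('b, 'm) module) \<Rightarrow>
     (('a, 'm) module \<Rightarrow> ('a, 'm) module \<Rightarrow> ('m \<Rightarrow> 'm) \<Rightarrow> ('m \<Rightarrow> 'm)) \<Rightarrow> bool" where
  "additive_functor R S Fo Fm \<longleftrightarrow>
     (\<forall>M. left_module R M \<longrightarrow> left_module S (Fo M)) \<and>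
     (\<forall>M N. left_module R M \<and> left_module R N \<longrightarrow>
        (\<forall>f\<in>lmod_hom R M N. Fm M N f \<in> lmod_hom S (Fo M) (Fo N))) \<and>
     (\<forall>M. left_module R M \<longrightarrow> Fm M M (\<lambda>x\<in>carrier M. x) = (\<lambda>x\<in>carrier (Fo M). x)) \<and>
     (\<forall>L M N. left_module R L \<and> left_module R M \<and> left_module R N \<longrightarrow>
        (\<forall>f\<in>lmod_hom R L M. \<forall>g\<in>lmod_hom R M N.
           Fm L N (compose (carrier L) g f) = compose (carrier (Fo L)) (Fm M N g) (Fm L M f))) \<and>
     (\<forall>M N. left_module R M \<and> left_module R N \<longrightarrow>
        (\<forall>f\<in>lmod_hom R M N. \<forall>g\<in>lmod_hom R M N.
           Fm M N (\<lambda>x\<in>carrier M. f x \<oplus>\<^bsub>N\<^esub> g x) =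
           (\<lambda>x\<in>carrier (Fo M). Fm M N f x \<oplus>\<^bsub>Fo N\<^esub> Fm M N g x)))"

text \<open>\<open>\<eta>\<close> is a natural isomorphism from the identity functor to the endofunctor \<open>(Ho, Hm)\<close>.\<close>

definition natural_iso_from_id ::
    "('a, 'z) ring_scheme \<Rightarrow> (('a, 'm) module \<Rightarrow> ('a, 'm) module) \<Rightarrow>
     (('a, 'm) module \<Rightarrow> ('a, 'm) module \<Rightarrow> ('m \<Rightarrow> 'm) \<Rightarrow> ('m \<Rightarrow> 'm)) \<Rightarrow>
     (('a, 'm) module \<Rightarrow> 'm \<Rightarrow> 'm) \<Rightarrow> bool" where
  "natural_iso_from_id R Ho Hm \<eta> \<longleftrightarrow>
     (\<forall>M. left_module R M \<longrightarrow>
        \<eta> M \<in> lmod_hom R M (Ho M) \<and> bij_betw (\<eta> M) (carrier M) (carrier (Ho M))) \<and>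
     (\<forall>M N. left_module R M \<and> left_module R N \<longrightarrow>
        (\<forall>f\<in>lmod_hom R M N.
           compose (carrier M) (\<eta> N) f = compose (carrier M) (Hm M N f) (\<eta> M)))"

text \<open>
  Two rings are Morita equivalent if their categories of left modules are equivalent.  As there is
  no type of all modules, the type \<open>'m\<close> of the module elements serves as the universe; it is a
  parameter, to be quantified universally over all infinite types.  (Finite types have to be
  excluded: the modules on a finite type \<open>'m\<close> are those with at most \<open>CARD('m)\<close> elements, and
  bounding the size by a finite number is not invariant under Morita equivalence.)
  For algebras over \<^typ>\<open>bit\<close>, additive functors are the same as linear ones.  The requirement that
  \<open>R\<close> and \<open>S\<close> are rings keeps the definition from being vacuous (without it \<^const>\<open>left_module\<close>
  would have no instances).
\<close>

definition morita_equivalent ::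
    "'m itself \<Rightarrow> ('a, 'y) ring_scheme \<Rightarrow> ('b, 'z) ring_scheme \<Rightarrow> bool" where
  "morita_equivalent _ R S \<longleftrightarrow> ring R \<and> ring S \<and>
     (\<exists>(Fo :: ('a, 'm) module \<Rightarrow> ('b, 'm) module) Fm Go Gm \<eta> \<epsilon>.
        additive_functor R S Fo Fm \<and> additive_functor S R Go Gm \<and>
        natural_iso_from_id R (\<lambda>M. Go (Fo M)) (\<lambda>M N f. Gm (Fo M) (Fo N) (Fm M N f)) \<eta> \<and>
        natural_iso_from_id S (\<lambda>N. Fo (Go N)) (\<lambda>M N f. Fm (Go M) (Go N) (Gm M N f)) \<epsilon>)"

end

theory Submission
  imports Defs "HOL-Library.Product_Plus" "HOL-Analysis.Cartesian_Space"
begin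

text \<open>
  Both algebras are compared with an explicit algebra \<open>lam\<close> of dimension 22 over the field with two
  elements, the reduction of $\Lambda_{(2)}$ modulo 2, and with its corner at the image \<open>lam_e\<close> of
  $\mathrm{e}_3 + \mathrm{e}_4 + \mathrm{e}_5$.  The reduction of $\Lambda'_{(2)}$ and the path algebra modulo
  its relations are identified with this corner, because both have a basis of ten elements with the same
  products.  Since the diagonal matrix units of $\mathbb{Q}^{3\times3}$ are equivalent to $\mathrm{e}_3$, the
  idempotent is full, so the corner is Morita equivalent to \<open>lam\<close>.

  Moreover \<open>lam\<close> is isomorphic to the double Burnside algebra: a $(G,G)$-biset is a set with an action
  of $G \times G$, the stabilizer of a point $[m,n]$ of $M \times_G N$ is the relational composite of the stabilizers of $m$
  and $n$, and the orbits on the tensor product of two transitive bisets correspond to the double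
  cosets of the projections of the stabilizers (Mackey's formula).  So an assignment of elements of \<open>lam\<close> to the 22
  conjugacy classes of subgroups of $S_3 \times S_3$ is multiplicative as soon as it satisfies finitely many
  identities.  A subgroup of $S_3 \times S_3$ is determined up to conjugation by the kinds of pairs it contains.
\<close>

section \<open>Corner rings and quotients by kernels\<close>

text \<open>Every quotient is reached through a surjection onto a ring \<open>corner e\<close>
  inside one type of class \<open>ring_1\<close>: calculations run in the type class, while the
  record meets the statements about quotients and modules; \<open>corner 1\<close> is the whole
  ring. The pattern is always the same: a multiplicative map onto a corner whose kernel is the
  subspace divided out. For the kernel, a section assigns a normal form to each value, and each
  basis element is congruent to the normal form of its value. The ring axioms then pass from the
  corner to the quotient; in particular, products of classes of bisets inherit their associativity
  from \<open>lam\<close>.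

  The hard map is the one on bisets. The values of the 22 transitive ones are given outright, and
  what remains is to check 22 * 22 products against Mackey's formula and to invert a matrix of size
  22. The algebras of dimension 22 and 10 are not isomorphic: \<open>lam\<close> contains a block of
  3 by 3 matrices, of which the corner keeps one diagonal entry. This difference is what Morita
  equivalence absorbs.\<close>

definition corner :: "'t::ring_1 \<Rightarrow> 't ring" where
  "corner e = \<lparr>carrier = {x. e * x * e = x}, mult = (*), one = e, zero = 0, add = (+)\<rparr>"

lemma corner_sel [simp]:
  "mult (corner e) = (*)" "one (corner e) = e" "zero (corner e) = 0" "add (corner e) = (+)"
  "x \<in> carrier (corner e) \<longleftrightarrow> e * x * e = x"
  by (simp_all add: corner_def)

lemma carrier_corner_1 [simp]: "carrier (corner (1::'t::ring_1)) = UNIV"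
  by (simp add: corner_def)

lemma corner_absorb:
  fixes e :: "'t::ring_1"
  assumes "e * e = e" "x \<in> carrier (corner e)"
  shows "e * x = x" "x * e = x"
proof -
  have "e * (e * x * e) = e * x * e" "(e * x * e) * e = e * x * e"
    by (metis assms(1) mult.assoc)+
  with assms(2) show "e * x = x" "x * e = x" by auto
qed

lemma corner_memI:
  fixes e :: "'t::ring_1"
  assumes "e * x = x" "x * e = x"
  shows "x \<in> carrier (corner e)"
  using assms by simp

lemma ring_corner:
  fixes e :: "'t::ring_1"
  assumes "e * e = e"
  shows "ring (corner e)"
proof (rule ringI)
  show "abelian_group (corner e)"
  proof (rule abelian_groupI)
    fix x assume "x \<in> carrier (corner e)"
    then have "- x \<in> carrier (corner e)" by simp
    then show "\<exists>y\<in>carrier (corner e). y \<oplus>\<^bsub>corner e\<^esub> x = \<zero>\<^bsub>corner e\<^esub>"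
      by (intro bexI[of _ "- x"]) auto
  qed (auto simp: algebra_simps)
  show "monoid (corner e)"
  proof (rule monoidI)
    fix x y assume "x \<in> carrier (corner e)" "y \<in> carrier (corner e)"
    then have "e * x = x" "y * e = y"
      using corner_absorb[OF assms] by blast+
    then have "e * (x * y) = x * y" "(x * y) * e = x * y"
      by (metis mult.assoc)+
    then show "x \<otimes>\<^bsub>corner e\<^esub> y \<in> carrier (corner e)"
      unfolding corner_sel(1) by (rule corner_memI)
  next
    fix x assume "x \<in> carrier (corner e)"
    then show "\<one>\<^bsub>corner e\<^esub> \<otimes>\<^bsub>corner e\<^esub> x = x" "x \<otimes>\<^bsub>corner e\<^esub> \<one>\<^bsub>corner e\<^esub> = x"
      unfolding corner_sel(1,2) using corner_absorb[OF assms] by blast+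
  qed (simp_all add: assms mult.assoc)
qed (auto simp: algebra_simps)

text \<open>The fibres of \<open>h\<close> are the cosets of \<open>I\<close>, and \<open>B\<close>
  supplies the ring axioms: \<open>A\<close> enters as an additive group with a closed product,
  which suits the free algebra on bisets and the order. The isomorphism runs from \<open>B\<close>
  to the fibres, so that the operations on cosets are computed fibre by fibre.\<close>

lemma quot_by_kernel:
  assumes "abelian_group A" and B: "ring B"
    and mult: "\<And>x y. x \<in> carrier A \<Longrightarrow> y \<in> carrier A \<Longrightarrow> x \<otimes>\<^bsub>A\<^esub> y \<in> carrier A"
    and one: "\<one>\<^bsub>A\<^esub> \<in> carrier A"
    and h: "\<And>x. x \<in> carrier A \<Longrightarrow> h x \<in> carrier B"
    and h_add: "\<And>x y. x \<in> carrier A \<Longrightarrow> y \<in> carrier A \<Longrightarrow> h (x \<oplus>\<^bsub>A\<^esub> y) = h x \<oplus>\<^bsub>B\<^esub> h y"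
    and h_mult: "\<And>x y. x \<in> carrier A \<Longrightarrow> y \<in> carrier A \<Longrightarrow> h (x \<otimes>\<^bsub>A\<^esub> y) = h x \<otimes>\<^bsub>B\<^esub> h y"
    and h_one: "h \<one>\<^bsub>A\<^esub> = \<one>\<^bsub>B\<^esub>"
    and surj: "\<And>b. b \<in> carrier B \<Longrightarrow> \<exists>a\<in>carrier A. h a = b"
    and I: "I = {a \<in> carrier A. h a = \<zero>\<^bsub>B\<^esub>}"
  shows "a \<in> carrier A \<Longrightarrow> I +>\<^bsub>A\<^esub> a = {x \<in> carrier A. h x = h a}" (is "_ \<Longrightarrow> ?coset")
    and "(\<lambda>b. {a \<in> carrier A. h a = b}) \<in> ring_iso B (A Quot I)" (is ?iso)
    and "ring (A Quot I)"
proof -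
  interpret A: abelian_group A by fact
  interpret B: ring B by fact
  define f where "f b = {a \<in> carrier A. h a = b}" for b
  have h_zero: "h \<zero>\<^bsub>A\<^esub> = \<zero>\<^bsub>B\<^esub>"
  proof -
    have "h \<zero>\<^bsub>A\<^esub> \<oplus>\<^bsub>B\<^esub> h \<zero>\<^bsub>A\<^esub> = h \<zero>\<^bsub>A\<^esub>"
      using h_add[of "\<zero>\<^bsub>A\<^esub>" "\<zero>\<^bsub>A\<^esub>"] by simp
    then show ?thesis using h[of "\<zero>\<^bsub>A\<^esub>"] B.add.r_cancel_one by auto
  qed
  have h_minus: "h (\<ominus>\<^bsub>A\<^esub> x) = \<ominus>\<^bsub>B\<^esub> h x" if "x \<in> carrier A" for x
  proof -
    have "h (\<ominus>\<^bsub>A\<^esub> x) \<oplus>\<^bsub>B\<^esub> h x = \<zero>\<^bsub>B\<^esub>"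
      using h_add[of "\<ominus>\<^bsub>A\<^esub> x" x] that h_zero by (simp add: A.l_neg)
    then show ?thesis using that h B.minus_equality by simp
  qed
  show coset: "I +>\<^bsub>A\<^esub> a = {x \<in> carrier A. h x = h a}" if a: "a \<in> carrier A" for a
  proof
    show "I +>\<^bsub>A\<^esub> a \<subseteq> {x \<in> carrier A. h x = h a}"
      using a h h_add by (auto simp: I a_r_coset_def')
    show "{x \<in> carrier A. h x = h a} \<subseteq> I +>\<^bsub>A\<^esub> a"
    proof
      fix x assume "x \<in> {x \<in> carrier A. h x = h a}"
      then have x: "x \<in> carrier A" "h x = h a" by auto
      then have "x \<ominus>\<^bsub>A\<^esub> a \<in> I"
        using a h h_add h_minus by (simp add: I a_minus_def B.r_neg)
      moreover have "x = (x \<ominus>\<^bsub>A\<^esub> a) \<oplus>\<^bsub>A\<^esub> a"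
        using x a by (simp add: a_minus_def A.a_assoc A.l_neg)
      ultimately show "x \<in> I +>\<^bsub>A\<^esub> a" by (auto simp: a_r_coset_def')
    qed
  qed
  have f_coset: "f (h a) = I +>\<^bsub>A\<^esub> a" if "a \<in> carrier A" for a
    using coset that by (simp add: f_def)
  have carr: "carrier (A Quot I) = {I +>\<^bsub>A\<^esub> a | a. a \<in> carrier A}"
    by (auto simp: FactRing_def A_RCOSETS_def')
  have "f \<in> ring_iso B (A Quot I)"
  proof (rule ring_iso_memI)
    fix b assume "b \<in> carrier B"
    then obtain a where "a \<in> carrier A" "h a = b" using surj by auto
    then show "f b \<in> carrier (A Quot I)" using f_coset carr by auto
  next
    fix b c assume "b \<in> carrier B" "c \<in> carrier B"
    then obtain x y where xy: "x \<in> carrier A" "h x = b" "y \<in> carrier A" "h y = c"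
      using surj by meson
    have "rcoset_mult A I (f b) (f c) = (\<Union>x'\<in>f b. \<Union>y'\<in>f c. I +>\<^bsub>A\<^esub> (x' \<otimes>\<^bsub>A\<^esub> y'))"
      by (simp add: rcoset_mult_def)
    also have "\<dots> = (\<Union>x'\<in>f b. \<Union>y'\<in>f c. f (b \<otimes>\<^bsub>B\<^esub> c))"
      by (intro SUP_cong refl) (auto simp: f_def coset mult h_mult)
    \<comment> \<open>The product of cosets is a union over all pairs of representatives; both
      fibres are nonempty, so the constant union collapses.\<close>
    also have "\<dots> = f (b \<otimes>\<^bsub>B\<^esub> c)"
      using xy by (auto simp: f_def)
    finally show "f (b \<otimes>\<^bsub>B\<^esub> c) = f b \<otimes>\<^bsub>A Quot I\<^esub> f c"
      by (simp add: FactRing_def)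
    have "f b <+>\<^bsub>A\<^esub> f c = f (b \<oplus>\<^bsub>B\<^esub> c)"
    proof
      show "f b <+>\<^bsub>A\<^esub> f c \<subseteq> f (b \<oplus>\<^bsub>B\<^esub> c)"
        by (auto simp: f_def set_add_def' h_add)
      show "f (b \<oplus>\<^bsub>B\<^esub> c) \<subseteq> f b <+>\<^bsub>A\<^esub> f c"
      proof
        fix z assume z: "z \<in> f (b \<oplus>\<^bsub>B\<^esub> c)"
        have "h (\<ominus>\<^bsub>A\<^esub> x \<oplus>\<^bsub>A\<^esub> z) = c"
          using z xy h[OF xy(1)] h[OF xy(3)]
          by (simp add: f_def h_add h_minus B.a_assoc[symmetric] B.l_neg)
        moreover have "z = x \<oplus>\<^bsub>A\<^esub> (\<ominus>\<^bsub>A\<^esub> x \<oplus>\<^bsub>A\<^esub> z)"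
          using z xy by (simp add: f_def A.a_assoc[symmetric] A.r_neg)
        moreover have "x \<in> f b" "\<ominus>\<^bsub>A\<^esub> x \<oplus>\<^bsub>A\<^esub> z \<in> f c"
          using z xy calculation(1) by (simp_all add: f_def)
        ultimately show "z \<in> f b <+>\<^bsub>A\<^esub> f c"
          unfolding set_add_def' by blast
      qed
    qed
    then show "f (b \<oplus>\<^bsub>B\<^esub> c) = f b \<oplus>\<^bsub>A Quot I\<^esub> f c"
      by (simp add: FactRing_def)
  next
    show "f \<one>\<^bsub>B\<^esub> = \<one>\<^bsub>A Quot I\<^esub>"
      using f_coset[OF one] h_one by (simp add: FactRing_def)
    show "bij_betw f (carrier B) (carrier (A Quot I))"
    proof (rule bij_betw_imageI)
      show "inj_on f (carrier B)"
      proof (rule inj_onI)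
        fix b c assume bc: "b \<in> carrier B" "c \<in> carrier B" "f b = f c"
        then obtain a where "a \<in> f b" using surj by (auto simp: f_def)
        with bc show "b = c" by (auto simp: f_def)
      qed
      show "f ` carrier B = carrier (A Quot I)"
      proof
        show "f ` carrier B \<subseteq> carrier (A Quot I)"
          unfolding carr using surj f_coset by fast
        show "carrier (A Quot I) \<subseteq> f ` carrier B"
          unfolding carr using h f_coset[symmetric] by auto
      qed
    qed
  qed
  then show ?iso by (simp add: f_def[abs_def])
  moreover have "f \<in> ring_iso B (A Quot I)"
    by fact
  \<comment> \<open>Transporting the ring structure overwrites the field \<open>zero\<close> by the
    image of zero. This is the fibre over zero, that is \<open>I\<close>, already the zero of the
    quotient.\<close>
  ultimately have "ring ((A Quot I)\<lparr>zero := f \<zero>\<^bsub>B\<^esub>\<rparr>)"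
    using B.ring_iso_imp_img_ring[of f "A Quot I"] by blast
  moreover have "(A Quot I)\<lparr>zero := f \<zero>\<^bsub>B\<^esub>\<rparr> = A Quot I"
    by (simp add: FactRing_def f_def I)
  ultimately show "ring (A Quot I)"
    by simp
qed

lemma quot_alg_sel [simp]:
  "carrier (quot_alg A I) = carrier (A Quot I)" "mult (quot_alg A I) = mult (A Quot I)"
  "one (quot_alg A I) = one (A Quot I)" "zero (quot_alg A I) = zero (A Quot I)"
  "add (quot_alg A I) = add (A Quot I)" "c \<odot>\<^bsub>quot_alg A I\<^esub> X = (\<Union>x\<in>X. I +>\<^bsub>A\<^esub> (c \<odot>\<^bsub>A\<^esub> x))"
  by (simp_all add: quot_alg_def ring.defs module.defs)

lemma ring_iso_cong:
  assumes "f \<in> ring_iso B Q" "carrier Q' = carrier Q" "mult Q' = mult Q" "one Q' = one Q" "add Q' = add Q"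
  shows "f \<in> ring_iso B Q'"
  using assms unfolding ring_iso_def ring_hom_def by simp

text \<open>Membership in \<open>ring_iso\<close> says nothing about the field \<open>zero\<close>
  of the target record, hence the third assumption.\<close>

lemma ring_transfer_iso:
  fixes Q :: "('b, 'c) module"
  assumes "ring B" "f \<in> ring_iso B Q" "f \<zero>\<^bsub>B\<^esub> = \<zero>\<^bsub>Q\<^esub>"
  shows "ring Q"
proof -
  have "ring (Q\<lparr>zero := f \<zero>\<^bsub>B\<^esub>\<rparr>)" by (rule ring.ring_iso_imp_img_ring[OF assms(1,2)])
  moreover have "Q\<lparr>zero := f \<zero>\<^bsub>B\<^esub>\<rparr> = Q" by (simp add: assms(3))
  ultimately show ?thesis by simp
qed

lemma
  shows module_span_superset: "x \<in> X \<Longrightarrow> x \<in> module_span A X"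
    and module_span_zero: "\<zero>\<^bsub>A\<^esub> \<in> module_span A X"
    and module_span_add: "x \<in> module_span A X \<Longrightarrow> y \<in> module_span A X \<Longrightarrow> x \<oplus>\<^bsub>A\<^esub> y \<in> module_span A X"
    and module_span_least: "X \<subseteq> W \<Longrightarrow> W \<subseteq> carrier A \<Longrightarrow> \<zero>\<^bsub>A\<^esub> \<in> W \<Longrightarrow> (\<And>x y. x \<in> W \<Longrightarrow> y \<in> W \<Longrightarrow> x \<oplus>\<^bsub>A\<^esub> y \<in> W) \<Longrightarrow>
      (\<And>c x. x \<in> W \<Longrightarrow> c \<odot>\<^bsub>A\<^esub> x \<in> W) \<Longrightarrow> module_span A X \<subseteq> W"
  unfolding module_span_def by auto

section \<open>Morita equivalence with the corner of a full idempotent\<close>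

text \<open>An infinite set is in bijection with its square, so the finitely many values of an
  extensional function are packed into one element by repeated pairing.\<close>

lemma finite_PiE_encode:
  assumes "finite X" and inf: "infinite (UNIV :: 'm set)"
  obtains enc :: "('a \<Rightarrow> 'm) \<Rightarrow> 'm" where "inj_on enc (X \<rightarrow>\<^sub>E UNIV)"
proof -
  obtain p :: "'m \<times> 'm \<Rightarrow> 'm" where p: "inj p"
    using card_of_Times_same_infinite[OF inf] unfolding card_of_ordIso[symmetric]
    by (auto simp: bij_betw_def)
  have "\<exists>enc :: ('a \<Rightarrow> 'm) \<Rightarrow> 'm. inj_on enc (X \<rightarrow>\<^sub>E UNIV)"
    using assms(1)
  proof induction
    case empty
    show ?case by (auto simp: inj_on_def)
  next
    case (insert x X)
    then obtain enc :: "('a \<Rightarrow> 'm) \<Rightarrow> 'm" where enc: "inj_on enc (X \<rightarrow>\<^sub>E UNIV)" by blast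
    have "inj_on (\<lambda>v. p (v x, enc (restrict v X))) (insert x X \<rightarrow>\<^sub>E UNIV)"
    proof (rule inj_onI)
      fix v w :: "'a \<Rightarrow> 'm"
      assume vw: "v \<in> insert x X \<rightarrow>\<^sub>E UNIV" "w \<in> insert x X \<rightarrow>\<^sub>E UNIV"
        and eq: "p (v x, enc (restrict v X)) = p (w x, enc (restrict w X))"
      then have "v x = w x" "enc (restrict v X) = enc (restrict w X)"
        using injD[OF p eq] by auto
      moreover from this(2) have "restrict v X = restrict w X"
        by (rule inj_onD[OF enc]) auto
      ultimately have "v y = w y" if "y \<in> insert x X" for y
        using that by (metis insert_iff restrict_apply')
      then show "v = w" by (rule PiE_ext[OF vw])
    qed
    then show ?case by blast
  qed
  with that show thesis by blast
qed

context left_module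
begin

lemma smult_r_null: "a \<in> carrier R \<Longrightarrow> a \<odot>\<^bsub>M\<^esub> \<zero>\<^bsub>M\<^esub> = \<zero>\<^bsub>M\<^esub>"
  by (metis M.add.r_cancel_one M.zero_closed M.l_zero smult_closed smult_r_distr)

lemma smult_r_minus:
  assumes "a \<in> carrier R" "x \<in> carrier M"
  shows "a \<odot>\<^bsub>M\<^esub> (\<ominus>\<^bsub>M\<^esub> x) = \<ominus>\<^bsub>M\<^esub> (a \<odot>\<^bsub>M\<^esub> x)"
  by (metis M.minus_equality M.add.inv_closed M.l_neg assms smult_closed smult_r_distr smult_r_null)

end

text \<open>For a full idempotent $e$, with $\sum p e q = 1$ over the pairs of the list \<open>pq\<close>, the functor
  $M \mapsto eM$ has the quasi-inverse $N \mapsto \mathrm{Hom}_{eTe}(eT, N)$.  The map \<open>enc\<close> codes functions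
  on $eT$ by elements of the universe \<open>'m\<close>, which is possible for infinite \<open>'m\<close> as $eT$ is finite.\<close>

locale full_corner =
  fixes e :: "'t::ring_1" and pq :: "('t \<times> 't) list"
    and R :: "('a, 'y) ring_scheme" and S :: "('b, 'z) ring_scheme" and \<phi> :: "'t \<Rightarrow> 'a" and \<psi> :: "'t \<Rightarrow> 'b"
    and enc :: "('t \<Rightarrow> 'm) \<Rightarrow> 'm"
  assumes idem: "e * e = e"
    and full: "(\<Sum>(p, q)\<leftarrow>pq. p * e * q) = 1"
    and ring_R: "ring R" and ring_S: "ring S"
    and iso_R: "\<phi> \<in> ring_iso (corner 1) R" and iso_S: "\<psi> \<in> ring_iso (corner e) S"
    and enc: "inj_on enc ({x. e * x = x} \<rightarrow>\<^sub>E UNIV)"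
begin

text \<open>\<open>X\<close> is \<open>eT\<close> and \<open>C\<close> is \<open>eTe\<close>. The
  left action of \<open>C\<close> on \<open>X\<close> defines the homomorphisms into a module over
  the corner, and the right action of the whole ring makes these a left module again.\<close>

definition X :: "'t set" where "X = {x. e * x = x}"

definition C :: "'t set" where "C = {x. e * x = x \<and> x * e = x}"

lemma carrier_corner: "carrier (corner e) = C"
proof -
  have "e * x = x \<and> x * e = x" if "e * x * e = x" for x
    using corner_absorb[OF idem] that by simp
  then show ?thesis by (auto simp: corner_def C_def)
qed

lemma phi [simp]:
  "\<phi> x \<in> carrier R" "\<phi> (x * y) = \<phi> x \<otimes>\<^bsub>R\<^esub> \<phi> y" "\<phi> (x + y) = \<phi> x \<oplus>\<^bsub>R\<^esub> \<phi> y" "\<phi> 1 = \<one>\<^bsub>R\<^esub>"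
  using iso_R ring_iso_memE[OF iso_R] by simp_all

lemma psi [simp]:
  "x \<in> C \<Longrightarrow> \<psi> x \<in> carrier S"
  "x \<in> C \<Longrightarrow> y \<in> C \<Longrightarrow> \<psi> (x * y) = \<psi> x \<otimes>\<^bsub>S\<^esub> \<psi> y"
  "x \<in> C \<Longrightarrow> y \<in> C \<Longrightarrow> \<psi> (x + y) = \<psi> x \<oplus>\<^bsub>S\<^esub> \<psi> y"
  "\<psi> e = \<one>\<^bsub>S\<^esub>"
  using ring_iso_memE[OF iso_S, unfolded carrier_corner corner_sel(1-4)] by blast+

definition \<phi>i where "\<phi>i = inv_into UNIV \<phi>"
definition \<psi>i where "\<psi>i = inv_into C \<psi>"

lemma bij_phi: "bij_betw \<phi> UNIV (carrier R)"
  using ring_iso_memE(5)[OF iso_R] by simp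

lemma bij_psi: "bij_betw \<psi> C (carrier S)"
  using ring_iso_memE(5)[OF iso_S] carrier_corner by simp

lemma phii [simp]: "\<phi>i (\<phi> x) = x" "r \<in> carrier R \<Longrightarrow> \<phi> (\<phi>i r) = r"
  using bij_phi unfolding \<phi>i_def
  by (auto simp: bij_betw_def intro: f_inv_into_f)

lemma psii [simp]:
  "x \<in> C \<Longrightarrow> \<psi>i (\<psi> x) = x" "s \<in> carrier S \<Longrightarrow> \<psi>i s \<in> C" "s \<in> carrier S \<Longrightarrow> \<psi> (\<psi>i s) = s"
  using bij_psi unfolding \<psi>i_def
  by (auto simp: bij_betw_def intro: f_inv_into_f inv_into_into)

lemma phii_hom:
  assumes "r \<in> carrier R" "s \<in> carrier R"
  shows "\<phi>i (r \<oplus>\<^bsub>R\<^esub> s) = \<phi>i r + \<phi>i s" "\<phi>i (r \<otimes>\<^bsub>R\<^esub> s) = \<phi>i r * \<phi>i s"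
  by (metis assms phi(3) phii, metis assms phi(2) phii)

lemma phii_one: "\<phi>i \<one>\<^bsub>R\<^esub> = 1"
  by (metis phi(4) phii(1))

lemma C_closed: "x \<in> C \<Longrightarrow> y \<in> C \<Longrightarrow> x * y \<in> C" "x \<in> C \<Longrightarrow> y \<in> C \<Longrightarrow> x + y \<in> C" "e \<in> C"
  "x \<in> C \<Longrightarrow> x \<in> X"
  using idem by (auto simp: C_def X_def algebra_simps) (metis mult.assoc)

lemma X_closed: "x \<in> X \<Longrightarrow> y \<in> X \<Longrightarrow> x + y \<in> X" "x \<in> X \<Longrightarrow> x * t \<in> X" "e \<in> X"
  "x \<in> X \<Longrightarrow> x * e \<in> C" "0 \<in> X" "e * t \<in> X"
proof -
  show "x \<in> X \<Longrightarrow> x * e \<in> C"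
    unfolding X_def C_def mem_Collect_eq by (metis idem mult.assoc)
  show "e * t \<in> X" unfolding X_def mem_Collect_eq by (metis idem mult.assoc)
  show "x \<in> X \<Longrightarrow> x * t \<in> X" unfolding X_def mem_Collect_eq by (metis mult.assoc)
qed (auto simp: X_def algebra_simps idem)

lemma psii_hom:
  assumes "r \<in> carrier S" "s \<in> carrier S"
  shows "\<psi>i (r \<oplus>\<^bsub>S\<^esub> s) = \<psi>i r + \<psi>i s" "\<psi>i (r \<otimes>\<^bsub>S\<^esub> s) = \<psi>i r * \<psi>i s"
  by (metis assms psi(3) psii C_closed(2), metis assms psi(2) psii C_closed(1))

lemma psii_one: "\<psi>i \<one>\<^bsub>S\<^esub> = e"
  by (metis psi(4) psii(1) C_closed(3))

text \<open>This replaces computations with the sum $\sum p e q$.\<close>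

lemma full_induct:
  assumes "P 0" and "\<And>p q t. P t \<Longrightarrow> P (p * e * q + t)"
  shows "P 1"
proof -
  have "P (\<Sum>(p, q)\<leftarrow>l. p * e * q)" for l
    by (induction l) (auto simp: assms)
  then show ?thesis by (metis full)
qed

definition dec where "dec = inv_into (X \<rightarrow>\<^sub>E UNIV) enc"

lemma dec_enc: "f \<in> X \<rightarrow>\<^sub>E Y \<Longrightarrow> dec (enc f) = f"
  unfolding dec_def by (rule inv_into_f_f) (use enc in \<open>auto simp: X_def\<close>)

lemma dec_enc_restrict [simp]: "dec (enc (restrict f X)) = restrict f X"
  by (rule dec_enc[of _ UNIV]) auto

section \<open>The functors \<open>M \<mapsto> eM\<close> and
  \<open>N \<mapsto> Hom(eT, N)\<close>\<close>

definition Fo :: "('a, 'm) module \<Rightarrow> ('b, 'm) module" where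
  "Fo M = \<lparr>carrier = {m \<in> carrier M. \<phi> e \<odot>\<^bsub>M\<^esub> m = m}, mult = undefined, one = undefined,
     zero = \<zero>\<^bsub>M\<^esub>, add = add M, smult = (\<lambda>s m. \<phi> (\<psi>i s) \<odot>\<^bsub>M\<^esub> m)\<rparr>"

definition Fm :: "('a, 'm) module \<Rightarrow> ('a, 'm) module \<Rightarrow> ('m \<Rightarrow> 'm) \<Rightarrow> ('m \<Rightarrow> 'm)" where
  "Fm M N f = restrict f (carrier (Fo M))"

definition hom_X :: "('b, 'm) module \<Rightarrow> ('t \<Rightarrow> 'm) set" where
  "hom_X N = {f \<in> X \<rightarrow>\<^sub>E carrier N. (\<forall>x\<in>X. \<forall>y\<in>X. f (x + y) = f x \<oplus>\<^bsub>N\<^esub> f y) \<and>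
     (\<forall>c\<in>C. \<forall>x\<in>X. f (c * x) = \<psi> c \<odot>\<^bsub>N\<^esub> f x)}"

text \<open>Right multiplication on \<open>eT\<close> becomes a left action: \<open>r\<close> sends
  \<open>f\<close> to the map taking \<open>x\<close> to \<open>f (x r)\<close>. The elements of the
  module are codes, so each operation decodes, computes with functions and encodes again.\<close>

definition Go :: "('b, 'm) module \<Rightarrow> ('a, 'm) module" where
  "Go N = \<lparr>carrier = enc ` hom_X N, mult = undefined, one = undefined,
     zero = enc (\<lambda>x\<in>X. \<zero>\<^bsub>N\<^esub>),
     add = (\<lambda>a b. enc (\<lambda>x\<in>X. dec a x \<oplus>\<^bsub>N\<^esub> dec b x)),
     smult = (\<lambda>r a. enc (\<lambda>x\<in>X. dec a (x * \<phi>i r)))\<rparr>"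

definition Gm :: "('b, 'm) module \<Rightarrow> ('b, 'm) module \<Rightarrow> ('m \<Rightarrow> 'm) \<Rightarrow> ('m \<Rightarrow> 'm)" where
  "Gm M N f = (\<lambda>a\<in>carrier (Go M). enc (\<lambda>x\<in>X. f (dec a x)))"

lemma dec_hom_X: "f \<in> hom_X N \<Longrightarrow> dec (enc f) = f"
  unfolding hom_X_def by (blast intro: dec_enc)

lemma hom_XD:
  assumes "f \<in> hom_X N"
  shows "x \<in> X \<Longrightarrow> f x \<in> carrier N"
    "x \<in> X \<Longrightarrow> y \<in> X \<Longrightarrow> f (x + y) = f x \<oplus>\<^bsub>N\<^esub> f y"
    "c \<in> C \<Longrightarrow> x \<in> X \<Longrightarrow> f (c * x) = \<psi> c \<odot>\<^bsub>N\<^esub> f x"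
    "restrict f X = f"
  using assms unfolding hom_X_def by (auto simp: PiE_restrict)

lemma hom_XI:
  assumes "\<And>x. x \<in> X \<Longrightarrow> f x \<in> carrier N"
    "\<And>x y. x \<in> X \<Longrightarrow> y \<in> X \<Longrightarrow> f (x + y) = f x \<oplus>\<^bsub>N\<^esub> f y"
    "\<And>c x. c \<in> C \<Longrightarrow> x \<in> X \<Longrightarrow> f (c * x) = \<psi> c \<odot>\<^bsub>N\<^esub> f x"
  shows "restrict f X \<in> hom_X N"
  using assms X_closed C_closed unfolding hom_X_def
  by (auto simp: X_closed C_closed)

lemma left_module_Fo:
  assumes "left_module R M"
  shows "left_module S (Fo M)"
proof -
  interpret left_module R M by fact
  have C: "\<phi> e \<odot>\<^bsub>M\<^esub> (\<phi> c \<odot>\<^bsub>M\<^esub> m) = \<phi> c \<odot>\<^bsub>M\<^esub> m" if "c \<in> C" "m \<in> carrier M" for c m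
  proof -
    have "\<phi> (e * c) = \<phi> c" using that by (simp add: C_def)
    then show ?thesis using that smult_assoc[of "\<phi> e" "\<phi> c" m] by simp
  qed
  show ?thesis
  proof (rule left_module.intro[OF ring_S])
    show "abelian_group (Fo M)"
    proof (rule abelian_groupI)
      fix m assume "m \<in> carrier (Fo M)"
      then show "\<exists>n\<in>carrier (Fo M). n \<oplus>\<^bsub>Fo M\<^esub> m = \<zero>\<^bsub>Fo M\<^esub>"
        by (intro bexI[of _ "\<ominus>\<^bsub>M\<^esub> m"]) (auto simp: Fo_def smult_r_minus M.l_neg)
    qed (auto simp: Fo_def smult_r_distr smult_r_null M.a_ac)
    show "left_module_axioms S (Fo M)"
    proof
      fix a b m assume "a \<in> carrier S" "b \<in> carrier S" "m \<in> carrier (Fo M)"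
      then show "(a \<otimes>\<^bsub>S\<^esub> b) \<odot>\<^bsub>Fo M\<^esub> m = a \<odot>\<^bsub>Fo M\<^esub> (b \<odot>\<^bsub>Fo M\<^esub> m)"
        by (simp add: Fo_def psii_hom smult_assoc)
    qed (auto simp: Fo_def smult_closed C psii_hom psii_one smult_l_distr smult_r_distr)
  qed
qed

lemma left_module_Go:
  assumes "left_module S N"
  shows "left_module R (Go N)"
proof -
  interpret left_module S N by fact
  have add: "(\<lambda>x\<in>X. f x \<oplus>\<^bsub>N\<^esub> g x) \<in> hom_X N" if "f \<in> hom_X N" "g \<in> hom_X N" for f g
    by (intro hom_XI) (use that in \<open>auto simp: hom_XD M.a_ac smult_r_distr\<close>)
  have zero: "(\<lambda>x\<in>X. \<zero>\<^bsub>N\<^esub>) \<in> hom_X N"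
    by (intro hom_XI) (auto simp: smult_r_null)
  have minus: "(\<lambda>x\<in>X. \<ominus>\<^bsub>N\<^esub> f x) \<in> hom_X N" if "f \<in> hom_X N" for f
    by (intro hom_XI) (use that in \<open>auto simp: hom_XD M.minus_add smult_r_minus\<close>)
  have smult: "(\<lambda>x\<in>X. f (x * t)) \<in> hom_X N" if "f \<in> hom_X N" for f t
    by (intro hom_XI) (use that in \<open>auto simp: hom_XD X_closed distrib_right mult.assoc\<close>)
  show ?thesis
  proof (rule left_module.intro[OF ring_R])
    show "abelian_group (Go N)"
    proof (rule abelian_groupI)
      fix a assume "a \<in> carrier (Go N)"
      then obtain f where f: "f \<in> hom_X N" "a = enc f" by (auto simp: Go_def)
      then have "enc (\<lambda>x\<in>X. \<ominus>\<^bsub>N\<^esub> f x) \<oplus>\<^bsub>Go N\<^esub> a = \<zero>\<^bsub>Go N\<^esub>"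
        by (auto simp: Go_def dec_hom_X hom_XD M.l_neg cong: restrict_cong)
      then show "\<exists>b\<in>carrier (Go N). b \<oplus>\<^bsub>Go N\<^esub> a = \<zero>\<^bsub>Go N\<^esub>"
        by (rule bexI) (use minus[OF f(1)] in \<open>simp add: Go_def\<close>)
      show "\<zero>\<^bsub>Go N\<^esub> \<oplus>\<^bsub>Go N\<^esub> a = a"
        using f by (auto simp: Go_def dec_hom_X hom_XD cong: restrict_cong)
    next
      fix a b c assume "a \<in> carrier (Go N)" "b \<in> carrier (Go N)" "c \<in> carrier (Go N)"
      then show "a \<oplus>\<^bsub>Go N\<^esub> b \<oplus>\<^bsub>Go N\<^esub> c = a \<oplus>\<^bsub>Go N\<^esub> (b \<oplus>\<^bsub>Go N\<^esub> c)"
        by (auto simp: Go_def dec_hom_X hom_XD M.a_assoc cong: restrict_cong)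
    next
      fix a b assume "a \<in> carrier (Go N)" "b \<in> carrier (Go N)"
      then show "a \<oplus>\<^bsub>Go N\<^esub> b = b \<oplus>\<^bsub>Go N\<^esub> a"
        by (auto simp: Go_def dec_hom_X hom_XD M.a_comm cong: restrict_cong)
    qed (auto simp: Go_def zero add dec_hom_X)
    show "left_module_axioms R (Go N)"
    proof
      fix r s a assume rs: "r \<in> carrier R" "s \<in> carrier R" and "a \<in> carrier (Go N)"
      then obtain f where f: "f \<in> hom_X N" "a = enc f" by (auto simp: Go_def)
      show "r \<odot>\<^bsub>Go N\<^esub> a \<in> carrier (Go N)"
        using f smult by (auto simp: Go_def dec_hom_X)
      show "(r \<oplus>\<^bsub>R\<^esub> s) \<odot>\<^bsub>Go N\<^esub> a = r \<odot>\<^bsub>Go N\<^esub> a \<oplus>\<^bsub>Go N\<^esub> s \<odot>\<^bsub>Go N\<^esub> a"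
        using f rs by (auto simp: Go_def dec_hom_X phii_hom distrib_left hom_XD X_closed cong: restrict_cong)
      show "(r \<otimes>\<^bsub>R\<^esub> s) \<odot>\<^bsub>Go N\<^esub> a = r \<odot>\<^bsub>Go N\<^esub> (s \<odot>\<^bsub>Go N\<^esub> a)"
        using f rs by (auto simp: Go_def dec_hom_X phii_hom X_closed mult.assoc cong: restrict_cong)
    next
      fix a assume "a \<in> carrier (Go N)"
      then show "\<one>\<^bsub>R\<^esub> \<odot>\<^bsub>Go N\<^esub> a = a"
        by (auto simp: Go_def dec_hom_X phii_one hom_XD cong: restrict_cong)
    next
      fix r a b assume "r \<in> carrier R" "a \<in> carrier (Go N)" "b \<in> carrier (Go N)"
      then show "r \<odot>\<^bsub>Go N\<^esub> (a \<oplus>\<^bsub>Go N\<^esub> b) = r \<odot>\<^bsub>Go N\<^esub> a \<oplus>\<^bsub>Go N\<^esub> r \<odot>\<^bsub>Go N\<^esub> b"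
        by (auto simp: Go_def dec_hom_X X_closed cong: restrict_cong)
    qed
  qed
qed

lemma lmod_homD:
  assumes "f \<in> lmod_hom Q M N"
  shows "x \<in> carrier M \<Longrightarrow> f x \<in> carrier N"
    "x \<in> carrier M \<Longrightarrow> y \<in> carrier M \<Longrightarrow> f (x \<oplus>\<^bsub>M\<^esub> y) = f x \<oplus>\<^bsub>N\<^esub> f y"
    "a \<in> carrier Q \<Longrightarrow> x \<in> carrier M \<Longrightarrow> f (a \<odot>\<^bsub>M\<^esub> x) = a \<odot>\<^bsub>N\<^esub> f x"
  using assms unfolding lmod_hom_def by blast+

lemma lmod_homI:
  assumes "\<And>x. x \<in> carrier M \<Longrightarrow> f x \<in> carrier N"
    "\<And>x y. x \<in> carrier M \<Longrightarrow> y \<in> carrier M \<Longrightarrow> f (x \<oplus>\<^bsub>M\<^esub> y) = f x \<oplus>\<^bsub>N\<^esub> f y"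
    "\<And>a x. a \<in> carrier Q \<Longrightarrow> x \<in> carrier M \<Longrightarrow> f (a \<odot>\<^bsub>M\<^esub> x) = a \<odot>\<^bsub>N\<^esub> f x"
    "left_module Q M"
  shows "restrict f (carrier M) \<in> lmod_hom Q M N"
proof -
  interpret M: left_module Q M by fact
  show ?thesis
    using assms(1-3) by (simp add: lmod_hom_def M.smult_closed)
qed

lemma Fo_sel [simp]:
  "m \<in> carrier (Fo M) \<longleftrightarrow> m \<in> carrier M \<and> \<phi> e \<odot>\<^bsub>M\<^esub> m = m"
  "zero (Fo M) = zero M" "add (Fo M) = add M" "s \<odot>\<^bsub>Fo M\<^esub> m = \<phi> (\<psi>i s) \<odot>\<^bsub>M\<^esub> m"
  by (simp_all add: Fo_def)

lemma Fo_hom: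
  assumes "f \<in> lmod_hom R M N" "m \<in> carrier (Fo M)"
  shows "f m \<in> carrier (Fo N)"
  using assms(2) lmod_homD(1)[OF assms(1), of m] lmod_homD(3)[OF assms(1), of "\<phi> e" m]
  by simp

lemma functor_F: "additive_functor R S Fo Fm"
  unfolding additive_functor_def
proof (intro conjI allI impI ballI)
  fix M N :: "('a, 'm) module" and f
  assume MN: "left_module R M \<and> left_module R N" and f: "f \<in> lmod_hom R M N"
  show "Fm M N f \<in> lmod_hom S (Fo M) (Fo N)"
    unfolding Fm_def
    by (intro lmod_homI Fo_hom[OF f] left_module_Fo conjunct1[OF MN])
      (simp_all add: lmod_homD[OF f])
next
  fix L M N :: "('a, 'm) module" and f g
  assume f: "f \<in> lmod_hom R L M" and g: "g \<in> lmod_hom R M N"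
  show "Fm L N (compose (carrier L) g f) = compose (carrier (Fo L)) (Fm M N g) (Fm L M f)"
  proof
    fix x
    show "Fm L N (compose (carrier L) g f) x = compose (carrier (Fo L)) (Fm M N g) (Fm L M f) x"
    proof (cases "x \<in> carrier (Fo L)")
      case True
      with Fo_hom[OF f True] show ?thesis
        by (simp add: Fm_def compose_def)
    next
      case False
      then show ?thesis by (simp add: Fm_def compose_def del: Fo_sel)
    qed
  qed
qed (auto simp: left_module_Fo Fm_def fun_eq_iff)

lemma carrier_Go: "carrier (Go N) = enc ` hom_X N"
  by (simp add: Go_def)

lemma hom_X_hom:
  assumes f: "f \<in> lmod_hom S M N" and h: "h \<in> hom_X M"
  shows "(\<lambda>x\<in>X. f (h x)) \<in> hom_X N"
  by (intro hom_XI) (simp_all add: lmod_homD[OF f] hom_XD[OF h])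

lemma functor_G: "additive_functor S R Go Gm"
  unfolding additive_functor_def
proof (intro conjI allI impI ballI)
  fix M N :: "('b, 'm) module" and f
  assume MN: "left_module S M \<and> left_module S N" and f: "f \<in> lmod_hom S M N"
  show "Gm M N f \<in> lmod_hom R (Go M) (Go N)"
    unfolding Gm_def
  proof (rule lmod_homI)
    fix a b assume ab: "a \<in> carrier (Go M)" "b \<in> carrier (Go M)"
    then obtain g h where gh: "g \<in> hom_X M" "h \<in> hom_X M" and [simp]: "a = enc g" "b = enc h"
      by (auto simp: carrier_Go)
    show "enc (\<lambda>x\<in>X. f (dec (a \<oplus>\<^bsub>Go M\<^esub> b) x)) =
      enc (\<lambda>x\<in>X. f (dec a x)) \<oplus>\<^bsub>Go N\<^esub> enc (\<lambda>x\<in>X. f (dec b x))"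
      using gh by (simp add: Go_def dec_hom_X hom_XD lmod_homD[OF f] cong: restrict_cong)
  next
    fix a r assume a: "a \<in> carrier (Go M)" and r: "r \<in> carrier R"
    then obtain g where g: "g \<in> hom_X M" and [simp]: "a = enc g"
      by (auto simp: carrier_Go)
    show "enc (\<lambda>x\<in>X. f (dec (r \<odot>\<^bsub>Go M\<^esub> a) x)) = r \<odot>\<^bsub>Go N\<^esub> enc (\<lambda>x\<in>X. f (dec a x))"
      using g by (simp add: Go_def dec_hom_X X_closed cong: restrict_cong)
  next
    fix a assume "a \<in> carrier (Go M)"
    then show "enc (\<lambda>x\<in>X. f (dec a x)) \<in> carrier (Go N)"
      using hom_X_hom[OF f] by (auto simp: carrier_Go dec_hom_X)
  qed (simp add: left_module_Go MN)
next
  fix M :: "('b, 'm) module"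
  show "Gm M M (\<lambda>x\<in>carrier M. x) = (\<lambda>x\<in>carrier (Go M). x)"
    by (auto simp: Gm_def carrier_Go fun_eq_iff dec_hom_X hom_XD cong: restrict_cong)
next
  fix L M N :: "('b, 'm) module" and f g
  assume f: "f \<in> lmod_hom S L M" and g: "g \<in> lmod_hom S M N"
  show "Gm L N (compose (carrier L) g f) = compose (carrier (Go L)) (Gm M N g) (Gm L M f)"
  proof
    fix a
    show "Gm L N (compose (carrier L) g f) a = compose (carrier (Go L)) (Gm M N g) (Gm L M f) a"
    proof (cases "a \<in> carrier (Go L)")
      case True
      then obtain h where h: "h \<in> hom_X L" "a = enc h" by (auto simp: carrier_Go)
      with True hom_X_hom[OF f h(1)] show ?thesis
        by (simp add: Gm_def compose_def carrier_Go dec_hom_X hom_XD[OF h(1)] cong: restrict_cong)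
    next
      case False
      then show ?thesis by (simp add: Gm_def compose_def)
    qed
  qed
next
  fix M N :: "('b, 'm) module" and f g
  assume f: "f \<in> lmod_hom S M N" and g: "g \<in> lmod_hom S M N"
  show "Gm M N (\<lambda>x\<in>carrier M. f x \<oplus>\<^bsub>N\<^esub> g x) =
    (\<lambda>x\<in>carrier (Go M). Gm M N f x \<oplus>\<^bsub>Go N\<^esub> Gm M N g x)"
  proof
    fix a
    show "Gm M N (\<lambda>x\<in>carrier M. f x \<oplus>\<^bsub>N\<^esub> g x) a =
      (\<lambda>x\<in>carrier (Go M). Gm M N f x \<oplus>\<^bsub>Go N\<^esub> Gm M N g x) a"
    proof (cases "a \<in> carrier (Go M)")
      case True
      then obtain h where h: "h \<in> hom_X M" "a = enc h" by (auto simp: carrier_Go)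
      with True show ?thesis
        by (simp add: Gm_def Go_def dec_hom_X hom_XD[OF h(1)] cong: restrict_cong)
    qed (simp add: Gm_def)
  qed
qed (simp add: left_module_Go)

section \<open>The natural isomorphisms between the composites and the identities\<close>

definition unit_R :: "('a, 'm) module \<Rightarrow> 'm \<Rightarrow> 'm" where
  "unit_R M = (\<lambda>m\<in>carrier M. enc (\<lambda>x\<in>X. \<phi> x \<odot>\<^bsub>M\<^esub> m))"

definition unit_S :: "('b, 'm) module \<Rightarrow> 'm \<Rightarrow> 'm" where
  "unit_S N = (\<lambda>n\<in>carrier N. enc (\<lambda>x\<in>X. \<psi> (x * e) \<odot>\<^bsub>N\<^esub> n))"

lemma enc_restrict_eqD:
  assumes "enc (restrict f X) = enc (restrict g X)" "x \<in> X"
  shows "f x = g x"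
  by (metis assms dec_enc_restrict restrict_apply')

text \<open>If \<open>x m = x n\<close> for all \<open>x\<close> in \<open>eT\<close>, then the same
  holds for all sums of elements \<open>p e q\<close>, in particular for 1. Conversely, a
  homomorphism \<open>f\<close> on \<open>eT\<close> comes from the sum of the
  \<open>p f(e q)\<close>, because \<open>x p f(e q) = (x p e) f(e q) = f(x p e q)\<close>, and
  these add up to \<open>f x\<close>.\<close>

lemma unit_R:
  assumes "left_module R M"
  shows "unit_R M \<in> lmod_hom R M (Go (Fo M))"
    and "bij_betw (unit_R M) (carrier M) (carrier (Go (Fo M)))"
proof -
  interpret left_module R M by fact
  have act: "(\<lambda>x\<in>X. \<phi> x \<odot>\<^bsub>M\<^esub> m) \<in> hom_X (Fo M)" if m: "m \<in> carrier M" for m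
  proof (intro hom_XI)
    fix x assume x: "x \<in> X"
    have "\<phi> e \<odot>\<^bsub>M\<^esub> (\<phi> x \<odot>\<^bsub>M\<^esub> m) = \<phi> (e * x) \<odot>\<^bsub>M\<^esub> m"
      using m by (simp add: smult_assoc)
    also have "e * x = x" using x by (simp add: X_def)
    finally show "\<phi> x \<odot>\<^bsub>M\<^esub> m \<in> carrier (Fo M)"
      using m by (simp add: smult_closed)
  qed (use m in \<open>simp_all add: smult_l_distr smult_assoc\<close>)
  show "unit_R M \<in> lmod_hom R M (Go (Fo M))"
    unfolding unit_R_def
  proof (rule lmod_homI)
    fix r m assume "r \<in> carrier R" "m \<in> carrier M"
    then show "enc (\<lambda>x\<in>X. \<phi> x \<odot>\<^bsub>M\<^esub> (r \<odot>\<^bsub>M\<^esub> m)) = r \<odot>\<^bsub>Go (Fo M)\<^esub> enc (\<lambda>x\<in>X. \<phi> x \<odot>\<^bsub>M\<^esub> m)"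
      by (simp add: Go_def X_closed smult_assoc cong: restrict_cong)
  next
    fix m n assume "m \<in> carrier M" "n \<in> carrier M"
    then show "enc (\<lambda>x\<in>X. \<phi> x \<odot>\<^bsub>M\<^esub> (m \<oplus>\<^bsub>M\<^esub> n)) =
      enc (\<lambda>x\<in>X. \<phi> x \<odot>\<^bsub>M\<^esub> m) \<oplus>\<^bsub>Go (Fo M)\<^esub> enc (\<lambda>x\<in>X. \<phi> x \<odot>\<^bsub>M\<^esub> n)"
      by (simp add: Go_def smult_r_distr cong: restrict_cong)
  qed (use act assms in \<open>auto simp: carrier_Go\<close>)
  show "bij_betw (unit_R M) (carrier M) (carrier (Go (Fo M)))"
  proof (rule bij_betw_imageI)
    show "inj_on (unit_R M) (carrier M)"
    proof (rule inj_onI)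
      fix m n assume mn: "m \<in> carrier M" "n \<in> carrier M" "unit_R M m = unit_R M n"
      then have eq: "\<phi> x \<odot>\<^bsub>M\<^esub> m = \<phi> x \<odot>\<^bsub>M\<^esub> n" if "x \<in> X" for x
        using that by (auto simp: unit_R_def dest: enc_restrict_eqD)
      have "\<phi> 1 \<odot>\<^bsub>M\<^esub> m = \<phi> 1 \<odot>\<^bsub>M\<^esub> n"
      proof (rule full_induct)
        show "\<phi> 0 \<odot>\<^bsub>M\<^esub> m = \<phi> 0 \<odot>\<^bsub>M\<^esub> n"
          by (rule eq) (rule X_closed)
        fix p q t assume IH: "\<phi> t \<odot>\<^bsub>M\<^esub> m = \<phi> t \<odot>\<^bsub>M\<^esub> n"
        have "\<phi> (p * (e * q) + t) \<odot>\<^bsub>M\<^esub> m = \<phi> (p * (e * q) + t) \<odot>\<^bsub>M\<^esub> n"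
          unfolding phi(2)[of p] phi(3) using mn eq[of "e * q"] IH
          by (simp add: smult_l_distr smult_assoc[of "\<phi> p" "\<phi> (e * q)"] X_closed del: phi(2))
        then show "\<phi> (p * e * q + t) \<odot>\<^bsub>M\<^esub> m = \<phi> (p * e * q + t) \<odot>\<^bsub>M\<^esub> n"
          by (simp only: mult.assoc)
      qed
      then show "m = n" using mn by (simp add: smult_one)
    qed
    show "unit_R M ` carrier M = carrier (Go (Fo M))"
    proof
      show "unit_R M ` carrier M \<subseteq> carrier (Go (Fo M))"
        using act by (auto simp: unit_R_def carrier_Go)
      show "carrier (Go (Fo M)) \<subseteq> unit_R M ` carrier M"
      proof
        fix a assume "a \<in> carrier (Go (Fo M))"
        then obtain f where f: "f \<in> hom_X (Fo M)" "a = enc f" by (auto simp: carrier_Go)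
        have f0: "f 0 = \<zero>\<^bsub>M\<^esub>"
          using hom_XD(1)[OF f(1), of 0] hom_XD(2)[OF f(1), of 0 0] X_closed(5) M.add.r_cancel_one by auto
        \<comment> \<open>Written with \<open>x * 1\<close> so that 1 can be replaced by the partial
          sums of the \<open>p e q\<close>; each new term contributes \<open>p f(e q)\<close> to
          \<open>m\<close>.\<close>
        have "\<exists>m\<in>carrier M. \<forall>x\<in>X. \<phi> x \<odot>\<^bsub>M\<^esub> m = f (x * 1)"
        proof (rule full_induct)
          show "\<exists>m\<in>carrier M. \<forall>x\<in>X. \<phi> x \<odot>\<^bsub>M\<^esub> m = f (x * 0)"
            by (rule bexI[of _ "\<zero>\<^bsub>M\<^esub>"]) (simp_all add: f0 smult_r_null)
        next
          fix p q t assume "\<exists>m\<in>carrier M. \<forall>x\<in>X. \<phi> x \<odot>\<^bsub>M\<^esub> m = f (x * t)"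
          then obtain m where m: "m \<in> carrier M" "\<And>x. x \<in> X \<Longrightarrow> \<phi> x \<odot>\<^bsub>M\<^esub> m = f (x * t)" by blast
          have feq: "f (e * q) \<in> carrier M" "\<phi> e \<odot>\<^bsub>M\<^esub> f (e * q) = f (e * q)"
            using hom_XD(1)[OF f(1) X_closed(6)] by auto
          have "\<phi> x \<odot>\<^bsub>M\<^esub> (\<phi> p \<odot>\<^bsub>M\<^esub> f (e * q) \<oplus>\<^bsub>M\<^esub> m) = f (x * (p * e * q + t))" if x: "x \<in> X" for x
          proof -
            have C: "x * p * e \<in> C" using x X_closed(2,4) by blast
            have "\<phi> x \<odot>\<^bsub>M\<^esub> (\<phi> p \<odot>\<^bsub>M\<^esub> f (e * q)) = \<phi> (x * p) \<odot>\<^bsub>M\<^esub> (\<phi> e \<odot>\<^bsub>M\<^esub> f (e * q))"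
              using feq by (simp add: smult_assoc)
            also have "\<dots> = \<phi> (x * p * e) \<odot>\<^bsub>M\<^esub> f (e * q)"
              unfolding phi(2)[of "x * p"] using feq by (simp add: smult_assoc del: phi(2))
            also have "\<dots> = f (x * p * e * (e * q))"
              using hom_XD(3)[OF f(1) C X_closed(6)] C by simp
            also have "x * p * e * (e * q) = x * (p * e * q)"
              by (metis idem mult.assoc)
            finally have "\<phi> x \<odot>\<^bsub>M\<^esub> (\<phi> p \<odot>\<^bsub>M\<^esub> f (e * q)) = f (x * (p * e * q))" .
            then show ?thesis
              using feq m x hom_XD(2)[OF f(1) X_closed(2)[OF x] X_closed(2)[OF x]]
              by (simp add: smult_r_distr smult_closed distrib_left)
          qed
          then show "\<exists>m\<in>carrier M. \<forall>x\<in>X. \<phi> x \<odot>\<^bsub>M\<^esub> m = f (x * (p * e * q + t))"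
            using feq m by (intro bexI[of _ "\<phi> p \<odot>\<^bsub>M\<^esub> f (e * q) \<oplus>\<^bsub>M\<^esub> m"]) (simp_all add: smult_closed)
        qed
        then obtain m where m: "m \<in> carrier M" "\<And>x. x \<in> X \<Longrightarrow> \<phi> x \<odot>\<^bsub>M\<^esub> m = f x" by auto
        then have "unit_R M m = a"
          using f hom_XD(4)[OF f(1)] by (simp add: unit_R_def cong: restrict_cong)
        with m show "a \<in> unit_R M ` carrier M" by blast
      qed
    qed
  qed
qed

lemma unit_R_natural:
  assumes M: "left_module R M" and N: "left_module R N" and f: "f \<in> lmod_hom R M N"
  shows "compose (carrier M) (unit_R N) f =
    compose (carrier M) (Gm (Fo M) (Fo N) (Fm M N f)) (unit_R M)"
proof (rule ext)
  interpret left_module R M by fact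
  fix m
  show "compose (carrier M) (unit_R N) f m =
    compose (carrier M) (Gm (Fo M) (Fo N) (Fm M N f)) (unit_R M) m"
  proof (cases "m \<in> carrier M")
    case True
    have mem: "unit_R M m \<in> carrier (Go (Fo M))"
      by (rule lmod_homD(1)[OF unit_R(1)[OF M] True])
    have "\<phi> x \<odot>\<^bsub>M\<^esub> m \<in> carrier (Fo M)" if "x \<in> X" for x
    proof -
      have "\<phi> e \<odot>\<^bsub>M\<^esub> (\<phi> x \<odot>\<^bsub>M\<^esub> m) = \<phi> (e * x) \<odot>\<^bsub>M\<^esub> m"
        using True by (simp add: smult_assoc)
      with that True show ?thesis by (simp add: X_def smult_closed)
    qed
    note mem' = this
    have "compose (carrier M) (Gm (Fo M) (Fo N) (Fm M N f)) (unit_R M) m =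
        enc (\<lambda>x\<in>X. Fm M N f (dec (unit_R M m) x))"
      using True mem by (simp only: compose_def Gm_def restrict_apply' if_True)
    also have "\<dots> = enc (\<lambda>x\<in>X. \<phi> x \<odot>\<^bsub>N\<^esub> f m)"
      using True mem' by (simp add: unit_R_def Fm_def lmod_homD[OF f] cong: restrict_cong)
    also have "\<dots> = compose (carrier M) (unit_R N) f m"
      using True lmod_homD(1)[OF f True] by (simp add: compose_def unit_R_def)
    finally show ?thesis by simp
  next
    case False
    then show ?thesis by (simp add: compose_def)
  qed
qed

lemma natural_unit_R:
  "natural_iso_from_id R (\<lambda>M. Go (Fo M)) (\<lambda>M N f. Gm (Fo M) (Fo N) (Fm M N f)) unit_R"
  unfolding natural_iso_from_id_def
  by (blast intro: unit_R unit_R_natural)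

text \<open>An element of \<open>e Hom(eT, N)\<close> satisfies \<open>f (x e) = f x\<close>, and
  \<open>x e\<close> lies in \<open>eTe\<close>, so \<open>f x = (x e) f(e)\<close>. Hence
  \<open>f\<close> is determined by \<open>f e\<close>, which can be any element of
  \<open>N\<close>.\<close>

lemma unit_S:
  assumes "left_module S N"
  shows "unit_S N \<in> lmod_hom S N (Fo (Go N))"
    and "bij_betw (unit_S N) (carrier N) (carrier (Fo (Go N)))"
proof -
  interpret left_module S N by fact
  have act: "(\<lambda>x\<in>X. \<psi> (x * e) \<odot>\<^bsub>N\<^esub> n) \<in> hom_X N" if n: "n \<in> carrier N" for n
    by (intro hom_XI)
      (use n in \<open>simp_all add: smult_closed X_closed distrib_right smult_l_distr smult_assoc[symmetric]
        mult.assoc flip: psi(2)\<close>)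
  have act': "enc (\<lambda>x\<in>X. \<psi> (x * e) \<odot>\<^bsub>N\<^esub> n) \<in> carrier (Fo (Go N))" if n: "n \<in> carrier N" for n
    using act[OF n] by (simp add: carrier_Go) (simp add: Go_def X_closed mult.assoc idem cong: restrict_cong)
  show "unit_S N \<in> lmod_hom S N (Fo (Go N))"
    unfolding unit_S_def
  proof (rule lmod_homI)
    fix s n assume s: "s \<in> carrier S" and n: "n \<in> carrier N"
    \<comment> \<open>Moving \<open>s\<close> past \<open>e\<close>: its preimage in
      \<open>eTe\<close> is fixed by \<open>e\<close> on both sides.\<close>
    have "\<psi> (x * e) \<odot>\<^bsub>N\<^esub> (s \<odot>\<^bsub>N\<^esub> n) = \<psi> (x * \<psi>i s * e) \<odot>\<^bsub>N\<^esub> n" if x: "x \<in> X" for x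
    proof -
      have "x * e * \<psi>i s = x * \<psi>i s * e"
        using psii(2)[OF s] by (simp add: C_def mult.assoc)
      then have "\<psi> (x * \<psi>i s * e) = \<psi> (x * e) \<otimes>\<^bsub>S\<^esub> s"
        using psi(2)[OF X_closed(4)[OF x] psii(2)[OF s]] s by simp
      then show ?thesis using x s n by (simp add: smult_assoc X_closed)
    qed
    then show "enc (\<lambda>x\<in>X. \<psi> (x * e) \<odot>\<^bsub>N\<^esub> (s \<odot>\<^bsub>N\<^esub> n)) =
      s \<odot>\<^bsub>Fo (Go N)\<^esub> enc (\<lambda>x\<in>X. \<psi> (x * e) \<odot>\<^bsub>N\<^esub> n)"
      by (simp add: Go_def X_closed cong: restrict_cong)
  next
    fix m n assume "m \<in> carrier N" "n \<in> carrier N"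
    then show "enc (\<lambda>x\<in>X. \<psi> (x * e) \<odot>\<^bsub>N\<^esub> (m \<oplus>\<^bsub>N\<^esub> n)) =
      enc (\<lambda>x\<in>X. \<psi> (x * e) \<odot>\<^bsub>N\<^esub> m) \<oplus>\<^bsub>Fo (Go N)\<^esub> enc (\<lambda>x\<in>X. \<psi> (x * e) \<odot>\<^bsub>N\<^esub> n)"
      by (simp add: Go_def smult_r_distr X_closed cong: restrict_cong)
  qed (use act' assms in auto)
  show "bij_betw (unit_S N) (carrier N) (carrier (Fo (Go N)))"
  proof (rule bij_betw_imageI)
    show "inj_on (unit_S N) (carrier N)"
    proof (rule inj_onI)
      fix m n assume mn: "m \<in> carrier N" "n \<in> carrier N" "unit_S N m = unit_S N n"
      \<comment> \<open>Evaluation at \<open>x = e\<close>, where the scalar is the unit of the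
        corner.\<close>
      then have "\<psi> (e * e) \<odot>\<^bsub>N\<^esub> m = \<psi> (e * e) \<odot>\<^bsub>N\<^esub> n"
        using X_closed(3) by (auto simp: unit_S_def dest: enc_restrict_eqD)
      with mn show "m = n" by (simp add: idem smult_one)
    qed
    show "unit_S N ` carrier N = carrier (Fo (Go N))"
    proof
      show "unit_S N ` carrier N \<subseteq> carrier (Fo (Go N))"
        unfolding unit_S_def using act' by fastforce
      show "carrier (Fo (Go N)) \<subseteq> unit_S N ` carrier N"
      proof
        fix a assume a: "a \<in> carrier (Fo (Go N))"
        then obtain f where f: "f \<in> hom_X N" "a = enc f" by (auto simp: carrier_Go)
        with a have "enc (\<lambda>x\<in>X. f (x * e)) = enc (\<lambda>x\<in>X. f x)"
          using hom_XD(4)[OF f(1)] by (simp add: Go_def dec_hom_X)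
        then have "f (x * e) = f x" if "x \<in> X" for x
          using that by (auto dest: enc_restrict_eqD)
        moreover have "f (x * e) = \<psi> (x * e) \<odot>\<^bsub>N\<^esub> f e" if "x \<in> X" for x
          using hom_XD(3)[OF f(1) X_closed(4,3)] that by (metis idem mult.assoc)
        ultimately have "unit_S N (f e) = a"
          using f hom_XD(1,4)[OF f(1)] X_closed(3) by (simp add: unit_S_def cong: restrict_cong)
        then show "a \<in> unit_S N ` carrier N"
          using hom_XD(1)[OF f(1) X_closed(3)] by blast
      qed
    qed
  qed
qed

lemma unit_S_natural:
  assumes M: "left_module S M" and N: "left_module S N" and f: "f \<in> lmod_hom S M N"
  shows "compose (carrier M) (unit_S N) f =
    compose (carrier M) (Fm (Go M) (Go N) (Gm M N f)) (unit_S M)"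
proof (rule ext)
  interpret left_module S M by fact
  fix m
  show "compose (carrier M) (unit_S N) f m =
    compose (carrier M) (Fm (Go M) (Go N) (Gm M N f)) (unit_S M) m"
  proof (cases "m \<in> carrier M")
    case True
    have mem: "unit_S M m \<in> carrier (Fo (Go M))"
      by (rule lmod_homD(1)[OF unit_S(1)[OF M] True])
    then have "unit_S M m \<in> carrier (Go M)" by simp
    have "compose (carrier M) (Fm (Go M) (Go N) (Gm M N f)) (unit_S M) m = Gm M N f (unit_S M m)"
      using True mem by (simp only: compose_def Fm_def restrict_apply' if_True)
    also have "\<dots> = enc (\<lambda>x\<in>X. f (dec (unit_S M m) x))"
      unfolding Gm_def by (rule restrict_apply') fact
    also have "\<dots> = enc (\<lambda>x\<in>X. \<psi> (x * e) \<odot>\<^bsub>N\<^esub> f m)"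
      using True by (simp add: unit_S_def lmod_homD[OF f] X_closed(4) cong: restrict_cong)
    also have "\<dots> = compose (carrier M) (unit_S N) f m"
      using True lmod_homD(1)[OF f True] by (simp add: compose_def unit_S_def)
    finally show ?thesis by simp
  next
    case False
    then show ?thesis by (simp add: compose_def)
  qed
qed

lemma natural_unit_S:
  "natural_iso_from_id S (\<lambda>N. Fo (Go N)) (\<lambda>M N f. Fm (Go M) (Go N) (Gm M N f)) unit_S"
  unfolding natural_iso_from_id_def
  by (blast intro: unit_S unit_S_natural)

end

theorem morita_equivalent_corner:
  fixes e :: "'t::ring_1" and R :: "('a, 'y) ring_scheme" and S :: "('b, 'z) ring_scheme"
  assumes "e * e = e" and "(\<Sum>(p, q)\<leftarrow>pq. p * e * q) = 1" and "finite {x. e * x = x}"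
    and "ring R" and "ring S"
    and "(\<phi> :: 't \<Rightarrow> 'a) \<in> ring_iso (corner 1) R" and "(\<psi> :: 't \<Rightarrow> 'b) \<in> ring_iso (corner e) S"
    and "infinite (UNIV :: 'm set)"
  shows "morita_equivalent TYPE('m) R S"
proof -
  obtain enc :: "('t \<Rightarrow> 'm) \<Rightarrow> 'm" where "inj_on enc ({x. e * x = x} \<rightarrow>\<^sub>E UNIV)"
    using finite_PiE_encode assms(3,8) by blast
  with assms interpret full_corner e pq R S \<phi> \<psi> enc
    by (intro full_corner.intro)
  show ?thesis
    unfolding morita_equivalent_def
    using ring_R ring_S functor_F functor_G natural_unit_R natural_unit_S by blast
qed

section \<open>Algebras with a multiplicative basis\<close>

lemma basis_alg_sel [simp]:
  "f \<in> carrier (basis_alg S mul u) \<longleftrightarrow> finite {s. f s \<noteq> 0} \<and> {s. f s \<noteq> 0} \<subseteq> S"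
  "zero (basis_alg S mul u) = (\<lambda>_. 0)" "one (basis_alg S mul u) = u"
  "f \<oplus>\<^bsub>basis_alg S mul u\<^esub> g = (\<lambda>s. f s + g s)"
  "c \<odot>\<^bsub>basis_alg S mul u\<^esub> f = (\<lambda>s. c * f s)"
  by (simp_all add: basis_alg_def)

text \<open>In the definition the range of summation depends on \<open>r\<close>; a fixed rectangle
  containing both supports allows the order of summation to be changed.\<close>

lemma basis_alg_mult:
  assumes "finite A" "finite B" "{s. f s \<noteq> 0} \<subseteq> A" "{s. g s \<noteq> 0} \<subseteq> B"
  shows "(f \<otimes>\<^bsub>basis_alg S mul u\<^esub> g) r =
    (\<Sum>p\<in>A. \<Sum>q\<in>B. if mul p q = Some r then f p * g q else 0)"
proof -
  have "(f \<otimes>\<^bsub>basis_alg S mul u\<^esub> g) r =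
      (\<Sum>(p, q) \<in> {(p, q). f p \<noteq> 0 \<and> g q \<noteq> 0 \<and> mul p q = Some r}. f p * g q)"
    by (simp add: basis_alg_def)
  also have "\<dots> = (\<Sum>(p, q) \<in> A \<times> B. if mul p q = Some r then f p * g q else 0)"
    using assms by (intro sum.mono_neutral_cong_left) (auto split: if_splits)
  finally show ?thesis by (simp add: sum.cartesian_product)
qed

lemma basis_alg_mult_closed:
  assumes "f \<in> carrier (basis_alg S mul u)" "g \<in> carrier (basis_alg S mul u)"
    and closed: "\<And>p q r. p \<in> S \<Longrightarrow> q \<in> S \<Longrightarrow> mul p q = Some r \<Longrightarrow> r \<in> S"
  shows "f \<otimes>\<^bsub>basis_alg S mul u\<^esub> g \<in> carrier (basis_alg S mul u)"
proof -
  let ?A = "{s. f s \<noteq> 0}" and ?B = "{s. g s \<noteq> 0}"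
  have fin: "finite ?A" "finite ?B" and sub: "?A \<subseteq> S" "?B \<subseteq> S" using assms by auto
  have "{r. (f \<otimes>\<^bsub>basis_alg S mul u\<^esub> g) r \<noteq> 0} \<subseteq> (\<lambda>(p, q). the (mul p q)) ` {(p, q) \<in> ?A \<times> ?B. mul p q \<noteq> None}"
  proof
    fix r assume "r \<in> {r. (f \<otimes>\<^bsub>basis_alg S mul u\<^esub> g) r \<noteq> 0}"
    then have "(\<Sum>p\<in>?A. \<Sum>q\<in>?B. if mul p q = Some r then f p * g q else 0) \<noteq> 0"
      using basis_alg_mult[OF fin order_refl order_refl, where S = S and mul = mul and u = u and r = r]
      by (simp only: mem_Collect_eq not_False_eq_True)
    then obtain p where p: "p \<in> ?A" "(\<Sum>q\<in>?B. if mul p q = Some r then f p * g q else 0) \<noteq> 0"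
      by (rule sum.not_neutral_contains_not_neutral)
    from p(2) obtain q where "q \<in> ?B" "(if mul p q = Some r then f p * g q else 0) \<noteq> 0"
      by (rule sum.not_neutral_contains_not_neutral)
    with p(1) show "r \<in> (\<lambda>(p, q). the (mul p q)) ` {(p, q) \<in> ?A \<times> ?B. mul p q \<noteq> None}"
      by (intro image_eqI[of _ _ "(p, q)"]) (auto split: if_splits)
  qed
  moreover have "finite {(p, q) \<in> ?A \<times> ?B. mul p q \<noteq> None}"
    using fin by (intro finite_subset[OF _ finite_cartesian_product[OF fin]]) auto
  moreover have "(\<lambda>(p, q). the (mul p q)) ` {(p, q) \<in> ?A \<times> ?B. mul p q \<noteq> None} \<subseteq> S"
    using closed sub by fastforce
  ultimately show ?thesis
    unfolding basis_alg_sel(1) by (meson finite_imageI finite_subset order_trans)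
qed

lemma finite_supp_add:
  fixes f g :: "'s \<Rightarrow> 'k::comm_ring_1"
  assumes "finite {s. f s \<noteq> 0}" "finite {s. g s \<noteq> 0}"
  shows "finite {s. f s + g s \<noteq> 0}"
  by (rule finite_subset[OF _ finite_UnI[OF assms]]) auto

lemma abelian_group_basis_alg: "abelian_group (basis_alg S mul u)"
proof (rule abelian_groupI)
  fix f assume "f \<in> carrier (basis_alg S mul u)"
  then show "\<exists>g\<in>carrier (basis_alg S mul u). g \<oplus>\<^bsub>basis_alg S mul u\<^esub> f = \<zero>\<^bsub>basis_alg S mul u\<^esub>"
    by (intro bexI[of _ "\<lambda>s. - f s"]) auto
next
  fix f g :: "'a \<Rightarrow> 'b"
  assume fg: "f \<in> carrier (basis_alg S mul u)" "g \<in> carrier (basis_alg S mul u)"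
  have "{s. f s + g s \<noteq> 0} \<subseteq> {s. f s \<noteq> 0} \<union> {s. g s \<noteq> 0}" by auto
  with fg show "f \<oplus>\<^bsub>basis_alg S mul u\<^esub> g \<in> carrier (basis_alg S mul u)"
    unfolding basis_alg_sel using finite_supp_add[of f g] by blast
qed (auto simp: algebra_simps)

lemma basis_alg_bit_minus:
  fixes f g :: "'s \<Rightarrow> bit"
  assumes "g \<in> carrier (basis_alg S mul u)"
  shows "f \<ominus>\<^bsub>basis_alg S mul u\<^esub> g = (\<lambda>p. f p + g p)"
proof -
  interpret abelian_group "basis_alg S mul u" by (rule abelian_group_basis_alg)
  have "g \<oplus>\<^bsub>basis_alg S mul u\<^esub> g = \<zero>\<^bsub>basis_alg S mul u\<^esub>" by simp
  then have "\<ominus>\<^bsub>basis_alg S mul u\<^esub> g = g" using assms minus_equality by blast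
  then show ?thesis by (simp add: a_minus_def)
qed

lemma basis_elem_carrier: "p \<in> S \<Longrightarrow> (basis_elem p :: 's \<Rightarrow> 'k::comm_ring_1) \<in> carrier (basis_alg S mul u)"
proof -
  have "{s. (basis_elem p :: 's \<Rightarrow> 'k) s \<noteq> 0} = {p}" by (auto simp: basis_elem_def)
  then show "p \<in> S \<Longrightarrow> (basis_elem p :: 's \<Rightarrow> 'k) \<in> carrier (basis_alg S mul u)" by simp
qed

text \<open>Associativity of the partial product is expressed with \<open>Option.bind\<close>. The
  unit is a finite sum of local units from \<open>E\<close>; \<open>l p\<close> and
  \<open>r p\<close> are those fixing \<open>p\<close> from the left and from the right, such as the
  trivial paths at the two ends of a path.\<close>

lemma ring_basis_alg:
  fixes u :: "'s \<Rightarrow> 'k::comm_ring_1"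
  assumes closed: "\<And>p q r. p \<in> S \<Longrightarrow> q \<in> S \<Longrightarrow> mul p q = Some r \<Longrightarrow> r \<in> S"
    and assoc: "\<And>p q r. p \<in> S \<Longrightarrow> q \<in> S \<Longrightarrow> r \<in> S \<Longrightarrow>
      Option.bind (mul p q) (\<lambda>s. mul s r) = Option.bind (mul q r) (mul p)"
    and E: "finite E" "E \<subseteq> S" and u: "u = (\<lambda>p. if p \<in> E then 1 else 0)"
    and unit_l: "\<And>p. p \<in> S \<Longrightarrow> l p \<in> E \<and> (\<forall>i\<in>E. mul i p = (if i = l p then Some p else None))"
    and unit_r: "\<And>p. p \<in> S \<Longrightarrow> r p \<in> E \<and> (\<forall>i\<in>E. mul p i = (if i = r p then Some p else None))"
  shows "ring (basis_alg S mul u)" (is "ring ?A")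
proof (rule ringI)
  show "abelian_group ?A" by (rule abelian_group_basis_alg)
  show "monoid ?A"
  proof (rule monoidI)
    show "\<one>\<^bsub>?A\<^esub> \<in> carrier ?A" using E by (auto simp: u)
  next
    fix f assume f: "f \<in> carrier ?A"
    let ?B = "{s. f s \<noteq> 0}"
    have B: "finite ?B" "?B \<subseteq> S" using f by auto
    have "(\<Sum>i\<in>E. if mul i q = Some s then u i * f q else 0) = (if q = s then f q else 0)" if "q \<in> ?B" for q s
    proof -
      have "(\<Sum>i\<in>E. if mul i q = Some s then u i * f q else 0) = (\<Sum>i\<in>E. if i = l q then if q = s then f q else 0 else 0)"
      proof (intro sum.cong refl)
        fix i assume "i \<in> E"
        moreover from this have "mul i q = (if i = l q then Some q else None)"
          using unit_l[of q] that B by blast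
        ultimately show "(if mul i q = Some s then u i * f q else 0) =
          (if i = l q then if q = s then f q else 0 else 0)"
          by (auto simp: u)
      qed
      then show ?thesis using unit_l[of q] that B E by auto
    qed
    note inner = this
    show "\<one>\<^bsub>?A\<^esub> \<otimes>\<^bsub>?A\<^esub> f = f"
    proof
      fix s
      have "(\<one>\<^bsub>?A\<^esub> \<otimes>\<^bsub>?A\<^esub> f) s = (\<Sum>i\<in>E. \<Sum>q\<in>?B. if mul i q = Some s then u i * f q else 0)"
        unfolding basis_alg_sel by (rule basis_alg_mult) (use B E in \<open>auto simp: u\<close>)
      also have "\<dots> = (\<Sum>q\<in>?B. \<Sum>i\<in>E. if mul i q = Some s then u i * f q else 0)"
        by (rule sum.swap)
      also have "\<dots> = (\<Sum>q\<in>?B. if q = s then f q else 0)"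
        by (intro sum.cong refl inner)
      also have "\<dots> = f s"
        using B(1) by (cases "f s = 0") auto
      finally show "(\<one>\<^bsub>?A\<^esub> \<otimes>\<^bsub>?A\<^esub> f) s = f s" .
    qed
    have "(\<Sum>i\<in>E. if mul q i = Some s then f q * u i else 0) = (if q = s then f q else 0)" if "q \<in> ?B" for q s
    proof -
      have "(\<Sum>i\<in>E. if mul q i = Some s then f q * u i else 0) = (\<Sum>i\<in>E. if i = r q then if q = s then f q else 0 else 0)"
      proof (intro sum.cong refl)
        fix i assume "i \<in> E"
        moreover from this have "mul q i = (if i = r q then Some q else None)"
          using unit_r[of q] that B by blast
        ultimately show "(if mul q i = Some s then f q * u i else 0) =
          (if i = r q then if q = s then f q else 0 else 0)"
          by (auto simp: u)
      qed
      then show ?thesis using unit_r[of q] that B E by auto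
    qed
    note inner = this
    show "f \<otimes>\<^bsub>?A\<^esub> \<one>\<^bsub>?A\<^esub> = f"
    proof
      fix s
      have "(f \<otimes>\<^bsub>?A\<^esub> \<one>\<^bsub>?A\<^esub>) s = (\<Sum>q\<in>?B. \<Sum>i\<in>E. if mul q i = Some s then f q * u i else 0)"
        unfolding basis_alg_sel by (rule basis_alg_mult) (use B E in \<open>auto simp: u\<close>)
      also have "\<dots> = (\<Sum>q\<in>?B. if q = s then f q else 0)"
        by (intro sum.cong refl inner)
      also have "\<dots> = f s"
        using B(1) by (cases "f s = 0") auto
      finally show "(f \<otimes>\<^bsub>?A\<^esub> \<one>\<^bsub>?A\<^esub>) s = f s" .
    qed
  next
    fix f g assume "f \<in> carrier ?A" "g \<in> carrier ?A"
    then show "f \<otimes>\<^bsub>?A\<^esub> g \<in> carrier ?A" using closed by (rule basis_alg_mult_closed)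
  next
    fix f g h assume fgh: "f \<in> carrier ?A" "g \<in> carrier ?A" "h \<in> carrier ?A"
    let ?F = "{s. f s \<noteq> 0}" and ?G = "{s. g s \<noteq> 0}" and ?H = "{s. h s \<noteq> 0}"
    \<comment> \<open>Cancellation can remove the product of two basis elements from the support of
      \<open>f g\<close>, so all these products are adjoined; an undefined one contributes the
      harmless \<open>the None\<close>.\<close>
    let ?FG = "{s. (f \<otimes>\<^bsub>?A\<^esub> g) s \<noteq> 0} \<union> (\<lambda>(p, q). the (mul p q)) ` (?F \<times> ?G)"
    let ?GH = "{s. (g \<otimes>\<^bsub>?A\<^esub> h) s \<noteq> 0} \<union> (\<lambda>(p, q). the (mul p q)) ` (?G \<times> ?H)"
    have fin: "finite ?F" "finite ?G" "finite ?H" and sub: "?F \<subseteq> S" "?G \<subseteq> S" "?H \<subseteq> S"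
      using fgh by auto
    have "f \<otimes>\<^bsub>?A\<^esub> g \<in> carrier ?A" "g \<otimes>\<^bsub>?A\<^esub> h \<in> carrier ?A"
      using fgh closed by (blast intro: basis_alg_mult_closed)+
    then have FG: "finite ?FG" and GH: "finite ?GH" using fin by auto
    have "((f \<otimes>\<^bsub>?A\<^esub> g) \<otimes>\<^bsub>?A\<^esub> h) t = (f \<otimes>\<^bsub>?A\<^esub> (g \<otimes>\<^bsub>?A\<^esub> h)) t" for t
    proof -
      have "((f \<otimes>\<^bsub>?A\<^esub> g) \<otimes>\<^bsub>?A\<^esub> h) t =
        (\<Sum>s\<in>?FG. \<Sum>r\<in>?H. if mul s r = Some t then (f \<otimes>\<^bsub>?A\<^esub> g) s * h r else 0)"
        by (rule basis_alg_mult) (use FG fin in auto)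
      also have "\<dots> = (\<Sum>s\<in>?FG. \<Sum>r\<in>?H. \<Sum>p\<in>?F. \<Sum>q\<in>?G.
          if mul p q = Some s \<and> mul s r = Some t then f p * g q * h r else 0)"
        by (intro sum.cong refl) (auto simp: basis_alg_mult[OF fin(1,2)] sum_distrib_right intro!: sum.cong)
      also have "\<dots> = (\<Sum>r\<in>?H. \<Sum>p\<in>?F. \<Sum>q\<in>?G. \<Sum>s\<in>?FG.
          if mul p q = Some s \<and> mul s r = Some t then f p * g q * h r else 0)"
        by (simp only: sum.swap[of _ _ ?FG])
      also have "\<dots> = (\<Sum>r\<in>?H. \<Sum>p\<in>?F. \<Sum>q\<in>?G.
          if Option.bind (mul p q) (\<lambda>s. mul s r) = Some t then f p * g q * h r else 0)"
      proof (intro sum.cong refl)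
        fix r p q assume "r \<in> ?H" "p \<in> ?F" "q \<in> ?G"
        then have "the (mul p q) \<in> ?FG" by (intro UnI2 image_eqI[of _ _ "(p, q)"]) auto
        \<comment> \<open>For fixed \<open>p\<close> and \<open>q\<close> at most one
          \<open>s\<close> contributes, so the inner sum is evaluated at
          \<open>the (mul p q)\<close>.\<close>
        moreover have "(if mul p q = Some s \<and> mul s r = Some t then f p * g q * h r else 0) =
          (if the (mul p q) = s then if Option.bind (mul p q) (\<lambda>s. mul s r) = Some t
            then f p * g q * h r else 0 else 0)" for s
          by (cases "mul p q") auto
        ultimately show "(\<Sum>s\<in>?FG. if mul p q = Some s \<and> mul s r = Some t then f p * g q * h r else 0) =
          (if Option.bind (mul p q) (\<lambda>s. mul s r) = Some t then f p * g q * h r else 0)"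
          using FG by (simp only: sum.delta' if_True)
      qed
      also have "\<dots> = (\<Sum>r\<in>?H. \<Sum>p\<in>?F. \<Sum>q\<in>?G.
          if Option.bind (mul q r) (mul p) = Some t then f p * g q * h r else 0)"
        using sub by (intro sum.cong refl) (auto simp: assoc subset_iff)
      also have "\<dots> = (\<Sum>r\<in>?H. \<Sum>p\<in>?F. \<Sum>q\<in>?G. \<Sum>s\<in>?GH.
          if mul q r = Some s \<and> mul p s = Some t then f p * g q * h r else 0)"
      proof (intro sum.cong refl, rule sym)
        fix r p q assume "r \<in> ?H" "p \<in> ?F" "q \<in> ?G"
        then have "the (mul q r) \<in> ?GH" by (intro UnI2 image_eqI[of _ _ "(q, r)"]) auto
        moreover have "(if mul q r = Some s \<and> mul p s = Some t then f p * g q * h r else 0) =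
          (if the (mul q r) = s then if Option.bind (mul q r) (mul p) = Some t
            then f p * g q * h r else 0 else 0)" for s
          by (cases "mul q r") auto
        ultimately show "(\<Sum>s\<in>?GH. if mul q r = Some s \<and> mul p s = Some t then f p * g q * h r else 0) =
          (if Option.bind (mul q r) (mul p) = Some t then f p * g q * h r else 0)"
          using GH by (simp only: sum.delta' if_True)
      qed
      also have "\<dots> = (\<Sum>p\<in>?F. \<Sum>r\<in>?H. \<Sum>q\<in>?G. \<Sum>s\<in>?GH. 
          if mul q r = Some s \<and> mul p s = Some t then f p * g q * h r else 0)"
        by (rule sum.swap)
      also have "\<dots> = (\<Sum>p\<in>?F. \<Sum>r\<in>?H. \<Sum>s\<in>?GH. \<Sum>q\<in>?G. 
          if mul q r = Some s \<and> mul p s = Some t then f p * g q * h r else 0)"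
        by (rule sum.cong[OF refl], rule sum.cong[OF refl], rule sum.swap)
      also have "\<dots> = (\<Sum>p\<in>?F. \<Sum>s\<in>?GH. \<Sum>r\<in>?H. \<Sum>q\<in>?G. 
          if mul q r = Some s \<and> mul p s = Some t then f p * g q * h r else 0)"
        by (rule sum.cong[OF refl], rule sum.swap)
      also have "\<dots> = (\<Sum>p\<in>?F. \<Sum>s\<in>?GH. \<Sum>q\<in>?G. \<Sum>r\<in>?H. 
          if mul q r = Some s \<and> mul p s = Some t then f p * g q * h r else 0)"
        by (rule sum.cong[OF refl], rule sum.cong[OF refl], rule sum.swap)
      also have "\<dots> = (\<Sum>p\<in>?F. \<Sum>s\<in>?GH. if mul p s = Some t then f p * (g \<otimes>\<^bsub>?A\<^esub> h) s else 0)"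
        by (intro sum.cong refl)
          (auto simp: basis_alg_mult[OF fin(2,3)] sum_distrib_left mult.assoc intro!: sum.cong)
      also have "\<dots> = (f \<otimes>\<^bsub>?A\<^esub> (g \<otimes>\<^bsub>?A\<^esub> h)) t"
        by (rule basis_alg_mult[symmetric]) (use GH fin in auto)
      finally show ?thesis .
    qed
    then show "(f \<otimes>\<^bsub>?A\<^esub> g) \<otimes>\<^bsub>?A\<^esub> h = f \<otimes>\<^bsub>?A\<^esub> (g \<otimes>\<^bsub>?A\<^esub> h)" by blast
  qed
next
  fix f g h assume fgh: "f \<in> carrier ?A" "g \<in> carrier ?A" "h \<in> carrier ?A"
  let ?F = "{s. f s \<noteq> 0}" and ?G = "{s. g s \<noteq> 0}" and ?H = "{s. h s \<noteq> 0}"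
  have fin: "finite ?F" "finite ?G" "finite ?H" using fgh by auto
  show "(f \<oplus>\<^bsub>?A\<^esub> g) \<otimes>\<^bsub>?A\<^esub> h = f \<otimes>\<^bsub>?A\<^esub> h \<oplus>\<^bsub>?A\<^esub> g \<otimes>\<^bsub>?A\<^esub> h"
  proof
    fix r
    show "((f \<oplus>\<^bsub>?A\<^esub> g) \<otimes>\<^bsub>?A\<^esub> h) r = (f \<otimes>\<^bsub>?A\<^esub> h \<oplus>\<^bsub>?A\<^esub> g \<otimes>\<^bsub>?A\<^esub> h) r"
      unfolding basis_alg_sel
      using fin by (subst (1 2 3) basis_alg_mult[of "?F \<union> ?G" ?H])
        (auto simp: sum.distrib[symmetric] distrib_right intro!: sum.cong)
  qed
  show "h \<otimes>\<^bsub>?A\<^esub> (f \<oplus>\<^bsub>?A\<^esub> g) = h \<otimes>\<^bsub>?A\<^esub> f \<oplus>\<^bsub>?A\<^esub> h \<otimes>\<^bsub>?A\<^esub> g"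
  proof
    fix r
    show "(h \<otimes>\<^bsub>?A\<^esub> (f \<oplus>\<^bsub>?A\<^esub> g)) r = (h \<otimes>\<^bsub>?A\<^esub> f \<oplus>\<^bsub>?A\<^esub> h \<otimes>\<^bsub>?A\<^esub> g) r"
      unfolding basis_alg_sel
      using fin by (subst (1 2 3) basis_alg_mult[of ?H "?F \<union> ?G"])
        (auto simp: sum.distrib[symmetric] distrib_left intro!: sum.cong)
  qed
qed

section \<open>Linear extension over the field with two elements\<close>

definition lin_ext :: "('s \<Rightarrow> 't::comm_monoid_add) \<Rightarrow> ('s \<Rightarrow> bit) \<Rightarrow> 't" where
  "lin_ext g f = (\<Sum>p | f p \<noteq> 0. g p)"

lemma lin_ext_superset:
  assumes "finite A" "{p. f p \<noteq> 0} \<subseteq> A"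
  shows "lin_ext g f = (\<Sum>p\<in>A. if f p = 0 then 0 else g p)"
  unfolding lin_ext_def using assms by (intro sum.mono_neutral_cong_left) auto

lemma lin_ext_basis_elem [simp]: "lin_ext g (basis_elem p) = g p"
proof -
  have "{q. (basis_elem p q :: bit) \<noteq> 0} = {p}" by (auto simp: basis_elem_def)
  then show ?thesis by (simp add: lin_ext_def)
qed

lemma lin_ext_zero [simp]: "lin_ext g (\<lambda>_. 0) = 0"
  by (simp add: lin_ext_def)

text \<open>Coefficients are 0 or 1, so a linear combination is a sum over the support; where the
  two supports meet, the equal terms cancel by \<open>x + x = 0\<close>.\<close>

lemma lin_ext_add:
  fixes g :: "'s \<Rightarrow> 't::ring_1"
  assumes "finite {p. f p \<noteq> 0}" "finite {p. f' p \<noteq> 0}" and two: "\<And>x::'t. x + x = 0"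
  shows "lin_ext g (\<lambda>p. f p + f' p) = lin_ext g f + lin_ext g f'"
proof -
  let ?A = "{p. f p \<noteq> 0} \<union> {p. f' p \<noteq> 0}"
  have A: "finite ?A" using assms by auto
  show ?thesis
    apply (subst (1 2 3) lin_ext_superset[OF A])
       apply (auto simp: two sum.distrib[symmetric] simp del: add_bit_eq_xor intro!: sum.cong)
    done
qed

text \<open>The coefficient of \<open>r\<close> in the product is the parity of the number of pairs
  with product \<open>r\<close>, and by \<open>x + x = 0\<close> a parity acts like the number
  itself. Regrouping all pairs by their product gives the product of the two sums.\<close>

lemma lin_ext_mult:
  fixes g :: "'s \<Rightarrow> 't::ring_1"
  assumes f: "f \<in> carrier (basis_alg S mul u)" and f': "f' \<in> carrier (basis_alg S mul u)"
    and two: "\<And>x::'t. x + x = 0"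
    and mul: "\<And>p q. p \<in> S \<Longrightarrow> q \<in> S \<Longrightarrow> g p * g q = (case mul p q of None \<Rightarrow> 0 | Some r \<Rightarrow> g r)"
  shows "lin_ext g (f \<otimes>\<^bsub>basis_alg S mul u\<^esub> f') = lin_ext g f * lin_ext g f'"
proof -
  let ?A = "{s. f s \<noteq> 0}" and ?B = "{s. f' s \<noteq> 0}"
  define P where "P = {(p, q) \<in> ?A \<times> ?B. mul p q \<noteq> None}"
  define K where "K = (\<lambda>(p, q). the (mul p q)) ` P"
  have fin: "finite ?A" "finite ?B" and sub: "?A \<subseteq> S" "?B \<subseteq> S" using f f' by auto
  have P: "finite P" unfolding P_def
    by (intro finite_subset[OF _ finite_cartesian_product[OF fin]]) auto
  have mult: "(f \<otimes>\<^bsub>basis_alg S mul u\<^esub> f') r = (\<Sum>x\<in>{x\<in>P. (\<lambda>(p, q). the (mul p q)) x = r}. 1)" for r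
  proof -
    have "(f \<otimes>\<^bsub>basis_alg S mul u\<^esub> f') r =
        (\<Sum>(p, q) \<in> {(p, q). f p \<noteq> 0 \<and> f' q \<noteq> 0 \<and> mul p q = Some r}. f p * f' q)"
      by (simp add: basis_alg_def)
    also have "\<dots> = (\<Sum>x\<in>{x\<in>P. (\<lambda>(p, q). the (mul p q)) x = r}. 1)"
      by (intro sum.cong) (auto simp: P_def)
    finally show ?thesis .
  qed
  have scale: "(if (\<Sum>x\<in>X. 1::bit) = 0 then 0 else t) = (\<Sum>x\<in>X. t)" if "finite X" for X :: "('s \<times> 's) set" and t :: 't
    using that
  proof induction
    case (insert x X)
    have "(if (1::bit) + b = 0 then 0 else t) = t + (if b = 0 then 0 else t)" for b
      by (cases b) (auto simp: two)
    with insert show ?case by (simp del: add_bit_eq_xor sum_constant)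
  qed simp
  have "lin_ext g (f \<otimes>\<^bsub>basis_alg S mul u\<^esub> f') =
      (\<Sum>r\<in>K. if (f \<otimes>\<^bsub>basis_alg S mul u\<^esub> f') r = 0 then 0 else g r)"
  proof (rule lin_ext_superset)
    show "finite K" using P by (simp add: K_def)
    show "{p. (f \<otimes>\<^bsub>basis_alg S mul u\<^esub> f') p \<noteq> 0} \<subseteq> K"
    proof (rule ccontr)
      assume "\<not> ?thesis"
      then obtain r where r: "(f \<otimes>\<^bsub>basis_alg S mul u\<^esub> f') r \<noteq> 0" "r \<notin> K" by auto
      then have "{x\<in>P. (\<lambda>(p, q). the (mul p q)) x = r} = {}" by (auto simp: K_def)
      with r(1) show False by (simp only: mult sum.empty) simp
    qed
  qed
  also have "\<dots> = (\<Sum>r\<in>K. \<Sum>x\<in>{x\<in>P. (\<lambda>(p, q). the (mul p q)) x = r}. g ((\<lambda>(p, q). the (mul p q)) x))"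
  proof (intro sum.cong refl)
    fix r
    have "finite {x\<in>P. (\<lambda>(p, q). the (mul p q)) x = r}" using P by auto
    then show "(if (f \<otimes>\<^bsub>basis_alg S mul u\<^esub> f') r = 0 then 0 else g r) =
      (\<Sum>x\<in>{x\<in>P. (\<lambda>(p, q). the (mul p q)) x = r}. g ((\<lambda>(p, q). the (mul p q)) x))"
      unfolding mult by (subst scale) auto
  qed
  also have "\<dots> = (\<Sum>x\<in>P. g ((\<lambda>(p, q). the (mul p q)) x))"
    using P by (intro sum.group) (auto simp: K_def)
  also have "\<dots> = (\<Sum>(p, q) \<in> ?A \<times> ?B. g p * g q)"
    using fin sub mul by (intro sum.mono_neutral_cong_left) (auto simp: P_def subset_iff split: option.splits)
  also have "\<dots> = lin_ext g f * lin_ext g f'"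
    by (simp add: lin_ext_def sum_product sum.cartesian_product)
  finally show ?thesis .
qed

text \<open>Over \<^typ>\<open>bit\<close> signs do not matter, so the hypothesis \<open>normal\<close> says that each basis element is
  congruent to its normal form modulo \<open>I\<close>.\<close>

lemma lin_ext_kernel:
  fixes g :: "'s \<Rightarrow> 't::ring_1"
  assumes two: "\<And>x::'t. x + x = 0"
    and I_ker: "\<And>f. f \<in> I \<Longrightarrow> f \<in> carrier (basis_alg S mul u) \<and> lin_ext g f = 0"
    and I_zero: "(\<lambda>_. 0) \<in> I"
    and I_add: "\<And>f f'. f \<in> I \<Longrightarrow> f' \<in> I \<Longrightarrow> (\<lambda>p. f p + f' p) \<in> I"
    and s_zero: "s 0 = (\<lambda>_. 0)"
    and s_add: "\<And>x y. s (x + y) = (\<lambda>p. s x p + s y p)"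
    and normal: "\<And>p. p \<in> S \<Longrightarrow> (\<lambda>q. basis_elem p q + s (g p) q) \<in> I"
  shows "I = {f \<in> carrier (basis_alg S mul u). lin_ext g f = 0}"
proof
  show "I \<subseteq> {f \<in> carrier (basis_alg S mul u). lin_ext g f = 0}"
    using I_ker by blast
  \<comment> \<open>Every \<open>f\<close> is congruent to the normal form of its value, by removing
    one basis element of the support at a time. For value zero this says that \<open>f\<close> lies
    in \<open>I\<close>.\<close>
  have "(\<lambda>q. f q + s (lin_ext g f) q) \<in> I" if "finite A" "A \<subseteq> S" "A = {p. f p \<noteq> 0}" for A f
    using that
  proof (induction A arbitrary: f rule: finite_induct)
    case empty
    then have "f = (\<lambda>_. 0)" by auto
    then show ?case by (simp add: s_zero I_zero)
  next
    case (insert p A)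
    define f' where "f' = f(p := 0)"
    have f: "f = (\<lambda>q. basis_elem p q + f' q)"
      using insert.prems(2) insert.hyps(2) by (auto simp: f'_def basis_elem_def fun_eq_iff)
    have A: "A = {p. f' p \<noteq> 0}" using insert by (auto simp: f'_def)
    have IH: "(\<lambda>q. f' q + s (lin_ext g f') q) \<in> I"
      using insert.IH[OF _ A] insert.prems(1) by simp
    have "finite {q. (basis_elem p q :: bit) \<noteq> 0}" by (auto simp: basis_elem_def)
    then have "lin_ext g f = g p + lin_ext g f'"
      unfolding f using insert.hyps(1) A by (subst lin_ext_add) (simp_all add: two)
    then have "(\<lambda>q. f q + s (lin_ext g f) q) =
      (\<lambda>q. (basis_elem p q + s (g p) q) + (f' q + s (lin_ext g f') q))"
      by (simp add: s_add f add.assoc add.left_commute fun_eq_iff del: add_bit_eq_xor)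
    then show ?case using I_add[OF normal IH, of p] insert.prems(1) by simp
  qed
  note congruent = this
  show "{f \<in> carrier (basis_alg S mul u). lin_ext g f = 0} \<subseteq> I"
  proof
    fix f assume "f \<in> {f \<in> carrier (basis_alg S mul u). lin_ext g f = 0}"
    then have f: "finite {p. f p \<noteq> 0}" "{p. f p \<noteq> 0} \<subseteq> S" "lin_ext g f = 0" by auto
    show "f \<in> I" using congruent[OF f(1,2) refl] by (simp only: f(3) s_zero add_0_right)
  qed
qed

section \<open>The order modulo 2\<close>

text \<open>\<open>'k lam\<close> over \<^typ>\<open>bit\<close> is the reduction of $\Lambda_{(2)}$ modulo 2.  The fields are the
  coordinates of $s_{i,j}$, $t_i / 2$, $u$, $v / 2$, $x_j / 4$, $y / 2$, followed by the coefficients \<open>a\<close>, \<open>b\<close>,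
  \<open>c\<close>, \<open>d\<close> of $\mathrm{e}_5$, $\tau_7 = 2 e_{5,5} + 4 \bar\eta$, $8 \bar\eta$, $4 \bar\xi$ in the corner of
  $\mathrm{e}_5$; note that $\tau_7^2 = 4 e_{5,5} \equiv 8 \bar\eta$.\<close>

datatype 'k lam = Lam
  (c_s11: 'k) (c_s12: 'k) (c_s13: 'k) (c_s21: 'k) (c_s22: 'k) (c_s23: 'k)
  (c_s31: 'k) (c_s32: 'k) (c_s33: 'k) (c_t1: 'k) (c_t2: 'k) (c_t3: 'k)
  (c_u: 'k) (c_v: 'k) (c_x1: 'k) (c_x2: 'k) (c_x3: 'k) (c_y: 'k)
  (c_a: 'k) (c_b: 'k) (c_c: 'k) (c_d: 'k)

text \<open>With coefficients in an arbitrary commutative ring the ring laws are polynomial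
  identities in the coordinates, proved without splitting into cases.\<close>

instantiation lam :: (comm_ring_1) ring_1
begin

definition zero_lam :: "'a lam" where
  "0 = Lam 0 0 0 0 0 0 0 0 0 0 0 0 0 0 0 0 0 0 0 0 0 0"

definition one_lam :: "'a lam" where
  "1 = Lam 1 0 0 0 1 0 0 0 1 0 0 0 1 0 0 0 0 0 1 0 0 0"

definition plus_lam :: "'a lam \<Rightarrow> 'a lam \<Rightarrow> 'a lam" where
  "p + q = Lam
      (c_s11 p + c_s11 q) (c_s12 p + c_s12 q) (c_s13 p + c_s13 q) (c_s21 p + c_s21 q) (c_s22 p + c_s22 q)
      (c_s23 p + c_s23 q) (c_s31 p + c_s31 q) (c_s32 p + c_s32 q) (c_s33 p + c_s33 q) (c_t1 p + c_t1 q)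
      (c_t2 p + c_t2 q) (c_t3 p + c_t3 q) (c_u p + c_u q) (c_v p + c_v q) (c_x1 p + c_x1 q)
      (c_x2 p + c_x2 q) (c_x3 p + c_x3 q) (c_y p + c_y q) (c_a p + c_a q) (c_b p + c_b q)
      (c_c p + c_c q) (c_d p + c_d q)"

definition uminus_lam :: "'a lam \<Rightarrow> 'a lam" where
  "- p = Lam (- c_s11 p) (- c_s12 p) (- c_s13 p) (- c_s21 p) (- c_s22 p) (- c_s23 p) (- c_s31 p) (- c_s32 p) (- c_s33 p) (- c_t1 p) (- c_t2 p) (- c_t3 p) (- c_u p) (- c_v p) (- c_x1 p) (- c_x2 p) (- c_x3 p) (- c_y p) (- c_a p) (- c_b p) (- c_c p) (- c_d p)"

definition minus_lam :: "'a lam \<Rightarrow> 'a lam \<Rightarrow> 'a lam" where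
  "p - q = p + - (q :: 'a lam)"

text \<open>The last two coordinates collect the products that land in the multiples of eta and xi:
  \<open>4 x * 2 t\<close> is \<open>x t\<close> times 8 eta, while
  \<open>2 y * 2 v * (xi - 12 eta)\<close> is \<open>y v\<close> times 4 xi minus
  \<open>6 y v\<close> times 8 eta, and the latter vanishes modulo 2.\<close>

definition times_lam :: "'a lam \<Rightarrow> 'a lam \<Rightarrow> 'a lam" where
  "p * q = Lam
      (c_s11 p * c_s11 q + c_s12 p * c_s21 q + c_s13 p * c_s31 q)
      (c_s11 p * c_s12 q + c_s12 p * c_s22 q + c_s13 p * c_s32 q)
      (c_s11 p * c_s13 q + c_s12 p * c_s23 q + c_s13 p * c_s33 q)
      (c_s21 p * c_s11 q + c_s22 p * c_s21 q + c_s23 p * c_s31 q)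
      (c_s21 p * c_s12 q + c_s22 p * c_s22 q + c_s23 p * c_s32 q)
      (c_s21 p * c_s13 q + c_s22 p * c_s23 q + c_s23 p * c_s33 q)
      (c_s31 p * c_s11 q + c_s32 p * c_s21 q + c_s33 p * c_s31 q)
      (c_s31 p * c_s12 q + c_s32 p * c_s22 q + c_s33 p * c_s32 q)
      (c_s31 p * c_s13 q + c_s32 p * c_s23 q + c_s33 p * c_s33 q)
      (c_s11 p * c_t1 q + c_s12 p * c_t2 q + c_s13 p * c_t3 q + c_t1 p * c_a q)
      (c_s21 p * c_t1 q + c_s22 p * c_t2 q + c_s23 p * c_t3 q + c_t2 p * c_a q)
      (c_s31 p * c_t1 q + c_s32 p * c_t2 q + c_s33 p * c_t3 q + c_t3 p * c_a q)
      (c_u p * c_u q)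
      (c_u p * c_v q + c_v p * c_a q)
      (c_x1 p * c_s11 q + c_x2 p * c_s21 q + c_x3 p * c_s31 q + c_a p * c_x1 q)
      (c_x1 p * c_s12 q + c_x2 p * c_s22 q + c_x3 p * c_s32 q + c_a p * c_x2 q)
      (c_x1 p * c_s13 q + c_x2 p * c_s23 q + c_x3 p * c_s33 q + c_a p * c_x3 q)
      (c_y p * c_u q + c_a p * c_y q)
      (c_a p * c_a q)
      (c_a p * c_b q + c_b p * c_a q)
      (c_a p * c_c q + c_c p * c_a q + c_b p * c_b q + c_x1 p * c_t1 q + c_x2 p * c_t2 q + c_x3 p * c_t3 q)
      (c_a p * c_d q + c_d p * c_a q + c_y p * c_v q)"

lemmas lam_defs = zero_lam_def one_lam_def plus_lam_def uminus_lam_def minus_lam_def times_lam_def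

instance
proof
  fix p q r :: "'a lam"
  show "p + q + r = p + (q + r)" "p + q = q + p" "0 + p = p" "- p + p = 0" "p - q = p + - q"
    by (simp_all add: lam_defs lam.expand algebra_simps)
  show "1 * p = p" "p * 1 = p" "(0 :: 'a lam) \<noteq> 1"
    by (simp_all add: lam_defs lam.expand)
  show "(p + q) * r = p * r + q * r" "p * (q + r) = p * q + p * r"
    by (simp_all add: lam_defs algebra_simps)
  show "p * q * r = p * (q * r)"
    by (simp add: lam_defs algebra_simps)
qed

end

lemma lam_bit_add_self: "x + x = 0" for x :: "bit lam"
  by (simp add: lam_defs)

text \<open>The image of $\mathrm{e}_3 + \mathrm{e}_4 + \mathrm{e}_5$.\<close>

definition lam_e :: "bit lam" where
  "lam_e = Lam 0 0 0 0 0 0 0 0 1 0 0 0 1 0 0 0 0 0 1 0 0 0"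

lemma lam_e_idem: "lam_e * lam_e = lam_e"
  by (simp add: lam_e_def lam_defs)

lemma carrier_corner_lam_e:
  "carrier (corner lam_e) = {Lam 0 0 0 0 0 0 0 0 s 0 0 t u v 0 0 x y a b c d |s t u v x y a b c d. True}"
proof -
  have "lam_e * z * lam_e = Lam 0 0 0 0 0 0 0 0 (c_s33 z) 0 0 (c_t3 z) (c_u z) (c_v z) 0 0 (c_x3 z) (c_y z) (c_a z) (c_b z) (c_c z) (c_d z)" for z
    by (simp add: lam_e_def lam_defs)
  note * = this
  show ?thesis
  proof (intro Set.set_eqI iffI)
    fix z :: "bit lam" assume "z \<in> carrier (corner lam_e)"
    then show "z \<in> {Lam 0 0 0 0 0 0 0 0 s 0 0 t u v 0 0 x y a b c d |s t u v x y a b c d. True}"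
      unfolding corner_sel * by (metis (mono_tags, lifting) mem_Collect_eq)
  next
    fix z :: "bit lam" assume "z \<in> {Lam 0 0 0 0 0 0 0 0 s 0 0 t u v 0 0 x y a b c d |s t u v x y a b c d. True}"
    then show "z \<in> carrier (corner lam_e)"
      unfolding corner_sel * by auto
  qed
qed

text \<open>The matrix units at (1,3) and (3,1) carry the diagonal unit at (3,3), a summand of
  \<open>lam_e\<close>, to the one at (1,1); those at (2,3) and (3,2) carry it to the one at (2,2).
  Together with \<open>lam_e\<close> they give 1.\<close>

lemma lam_e_full:
  "lam_e * lam_e * lam_e
    + (Lam 0 0 1 0 0 0 0 0 0 0 0 0 0 0 0 0 0 0 0 0 0 0) * lam_e * (Lam 0 0 0 0 0 0 1 0 0 0 0 0 0 0 0 0 0 0 0 0 0 0)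
    + (Lam 0 0 0 0 0 1 0 0 0 0 0 0 0 0 0 0 0 0 0 0 0 0) * lam_e * (Lam 0 0 0 0 0 0 0 1 0 0 0 0 0 0 0 0 0 0 0 0 0 0) = 1"
  by (simp add: lam_e_def lam_defs)


section \<open>The path algebra\<close>

lemma paths_Psi: "(x, p, y) \<in> paths Psi \<longleftrightarrow> pre_digraph.cas Psi x p y"
  by (simp add: paths_def pre_digraph.awalk_def Psi_def)

lemma cas_Psi_simps [simp]:
  "pre_digraph.cas Psi x [] y \<longleftrightarrow> x = y"
  "pre_digraph.cas Psi x (a # p) y \<longleftrightarrow> Psi_tail a = x \<and> pre_digraph.cas Psi (Psi_head a) p y"
  by (simp_all add: pre_digraph.cas.simps Psi_def)

lemma cas_Psi_append:
  "pre_digraph.cas Psi x (p @ q) z \<longleftrightarrow> (\<exists>y. pre_digraph.cas Psi x p y \<and> pre_digraph.cas Psi y q z)"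
  by (induction p arbitrary: x) auto

lemma finite_Psi_vertex: "finite (UNIV :: Psi_vertex set)"
proof -
  have "(UNIV :: Psi_vertex set) = {E3, E4, E5}" using Psi_vertex.exhaust by auto
  then show ?thesis by (metis finite.emptyI finite.insertI)
qed

lemma ring_F2Psi: "ring F2Psi"
  unfolding F2Psi_def path_alg_def
proof (rule ring_basis_alg)
  let ?E = "range (\<lambda>x. (x, [], x)) :: (Psi_vertex, Psi_arrow) path set"
  show "finite ?E" using finite_Psi_vertex by simp
  show "?E \<subseteq> paths Psi" by (auto simp: paths_Psi)
  show "(\<lambda>(x, p, y). if x \<in> verts Psi \<and> p = [] \<and> x = y then 1 else 0) =
    (\<lambda>p. if p \<in> ?E then 1 else 0)"
    by (auto simp: Psi_def fun_eq_iff)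
  show "(\<lambda>(x, p, y). (x, [], x)) p \<in> ?E \<and>
      (\<forall>i\<in>?E. path_comp i p = (if i = (\<lambda>(x, p, y). (x, [], x)) p then Some p else None))"
    "(\<lambda>(x, p, y). (y, [], y)) p \<in> ?E \<and>
      (\<forall>i\<in>?E. path_comp p i = (if i = (\<lambda>(x, p, y). (y, [], y)) p then Some p else None))"
    if "p \<in> paths Psi" for p
    by (cases p; auto)+
next
  fix p q r assume "p \<in> paths Psi" "q \<in> paths Psi" "path_comp p q = Some r"
  then show "r \<in> paths Psi"
    by (cases p; cases q) (auto simp: paths_Psi cas_Psi_append split: if_splits)
next
  fix p q r assume "p \<in> paths Psi" "q \<in> paths Psi" "r \<in> paths Psi"
  show "Option.bind (path_comp p q) (\<lambda>s. path_comp s r) = Option.bind (path_comp q r) (path_comp p)"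
    by (cases p; cases q; cases r) auto
qed

fun vertex_val :: "Psi_vertex \<Rightarrow> bit lam" where
  "vertex_val E3 = Lam 0 0 0 0 0 0 0 0 1 0 0 0 0 0 0 0 0 0 0 0 0 0"
| "vertex_val E4 = Lam 0 0 0 0 0 0 0 0 0 0 0 0 1 0 0 0 0 0 0 0 0 0"
| "vertex_val E5 = Lam 0 0 0 0 0 0 0 0 0 0 0 0 0 0 0 0 0 0 1 0 0 0"

text \<open>The classes of the elements of the order with single entry 4 at (6,3), 2 at (3,6), 2 at
  (6,4) and 2 at (4,6), and of the element with 2 at (5,5) and 4 eta at (6,6) for
  \<open>T7\<close>.\<close>

fun arrow_val :: "Psi_arrow \<Rightarrow> bit lam" where
  "arrow_val T1 = Lam 0 0 0 0 0 0 0 0 0 0 0 0 0 0 0 0 1 0 0 0 0 0"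
| "arrow_val T2 = Lam 0 0 0 0 0 0 0 0 0 0 0 1 0 0 0 0 0 0 0 0 0 0"
| "arrow_val T3 = Lam 0 0 0 0 0 0 0 0 0 0 0 0 0 0 0 0 0 1 0 0 0 0"
| "arrow_val T4 = Lam 0 0 0 0 0 0 0 0 0 0 0 0 0 1 0 0 0 0 0 0 0 0"
| "arrow_val T7 = Lam 0 0 0 0 0 0 0 0 0 0 0 0 0 0 0 0 0 0 0 1 0 0"

text \<open>The leading factor gives the trivial paths their idempotents; a longer path absorbs it
  in its first arrow.\<close>

fun path_val :: "(Psi_vertex, Psi_arrow) path \<Rightarrow> bit lam" where
  "path_val (x, p, y) = vertex_val x * prod_list (map arrow_val p)"

lemma vertex_val_mult: "vertex_val x * vertex_val y = (if x = y then vertex_val x else 0)"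
  by (cases x; cases y) (simp_all add: lam_defs)

lemma vertex_val_arrow_val:
  "vertex_val x * arrow_val a = (if Psi_tail a = x then arrow_val a else 0)"
  "arrow_val a * vertex_val x = (if Psi_head a = x then arrow_val a else 0)"
  by (cases x; cases a; simp add: lam_defs)+

lemma path_val_Cons: "path_val (x, a # p, y) = vertex_val x * (arrow_val a * path_val (Psi_head a, p, y))"
proof -
  have "arrow_val a * vertex_val (Psi_head a) = arrow_val a"
    by (simp add: vertex_val_arrow_val)
  then show ?thesis by (simp flip: mult.assoc add: mult.assoc[of _ "arrow_val a" "vertex_val _"])
qed

lemma path_val_mult_vertex:
  assumes "pre_digraph.cas Psi x p y"
  shows "path_val (x, p, y) * vertex_val z = (if y = z then path_val (x, p, y) else 0)"
  using assms
proof (induction p arbitrary: x)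
  case Nil
  then show ?case by (auto simp: vertex_val_mult)
next
  case (Cons a p)
  then have "path_val (Psi_head a, p, y) * vertex_val z =
    (if y = z then path_val (Psi_head a, p, y) else 0)" by simp
  then show ?case
    unfolding path_val_Cons by (simp add: mult.assoc del: path_val.simps)
qed

lemma path_val_comp:
  assumes "p \<in> paths Psi" "q \<in> paths Psi"
  shows "path_val p * path_val q = (case path_comp p q of None \<Rightarrow> 0 | Some r \<Rightarrow> path_val r)"
proof -
  obtain x l y x' l' y' where [simp]: "p = (x, l, y)" "q = (x', l', y')" by (metis prod_cases3)
  have "path_val p * path_val q = path_val (x, l, y) * vertex_val x' * prod_list (map arrow_val l')"
    by (simp add: mult.assoc)
  also have "\<dots> = (case path_comp p q of None \<Rightarrow> 0 | Some r \<Rightarrow> path_val r)"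
    using assms(1) by (subst path_val_mult_vertex) (auto simp: paths_Psi mult.assoc)
  finally show ?thesis .
qed

lemma path_val_corner: "path_val p \<in> carrier (corner lam_e)" if "p \<in> paths Psi"
proof -
  have V: "lam_e * vertex_val x = vertex_val x" "vertex_val x * lam_e = vertex_val x" for x
    by (cases x; simp add: lam_e_def lam_defs)+
  obtain x l y where p: "p = (x, l, y)" by (metis prod_cases3)
  have "lam_e * path_val p = path_val p"
    by (simp add: p V flip: mult.assoc)
  moreover have "path_val p * lam_e = path_val p"
    using path_val_mult_vertex[of x l y y] that V(2)[of y] p
    by (metis (no_types, lifting) mult.assoc paths_Psi)
  ultimately show ?thesis by (rule corner_memI)
qed

section \<open>Normal forms of paths modulo the relations\<close>

definition path_normal :: "bit lam \<Rightarrow> (Psi_vertex, Psi_arrow) path \<Rightarrow> bit" where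
  "path_normal z q = c_s33 z * basis_elem (E3, [], E3) q + c_u z * basis_elem (E4, [], E4) q
     + c_a z * basis_elem (E5, [], E5) q + c_x3 z * basis_elem (E5, [T1], E3) q
     + c_t3 z * basis_elem (E3, [T2], E5) q + c_y z * basis_elem (E5, [T3], E4) q
     + c_v z * basis_elem (E4, [T4], E5) q + c_b z * basis_elem (E5, [T7], E5) q
     + c_c z * basis_elem (E5, [T1, T2], E5) q + c_d z * basis_elem (E5, [T3, T4], E5) q"

lemma path_normal_zero: "path_normal 0 = (\<lambda>_. 0)"
  by (simp add: path_normal_def fun_eq_iff zero_lam_def)

lemma path_normal_add: "path_normal (z + w) = (\<lambda>q. path_normal z q + path_normal w q)"
  by (simp add: path_normal_def fun_eq_iff plus_lam_def algebra_simps
      del: add_bit_eq_xor mult_bit_eq_and)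

abbreviation "path_elem p \<equiv> (basis_elem p :: (Psi_vertex, Psi_arrow) path \<Rightarrow> bit)"

lemma path_elem_carrier: "p \<in> paths Psi \<Longrightarrow> path_elem p \<in> carrier F2Psi"
  unfolding F2Psi_def path_alg_def by (rule basis_elem_carrier)

lemma path_elem_mult:
  "path_comp p q = Some r \<Longrightarrow> path_elem p \<otimes>\<^bsub>F2Psi\<^esub> path_elem q = path_elem r"
proof
  fix s assume "path_comp p q = Some r"
  then show "(path_elem p \<otimes>\<^bsub>F2Psi\<^esub> path_elem q) s = path_elem r s"
    unfolding F2Psi_def path_alg_def
    by (subst basis_alg_mult[of "{p}" "{q}"]) (auto simp: basis_elem_def)
qed

lemma arrow_Psi: "arrow Psi a = path_elem (Psi_tail a, [a], Psi_head a)"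
  by (simp add: arrow_def Psi_def)

lemma F2Psi_minus: "g \<in> carrier F2Psi \<Longrightarrow> f \<ominus>\<^bsub>F2Psi\<^esub> g = (\<lambda>p. f p + g p)"
  unfolding F2Psi_def path_alg_def by (rule basis_alg_bit_minus)

lemma Psi_relations_eq:
  "Psi_relations = {path_elem (E3, [T2, T1], E3), path_elem (E3, [T2, T3], E4),
    path_elem (E3, [T2, T7], E5), path_elem (E4, [T4, T1], E3), path_elem (E4, [T4, T3], E4),
    path_elem (E4, [T4, T7], E5), path_elem (E5, [T7, T1], E3), path_elem (E5, [T7, T3], E4),
    (\<lambda>p. path_elem (E5, [T7, T7], E5) p + path_elem (E5, [T1, T2], E5) p)}"
  unfolding Psi_relations_def Let_def
  by (simp add: arrow_Psi path_elem_mult F2Psi_minus path_elem_carrier paths_Psi)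

lemma F2Psi_sel:
  "\<one>\<^bsub>F2Psi\<^esub> = (\<lambda>(x, p, y). if x \<in> verts Psi \<and> p = [] \<and> x = y then 1 else 0)"
  "\<zero>\<^bsub>F2Psi\<^esub> = (\<lambda>_. 0)" "f \<oplus>\<^bsub>F2Psi\<^esub> g = (\<lambda>s. f s + g s)"
  by (simp_all add: F2Psi_def path_alg_def)

lemma lin_ext_path_val_hom: "lin_ext path_val \<in> ring_hom F2Psi (corner lam_e)"
proof (rule ring_hom_memI)
  fix f assume f: "f \<in> carrier F2Psi"
  interpret ring "corner lam_e" by (rule ring_corner[OF lam_e_idem])
  have "lin_ext path_val f = (\<Sum>p | f p \<noteq> 0. lam_e * path_val p * lam_e)"
    unfolding lin_ext_def using f path_val_corner
    by (intro sum.cong) (auto simp: F2Psi_def path_alg_def)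
  then show "lin_ext path_val f \<in> carrier (corner lam_e)"
    using lam_e_idem unfolding corner_sel
    by (simp add: sum_distrib_left[symmetric] sum_distrib_right[symmetric])
      (metis mult.assoc)
next
  fix f g assume "f \<in> carrier F2Psi" "g \<in> carrier F2Psi"
  then show "lin_ext path_val (f \<otimes>\<^bsub>F2Psi\<^esub> g) = lin_ext path_val f \<otimes>\<^bsub>corner lam_e\<^esub> lin_ext path_val g"
    unfolding corner_sel F2Psi_def path_alg_def
    by (rule lin_ext_mult) (simp_all add: lam_bit_add_self path_val_comp)
next
  fix f g assume "f \<in> carrier F2Psi" "g \<in> carrier F2Psi"
  then show "lin_ext path_val (f \<oplus>\<^bsub>F2Psi\<^esub> g) = lin_ext path_val f \<oplus>\<^bsub>corner lam_e\<^esub> lin_ext path_val g"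
    unfolding corner_sel F2Psi_sel
    by (intro lin_ext_add) (simp_all add: lam_bit_add_self F2Psi_def path_alg_def)
next
  have "{p. \<one>\<^bsub>F2Psi\<^esub> p \<noteq> 0} = {(E3, [], E3), (E4, [], E4), (E5, [], E5)}"
  proof (intro Set.set_eqI)
    fix p :: "(Psi_vertex, Psi_arrow) path"
    obtain x l z where "p = (x, l, z)" by (metis prod_cases3)
    then show "p \<in> {p. \<one>\<^bsub>F2Psi\<^esub> p \<noteq> 0} \<longleftrightarrow> p \<in> {(E3, [], E3), (E4, [], E4), (E5, [], E5)}"
      by (cases x; cases z) (simp_all add: F2Psi_sel Psi_def)
  qed
  then show "lin_ext path_val \<one>\<^bsub>F2Psi\<^esub> = \<one>\<^bsub>corner lam_e\<^esub>"
    by (simp add: lin_ext_def lam_e_def lam_defs)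
qed

lemma Psi_relations_carrier: "Psi_relations \<subseteq> carrier F2Psi"
proof -
  interpret ring F2Psi by (rule ring_F2Psi)
  show ?thesis
    unfolding Psi_relations_eq
    using a_closed[OF path_elem_carrier path_elem_carrier, of "(E5, [T7, T7], E5)" "(E5, [T1, T2], E5)"]
    by (simp add: path_elem_carrier paths_Psi F2Psi_sel)
qed

text \<open>The only composable pairs of arrows that are not relations are \<open>T1 T2\<close>,
  \<open>T3 T4\<close> and \<open>T7 T7\<close>. A path with at least three arrows has another
  composable pair among its first three arrows, unless it begins with \<open>T7 T7 T7\<close>; there
  \<open>T7 T7\<close> is replaced by \<open>T1 T2\<close>, and \<open>T2 T7\<close> is a relation.
  So ten paths remain: three trivial ones, five arrows, \<open>T1 T2\<close> and
  \<open>T3 T4\<close>.\<close>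

lemma path_normal_basis:
  assumes "p \<in> paths Psi"
  shows "(\<lambda>q. path_elem p q + path_normal (path_val p) q) \<in> Idl\<^bsub>F2Psi\<^esub> Psi_relations"
    (is "_ \<in> ?I")
proof -
  interpret F2Psi: ring F2Psi by (rule ring_F2Psi)
  interpret I: ideal ?I F2Psi by (rule F2Psi.genideal_ideal[OF Psi_relations_carrier])
  have rel: "r \<in> ?I" if "r \<in> Psi_relations" for r
    using F2Psi.genideal_self[OF Psi_relations_carrier] that by blast
  have zero: "(\<lambda>_. 0) \<in> ?I" using I.zero_closed by (simp add: F2Psi_sel)
  have mult_r: "path_elem (x, p @ q, z) \<in> ?I"
    if "path_elem (x, p, y) \<in> ?I" "pre_digraph.cas Psi y q z" for x y z p q
  proof -
    have "path_elem (x, p, y) \<otimes>\<^bsub>F2Psi\<^esub> path_elem (y, q, z) \<in> ?I"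
      using that by (intro I.I_r_closed path_elem_carrier) (simp_all add: paths_Psi)
    then show ?thesis by (subst (asm) path_elem_mult) auto
  qed
  have mult_l: "path_elem (Psi_tail a, a # p, z) \<in> ?I"
    if "path_elem (Psi_head a, p, z) \<in> ?I" for a p z
  proof -
    have "path_elem (Psi_tail a, [a], Psi_head a) \<otimes>\<^bsub>F2Psi\<^esub> path_elem (Psi_head a, p, z) \<in> ?I"
      using that by (intro I.I_l_closed path_elem_carrier) (simp_all add: paths_Psi)
    then show ?thesis by (subst (asm) path_elem_mult) auto
  qed
  have two: "path_elem (Psi_tail a, [a, a'], Psi_head a') \<in> ?I"
    if "Psi_head a = Psi_tail a'" "(a, a') \<notin> {(T1, T2), (T3, T4), (T7, T7)}" for a a'
    using that by (intro rel) (cases a; cases a'; simp add: Psi_relations_eq)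
  have bad: "path_elem (Psi_tail a, a # a' # q, z) \<in> ?I"
    if "Psi_head a = Psi_tail a'" "(a, a') \<notin> {(T1, T2), (T3, T4), (T7, T7)}"
      "pre_digraph.cas Psi (Psi_head a') q z" for a a' q z
    using mult_r[OF two[OF that(1,2)] that(3)] by simp
  have T777: "path_elem (E5, T7 # T7 # T7 # q, z) \<in> ?I" if q: "pre_digraph.cas Psi E5 q z" for q z
  proof -
    let ?p = "path_elem (E5, T7 # q, z)"
    have c: "?p \<in> carrier F2Psi" "path_elem (E5, [T7, T7], E5) \<in> carrier F2Psi"
      "path_elem (E5, [T1, T2], E5) \<in> carrier F2Psi"
      using q by (auto intro!: path_elem_carrier simp: paths_Psi)
    have "(\<lambda>p. path_elem (E5, [T7, T7], E5) p + path_elem (E5, [T1, T2], E5) p) \<in> ?I"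
      by (intro rel) (simp add: Psi_relations_eq)
    then have "(path_elem (E5, [T7, T7], E5) \<oplus>\<^bsub>F2Psi\<^esub> path_elem (E5, [T1, T2], E5)) \<otimes>\<^bsub>F2Psi\<^esub> ?p \<in> ?I"
      unfolding F2Psi_sel(3) by (rule I.I_r_closed) (rule c)
    then have "path_elem (E5, T7 # T7 # T7 # q, z) \<oplus>\<^bsub>F2Psi\<^esub> path_elem (E5, T1 # T2 # T7 # q, z) \<in> ?I"
      using c by (simp add: F2Psi.l_distr path_elem_mult)
    moreover have "path_elem (E5, T1 # T2 # T7 # q, z) \<in> ?I"
      using mult_l[of T1] bad[of T2 T7 q z] q by simp
    \<comment> \<open>Adding the second path once more cancels it, as the characteristic is
      2.\<close>
    ultimately have "path_elem (E5, T7 # T7 # T7 # q, z) \<oplus>\<^bsub>F2Psi\<^esub> path_elem (E5, T1 # T2 # T7 # q, z)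
      \<oplus>\<^bsub>F2Psi\<^esub> path_elem (E5, T1 # T2 # T7 # q, z) \<in> ?I"
      by (rule I.a_closed)
    then show ?thesis
      by (simp add: F2Psi_sel add.assoc del: add_bit_eq_xor)
  qed
  have long: "path_elem (Psi_tail a, a # a' # a'' # q, z) \<in> ?I \<and> path_val (Psi_tail a, a # a' # a'' # q, z) = 0"
    if "pre_digraph.cas Psi (Psi_tail a) (a # a' # a'' # q) z" for a a' a'' q z
  proof
    have cas: "Psi_head a = Psi_tail a'" "Psi_head a' = Psi_tail a''"
      "pre_digraph.cas Psi (Psi_head a'') q z" using that by auto
    show "path_elem (Psi_tail a, a # a' # a'' # q, z) \<in> ?I"
    proof (cases "(a, a') \<in> {(T1, T2), (T3, T4), (T7, T7)}")
      case False
      then show ?thesis using bad[of a a'] cas by simp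
    next
      case True
      show ?thesis
      proof (cases "(a', a'') = (T7, T7)")
        case True
        then show ?thesis using T777 cas \<open>(a, a') \<in> _\<close> by auto
      next
        case False
        \<comment> \<open>The middle arrow is \<open>T2\<close>, \<open>T4\<close> or
          \<open>T7\<close>, and the first two of these begin no permitted pair.\<close>
        with True have "(a', a'') \<notin> {(T1, T2), (T3, T4), (T7, T7)}" by auto
        then have "path_elem (Psi_head a, a' # a'' # q, z) \<in> ?I"
          using bad[of a' a''] cas by simp
        then show ?thesis by (rule mult_l)
      qed
    qed
    have "arrow_val a * (arrow_val a' * arrow_val a'') = 0"
      by (cases a; cases a'; cases a''; simp add: lam_defs)
    then show "path_val (Psi_tail a, a # a' # a'' # q, z) = 0"
      by (simp flip: mult.assoc)
  qed
  obtain x l z where p: "p = (x, l, z)" by (metis prod_cases3)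
  with assms have cas: "pre_digraph.cas Psi x l z" by (simp add: paths_Psi)
  consider "l = []" | a where "l = [a]" | a a' where "l = [a, a']" | a a' a'' q where "l = a # a' # a'' # q"
    by (metis neq_Nil_conv)
  then show ?thesis
  proof cases
    case 1
    then have "(\<lambda>q. path_elem p q + path_normal (path_val p) q) = (\<lambda>_. 0)"
      using cas p by (cases x) (auto simp: path_normal_def fun_eq_iff lam_defs)
    then show ?thesis using zero by simp
  next
    case (2 a)
    then have "(\<lambda>q. path_elem p q + path_normal (path_val p) q) = (\<lambda>_. 0)"
      using cas p by (cases a) (auto simp: path_normal_def fun_eq_iff lam_defs)
    then show ?thesis using zero by simp
  next
    case (3 a a')
    then have l: "x = Psi_tail a" "Psi_head a = Psi_tail a'" "z = Psi_head a'" using cas by auto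
    consider "(a, a') \<in> {(T1, T2), (T3, T4)}" | "(a, a') = (T7, T7)"
      | "(a, a') \<notin> {(T1, T2), (T3, T4), (T7, T7)}" by blast
    then show ?thesis
    proof cases
      case 1
      then have "(\<lambda>q. path_elem p q + path_normal (path_val p) q) = (\<lambda>_. 0)"
        using 1 l unfolding p \<open>l = [a, a']\<close>
        by (elim insertE emptyE) (simp_all add: path_normal_def fun_eq_iff lam_defs)
      then show ?thesis using zero by simp
    next
      case 2
      \<comment> \<open>\<open>T7 T7\<close> and \<open>T1 T2\<close> have the same value, so the
        difference to the normal form is the last relation.\<close>
      then have "(\<lambda>q. path_elem p q + path_normal (path_val p) q) =
        (\<lambda>q. path_elem (E5, [T7, T7], E5) q + path_elem (E5, [T1, T2], E5) q)"
        using 2 l unfolding p \<open>l = [a, a']\<close>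
        by (simp add: path_normal_def fun_eq_iff lam_defs)
      then show ?thesis using rel by (simp add: Psi_relations_eq)
    next
      case 3
      have "path_val p = 0"
        using l p \<open>l = [a, a']\<close> 3 by (cases a; cases a') (simp_all add: lam_defs)
      then show ?thesis
        using two[OF l(2) 3] l p \<open>l = [a, a']\<close> by (simp add: path_normal_zero del: add_bit_eq_xor path_val.simps)
    qed
  next
    case (4 a a' a'' q)
    then show ?thesis
      using long[of a a' a'' q z] cas p by (auto simp: path_normal_zero simp del: path_val.simps add_bit_eq_xor)
  qed
qed

text \<open>The kernel is an ideal containing the relations, hence contains the ideal they generate;
  the converse is the congruence of each path with its normal form.\<close>

lemma Idl_Psi_relations:
  "Idl\<^bsub>F2Psi\<^esub> Psi_relations = {f \<in> carrier F2Psi. lin_ext path_val f = 0}" (is "?I = _")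
proof -
  interpret F2Psi: ring F2Psi by (rule ring_F2Psi)
  interpret h: ring_hom_ring F2Psi "corner lam_e" "lin_ext path_val"
    by (intro ring_hom_ringI2 ring_F2Psi ring_corner lam_e_idem lin_ext_path_val_hom)
  have ker: "a_kernel F2Psi (corner lam_e) (lin_ext path_val) = {f \<in> carrier F2Psi. lin_ext path_val f = 0}"
    unfolding a_kernel_def' corner_sel by (rule refl)
  have "lin_ext path_val (path_elem (E5, [T7, T7], E5) \<oplus>\<^bsub>F2Psi\<^esub> path_elem (E5, [T1, T2], E5)) = 0"
    by (subst h.hom_add) (simp_all add: path_elem_carrier paths_Psi lam_defs)
  then have rel0: "lin_ext path_val f = 0" if "f \<in> Psi_relations" for f
    using that unfolding Psi_relations_eq F2Psi_sel by (auto simp: lam_defs)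
  then have sub: "?I \<subseteq> {f \<in> carrier F2Psi. lin_ext path_val f = 0}"
    unfolding ker[symmetric] using Psi_relations_carrier rel0
    by (intro F2Psi.genideal_minimal h.kernel_is_ideal) (unfold ker, blast)
  interpret I: ideal ?I F2Psi by (rule F2Psi.genideal_ideal[OF Psi_relations_carrier])
  have "?I = {f \<in> carrier (basis_alg (paths Psi) path_comp
      (\<lambda>(x, p, y). if x \<in> verts Psi \<and> p = [] \<and> x = y then 1 else 0)). lin_ext path_val f = 0}"
  proof (rule lin_ext_kernel)
    show "(\<lambda>_. 0) \<in> ?I" using I.zero_closed by (simp add: F2Psi_sel)
    show "(\<lambda>p. f p + g p) \<in> ?I" if "f \<in> ?I" "g \<in> ?I" for f g
      using I.a_closed[OF that] by (simp add: F2Psi_sel)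
    show "f \<in> carrier (basis_alg (paths Psi) path_comp
        (\<lambda>(x, p, y). if x \<in> verts Psi \<and> p = [] \<and> x = y then 1 else 0)) \<and> lin_ext path_val f = 0"
      if "f \<in> ?I" for f
      using that sub unfolding F2Psi_def path_alg_def by blast
  qed (rule lam_bit_add_self path_normal_zero path_normal_add path_normal_basis; assumption?)+
  then show ?thesis by (simp add: F2Psi_def path_alg_def)
qed

text \<open>Turns a conditional on a bit into coordinatewise multiplication, so that sums of
  conditionals can be added in coordinates.\<close>

lemma lam_if:
  "(if k = (1::bit) then P else 0) = Lam (k * c_s11 P) (k * c_s12 P) (k * c_s13 P) (k * c_s21 P) (k * c_s22 P) (k * c_s23 P) (k * c_s31 P) (k * c_s32 P) (k * c_s33 P) (k * c_t1 P) (k * c_t2 P) (k * c_t3 P) (k * c_u P) (k * c_v P) (k * c_x1 P) (k * c_x2 P) (k * c_x3 P) (k * c_y P) (k * c_a P) (k * c_b P) (k * c_c P) (k * c_d P)"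
  by (cases k; cases P) (simp_all add: zero_lam_def del: mult_bit_eq_and)

lemma lin_ext_path_val_surj:
  assumes "z \<in> carrier (corner lam_e)"
  shows "\<exists>f\<in>carrier F2Psi. lin_ext path_val f = z"
proof -
  interpret F2Psi: ring F2Psi by (rule ring_F2Psi)
  interpret h: ring_hom_ring F2Psi "corner lam_e" "lin_ext path_val"
    by (intro ring_hom_ringI2 ring_F2Psi ring_corner lam_e_idem lin_ext_path_val_hom)
  let ?s = "\<lambda>k p. if k = (1::bit) then path_elem p else \<zero>\<^bsub>F2Psi\<^esub>"
  have s: "?s k p \<in> carrier F2Psi" "lin_ext path_val (?s k p) = (if k = 1 then path_val p else 0)"
    if "p \<in> paths Psi" for k p
    using that F2Psi.zero_closed by (auto simp: path_elem_carrier F2Psi_sel(2))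
  let ?f = "?s (c_s33 z) (E3, [], E3) \<oplus>\<^bsub>F2Psi\<^esub> ?s (c_u z) (E4, [], E4) \<oplus>\<^bsub>F2Psi\<^esub> ?s (c_a z) (E5, [], E5)
    \<oplus>\<^bsub>F2Psi\<^esub> ?s (c_x3 z) (E5, [T1], E3) \<oplus>\<^bsub>F2Psi\<^esub> ?s (c_t3 z) (E3, [T2], E5) \<oplus>\<^bsub>F2Psi\<^esub> ?s (c_y z) (E5, [T3], E4)
    \<oplus>\<^bsub>F2Psi\<^esub> ?s (c_v z) (E4, [T4], E5) \<oplus>\<^bsub>F2Psi\<^esub> ?s (c_b z) (E5, [T7], E5)
    \<oplus>\<^bsub>F2Psi\<^esub> ?s (c_c z) (E5, [T1, T2], E5) \<oplus>\<^bsub>F2Psi\<^esub> ?s (c_d z) (E5, [T3, T4], E5)"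
  have "?f \<in> carrier F2Psi"
    by (intro F2Psi.a_closed s) (simp_all add: paths_Psi)
  moreover have "lin_ext path_val ?f = z"
  proof -
    have "lin_ext path_val ?f = (if c_s33 z = 1 then path_val (E3, [], E3) else 0) + (if c_u z = 1 then path_val (E4, [], E4) else 0)
      + (if c_a z = 1 then path_val (E5, [], E5) else 0) + (if c_x3 z = 1 then path_val (E5, [T1], E3) else 0)
      + (if c_t3 z = 1 then path_val (E3, [T2], E5) else 0) + (if c_y z = 1 then path_val (E5, [T3], E4) else 0)
      + (if c_v z = 1 then path_val (E4, [T4], E5) else 0) + (if c_b z = 1 then path_val (E5, [T7], E5) else 0)
      + (if c_c z = 1 then path_val (E5, [T1, T2], E5) else 0) + (if c_d z = 1 then path_val (E5, [T3, T4], E5) else 0)"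
      by (simp only: h.hom_add F2Psi.a_closed s paths_Psi cas_Psi_simps Psi_tail.simps Psi_head.simps corner_sel simp_thms)
    also have "\<dots> = Lam 0 0 0 0 0 0 0 0 (c_s33 z) 0 0 (c_t3 z) (c_u z) (c_v z) 0 0 (c_x3 z) (c_y z) (c_a z) (c_b z) (c_c z) (c_d z)"
      unfolding lam_if by (simp add: lam_defs del: add_bit_eq_xor mult_bit_eq_and)
    also have "\<dots> = z"
      using assms unfolding carrier_corner_lam_e by auto
    finally show ?thesis .
  qed
  ultimately show ?thesis by blast
qed

lemma F2Psi_quot_iso:
  "(\<lambda>z. {f \<in> carrier F2Psi. lin_ext path_val f = z}) \<in>
    ring_iso (corner lam_e) (F2Psi Quot (Idl\<^bsub>F2Psi\<^esub> Psi_relations))"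
  "f \<in> carrier F2Psi \<Longrightarrow> Idl\<^bsub>F2Psi\<^esub> Psi_relations +>\<^bsub>F2Psi\<^esub> f =
    {f' \<in> carrier F2Psi. lin_ext path_val f' = lin_ext path_val f}"
proof -
  interpret F2Psi: ring F2Psi by (rule ring_F2Psi)
  have I: "Idl\<^bsub>F2Psi\<^esub> Psi_relations = {f \<in> carrier F2Psi. lin_ext path_val f = \<zero>\<^bsub>corner lam_e\<^esub>}"
    by (simp add: Idl_Psi_relations)
  note * = quot_by_kernel[OF F2Psi.is_abelian_group ring_corner[OF lam_e_idem] F2Psi.m_closed F2Psi.one_closed
    ring_hom_memE(1,3,2,4)[OF lin_ext_path_val_hom] lin_ext_path_val_surj I]
  show "(\<lambda>z. {f \<in> carrier F2Psi. lin_ext path_val f = z}) \<in>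
    ring_iso (corner lam_e) (F2Psi Quot (Idl\<^bsub>F2Psi\<^esub> Psi_relations))"
    by (rule *)
  show "f \<in> carrier F2Psi \<Longrightarrow> Idl\<^bsub>F2Psi\<^esub> Psi_relations +>\<^bsub>F2Psi\<^esub> f =
    {f' \<in> carrier F2Psi. lin_ext path_val f' = lin_ext path_val f}"
    by (rule *)
qed

section \<open>Reduction of the order\<close>

lemma Z_loc2_of_int [simp]: "of_int n \<in> Z_loc2"
  unfolding Z_loc2_def by (rule CollectI, rule exI[of _ n], rule exI[of _ 1]) simp

lemma Z_loc2_numeral [simp]: "0 \<in> Z_loc2" "1 \<in> Z_loc2" "numeral k \<in> Z_loc2"
  using Z_loc2_of_int[of 0] Z_loc2_of_int[of 1] Z_loc2_of_int[of "numeral k"] by simp_all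

lemma Z_loc2_add [simp]: "p \<in> Z_loc2 \<Longrightarrow> q \<in> Z_loc2 \<Longrightarrow> p + q \<in> Z_loc2"
proof -
  assume "p \<in> Z_loc2" "q \<in> Z_loc2"
  then obtain a b c d :: int where *: "p = of_int a / of_int b" "odd b" "q = of_int c / of_int d" "odd d"
    unfolding Z_loc2_def by auto
  then have "of_int b \<noteq> (0::rat)" "of_int d \<noteq> (0::rat)" by auto
  with * have "p + q = of_int (a * d + c * b) / of_int (b * d)"
    by (simp add: add_frac_eq)
  moreover have "odd (b * d)" using * by simp
  ultimately show ?thesis unfolding Z_loc2_def by blast
qed

lemma Z_loc2_mult [simp]: "p \<in> Z_loc2 \<Longrightarrow> q \<in> Z_loc2 \<Longrightarrow> p * q \<in> Z_loc2"
proof -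
  assume "p \<in> Z_loc2" "q \<in> Z_loc2"
  then obtain a b c d :: int where *: "p = of_int a / of_int b" "odd b" "q = of_int c / of_int d" "odd d"
    unfolding Z_loc2_def by auto
  then have "p * q = of_int (a * c) / of_int (b * d)" by simp
  moreover have "odd (b * d)" using * by simp
  ultimately show ?thesis unfolding Z_loc2_def by blast
qed

lemma Z_loc2_uminus [simp]: "p \<in> Z_loc2 \<Longrightarrow> - p \<in> Z_loc2"
  using Z_loc2_mult[OF Z_loc2_of_int[of "-1"]] by simp

lemma Z_loc2_diff [simp]: "p \<in> Z_loc2 \<Longrightarrow> q \<in> Z_loc2 \<Longrightarrow> p - q \<in> Z_loc2"
  using Z_loc2_add[of p "- q"] by simp

lemma half_notin_Z_loc2: "1 / 2 \<notin> Z_loc2"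
proof
  assume "1 / 2 \<in> Z_loc2"
  then obtain a b :: int where *: "1 / 2 = (of_int a / of_int b :: rat)" "odd b" unfolding Z_loc2_def by auto
  then have "b \<noteq> 0" by auto
  with * have "of_int b = (of_int (2 * a) :: rat)" by (simp add: field_simps)
  then have "b = 2 * a" by (simp only: of_int_eq_iff)
  with * show False by simp
qed

section \<open>The residue field of the localization at 2\<close>

definition residue2 :: "rat \<Rightarrow> bit" where
  "residue2 p = (if p / 2 \<in> Z_loc2 then 0 else 1)"

lemma residue2_cases:
  assumes "p \<in> Z_loc2"
  obtains q where "q \<in> Z_loc2" "p = 2 * q" | q where "q \<in> Z_loc2" "p = 2 * q + 1"
proof -
  obtain a b :: int where *: "p = of_int a / of_int b" "odd b" using assms unfolding Z_loc2_def by auto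
  then have b: "of_int b \<noteq> (0::rat)" by auto
  show thesis
  proof (cases "even a")
    case True
    then obtain k where "a = 2 * k" by auto
    then have "p = 2 * (of_int k / of_int b)" using * by simp
    then show ?thesis using that(1) * unfolding Z_loc2_def by blast
  next
    case False
    then have "even (a - b)" using * by simp
    then obtain k where "a - b = 2 * k" by blast
    then have "a = 2 * k + b" by simp
    then have "p = 2 * (of_int k / of_int b) + 1" using * b by (simp add: add_divide_distrib)
    then show ?thesis using that(2) * unfolding Z_loc2_def by blast
  qed
qed

lemma residue2_even [simp]: "q \<in> Z_loc2 \<Longrightarrow> residue2 (2 * q) = 0"
  by (simp add: residue2_def)

lemma residue2_odd [simp]: "q \<in> Z_loc2 \<Longrightarrow> residue2 (2 * q + 1) = 1"
proof -
  assume q: "q \<in> Z_loc2"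
  have "(2 * q + 1) / 2 \<notin> Z_loc2"
  proof
    assume "(2 * q + 1) / 2 \<in> Z_loc2"
    then have "(2 * q + 1) / 2 - q \<in> Z_loc2" using q by (rule Z_loc2_diff)
    then show False using half_notin_Z_loc2 by (simp add: add_divide_distrib)
  qed
  then show ?thesis by (simp add: residue2_def)
qed

lemma residue2_zero_iff: "p \<in> Z_loc2 \<Longrightarrow> residue2 p = 0 \<longleftrightarrow> (\<exists>q\<in>Z_loc2. p = 2 * q)"
  by (rule residue2_cases[of p]) (auto, metis residue2_even residue2_odd zero_neq_one)

lemma residue2_add: "residue2 (p + q) = residue2 p + residue2 q" if P: "p \<in> Z_loc2" and Q: "q \<in> Z_loc2"
proof -
  obtain p' where p: "p' \<in> Z_loc2" "p = 2 * p' \<or> p = 2 * p' + 1" using residue2_cases[OF P] by metis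
  obtain q' where q: "q' \<in> Z_loc2" "q = 2 * q' \<or> q = 2 * q' + 1" using residue2_cases[OF Q] by metis
  have eq: "2 * p' + 2 * q' = 2 * (p' + q')" "2 * p' + 1 + 2 * q' = 2 * (p' + q') + 1"
    "2 * p' + (2 * q' + 1) = 2 * (p' + q') + 1" "2 * p' + 1 + (2 * q' + 1) = 2 * (p' + q' + 1)"
    by simp_all
  show ?thesis
    using p q Z_loc2_add[OF p(1) q(1)] Z_loc2_add[OF Z_loc2_add[OF p(1) q(1)] Z_loc2_numeral(2)]
    by (elim disjE; simp only: eq residue2_even residue2_odd; simp)
qed

lemma residue2_mult: "residue2 (p * q) = residue2 p * residue2 q" if P: "p \<in> Z_loc2" and Q: "q \<in> Z_loc2"
proof -
  obtain p' where p: "p' \<in> Z_loc2" "p = 2 * p' \<or> p = 2 * p' + 1" using residue2_cases[OF P] by metis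
  obtain q' where q: "q' \<in> Z_loc2" "q = 2 * q' \<or> q = 2 * q' + 1" using residue2_cases[OF Q] by metis
  have eq: "2 * p' * (2 * q') = 2 * (2 * p' * q')" "(2 * p' + 1) * (2 * q') = 2 * ((2 * p' + 1) * q')"
    "2 * p' * (2 * q' + 1) = 2 * (p' * (2 * q' + 1))" "(2 * p' + 1) * (2 * q' + 1) = 2 * (2 * p' * q' + p' + q') + 1"
    by (simp_all add: algebra_simps)
  have "2 * p' * q' \<in> Z_loc2" "(2 * p' + 1) * q' \<in> Z_loc2" "p' * (2 * q' + 1) \<in> Z_loc2"
    "2 * p' * q' + p' + q' \<in> Z_loc2"
    using p(1) q(1) by simp_all
  then show ?thesis
    using p q by (elim disjE; simp only: eq residue2_even residue2_odd; simp)
qed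

text \<open>The constants 2 and 6 are the coefficients in the product formula for
  \<open>lattice_elem\<close> that vanish modulo 2.\<close>

lemma residue2_numeral [simp]: "residue2 0 = 0" "residue2 1 = 1" "residue2 2 = 0" "residue2 6 = 0"
  using residue2_even[of 0] residue2_odd[of 0] residue2_even[of 1] residue2_even[of 3] by simp_all

lemma residue2_uminus: "p \<in> Z_loc2 \<Longrightarrow> residue2 (- p) = residue2 p"
  using residue2_add[of p "- p"] by (cases "residue2 p"; cases "residue2 (- p)") auto

lemma residue2_diff: "p \<in> Z_loc2 \<Longrightarrow> q \<in> Z_loc2 \<Longrightarrow> residue2 (p - q) = residue2 p + residue2 q"
  using residue2_add[of p "- q"] residue2_uminus by simp

section \<open>Coordinates on the corner of the order\<close>

definition mat33 :: "rat \<Rightarrow> rat^3^3" where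
  "mat33 s = (\<chi> i j. if i = 3 \<and> j = 3 then s else 0)"

definition vec3 :: "rat \<Rightarrow> rat^3" where
  "vec3 t = (\<chi> i. if i = 3 then t else 0)"

lemma mat33_simps:
  "mat33 s $ i $ j = (if i = 3 \<and> j = 3 then s else 0)" "vec3 t $ i = (if i = 3 then t else 0)"
  "mat33 s ** mat33 s' = mat33 (s * s')" "mat33 s ** X ** mat33 s' = mat33 (s * X $ 3 $ 3 * s')"
  "mat33 s *v z = vec3 (s * z $ 3)" "z v* mat33 s = vec3 (z $ 3 * s)"
  "scalar_product z (vec3 t) = z $ 3 * t" "c *s vec3 t = vec3 (c * t)"
  "mat33 s + mat33 s' = mat33 (s + s')" "vec3 t + vec3 t' = vec3 (t + t')"
  "mat33 0 = 0" "vec3 0 = 0"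
  by (simp_all add: mat33_def vec3_def vec_eq_iff matrix_matrix_mult_def matrix_vector_mult_def
    vector_matrix_mult_def scalar_product_def forall_3 sum_3)

definition corner_arr :: "rat \<Rightarrow> rat \<Rightarrow> rat \<Rightarrow> rat \<Rightarrow> rat \<Rightarrow> rat \<Rightarrow> rat \<Rightarrow> rat \<Rightarrow> rat \<Rightarrow> rat \<Rightarrow> arr" where
  "corner_arr s t u v w x y z1 z2 z3 = \<lparr>blk11 = mat33 s,
     blk14 = vec3 t, blk22 = u, blk24 = v, blk33 = w,
     blk41 = vec3 x, blk42 = y, blk44 = LocEl z1 z2 z3\<rparr>"

lemma corner_arr_mult:
  "corner_arr s t u v w x y z1 z2 z3 \<otimes>\<^bsub>alg_A\<^esub> corner_arr s' t' u' v' w' x' y' z1' z2' z3' =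
    corner_arr (s * s') (s * t' + t * z1') (u * u') (u * v' + v * z1') (w * w') (x * s' + z1 * x') (y * u' + z1 * y')
      (z1 * z1') (z1 * z2' + z2 * z1' + x * t' - 12 * y * v') (z1 * z3' + z3 * z1' + y * v')"
  unfolding corner_arr_def alg_A_def
  by (simp add: mat33_simps loc_add_def loc_scale_def loc_mult_def vec_eq_iff algebra_simps)

lemma corner_arr_eq_iff:
  "corner_arr s t u v w x y z1 z2 z3 = corner_arr s' t' u' v' w' x' y' z1' z2' z3' \<longleftrightarrow>
    s = s' \<and> t = t' \<and> u = u' \<and> v = v' \<and> w = w' \<and> x = x' \<and> y = y' \<and> z1 = z1' \<and> z2 = z2' \<and> z3 = z3'"
proof -
  have "mat33 s = mat33 s' \<longleftrightarrow> s = s'" "vec3 t = vec3 t' \<longleftrightarrow> t = t'" for s s' t t'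
    by (auto simp: mat33_def vec3_def vec_eq_iff)
  then show ?thesis by (auto simp: corner_arr_def)
qed

lemma corner_arr_add:
  "corner_arr s t u v w x y z1 z2 z3 \<oplus>\<^bsub>alg_A\<^esub> corner_arr s' t' u' v' w' x' y' z1' z2' z3' =
    corner_arr (s + s') (t + t') (u + u') (v + v') (w + w') (x + x') (y + y') (z1 + z1') (z2 + z2') (z3 + z3')"
  by (simp add: corner_arr_def alg_A_def mat33_simps loc_add_def)

lemma idem345_eq: "idem345 = corner_arr 1 0 1 0 1 0 0 1 0 0"
  by (simp add: idem345_def idem3_def idem4_def idem5_def alg_A_def corner_arr_def loc_add_def
    mat33_simps mat33_def[of 1])

lemma idem345_conj:
  "idem345 \<otimes>\<^bsub>alg_A\<^esub> z \<otimes>\<^bsub>alg_A\<^esub> idem345 =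
    corner_arr (blk11 z $ 3 $ 3) (blk14 z $ 3) (blk22 z) (blk24 z) (blk33 z) (blk41 z $ 3) (blk42 z)
      (cf_one (blk44 z)) (cf_eta (blk44 z)) (cf_xi (blk44 z))"
  by (simp add: idem345_eq corner_arr_def alg_A_def mat33_simps loc_add_def loc_scale_def loc_mult_def
    scalar_product_def loc_alg.expand)

text \<open>The entries are chosen so that the congruences defining \<^const>\<open>Lambda2\<close> hold for all values of
  the parameters; the parameter \<open>b\<close> is the coefficient of $\tau_7 = 2 e_{5,5} + 4\bar\eta$.\<close>

definition lattice_elem where
  "lattice_elem s t u v x y a b c d =
    corner_arr s (2 * t) u (2 * v) (a + 2 * b) (4 * x) (2 * y) a (4 * b + 8 * c) (4 * d)"

lemma lattice_elem_eq_iff: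
  "lattice_elem s t u v x y a b c d = lattice_elem s' t' u' v' x' y' a' b' c' d' \<longleftrightarrow>
    s = s' \<and> t = t' \<and> u = u' \<and> v = v' \<and> x = x' \<and> y = y' \<and> a = a' \<and> b = b' \<and> c = c' \<and> d = d'"
  by (auto simp: lattice_elem_def corner_arr_eq_iff)

text \<open>The entry \<open>w\<close> multiplies as \<open>(a + 2 b) (a' + 2 b')\<close>, which
  determines the new \<open>b\<close>, with its term \<open>2 b b'\<close>. The coefficient of eta
  has to be 4 times this \<open>b\<close> plus 8 times the new \<open>c\<close>; compensating the
  surplus \<open>8 b b'\<close> yields the term \<open>- b b'\<close> in \<open>c\<close>, and
  \<open>6 y v'\<close> is \<open>12 * 2 y * 2 v'\<close> divided by 8.\<close>

lemma lattice_elem_mult: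
  "lattice_elem s t u v x y a b c d \<otimes>\<^bsub>alg_A\<^esub> lattice_elem s' t' u' v' x' y' a' b' c' d' =
    lattice_elem (s * s') (s * t' + t * a') (u * u') (u * v' + v * a') (x * s' + a * x') (y * u' + a * y')
      (a * a') (a * b' + b * a' + 2 * b * b') (a * c' + c * a' - b * b' + x * t' - 6 * y * v')
      (a * d' + d * a' + y * v')"
  by (simp add: lattice_elem_def corner_arr_mult corner_arr_eq_iff algebra_simps)

lemma lattice_elem_add:
  "lattice_elem s t u v x y a b c d \<oplus>\<^bsub>alg_A\<^esub> lattice_elem s' t' u' v' x' y' a' b' c' d' =
    lattice_elem (s + s') (t + t') (u + u') (v + v') (x + x') (y + y') (a + a') (b + b') (c + c') (d + d')"
  by (simp add: lattice_elem_def corner_arr_add corner_arr_eq_iff algebra_simps)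

lemma idem345_lattice_elem: "idem345 = lattice_elem 1 0 1 0 0 0 1 0 0 0"
  by (simp add: idem345_eq lattice_elem_def)

lemma carrier_Lambda2': "carrier Lambda2' = {lattice_elem s t u v x y a b c d | s t u v x y a b c d.
    {s, t, u, v, x, y, a, b, c, d} \<subseteq> Z_loc2}" (is "_ = ?R")
proof (intro subset_antisym subsetI)
  fix z assume "z \<in> carrier Lambda2'"
  then obtain l where l: "l \<in> Lambda2" "z = idem345 \<otimes>\<^bsub>alg_A\<^esub> l \<otimes>\<^bsub>alg_A\<^esub> idem345"
    by (auto simp: Lambda2'_def)
  then obtain s t u v w x y z1 z2 z3 where
    "l = \<lparr>blk11 = s, blk14 = t, blk22 = u, blk24 = v, blk33 = w, blk41 = x, blk42 = y, blk44 = LocEl z1 z2 z3\<rparr>"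
    and Z: "s $ 3 $ 3 \<in> Z_loc2" "{u, v, w, y, z1, z2, z3} \<subseteq> Z_loc2"
    and c: "cong_loc2 (2 * w - 2 * z1) z2 8" "cong_loc2 z2 z3 4" "cong_loc2 z3 0 4"
      "cong_loc2 (x $ 3) 0 4" "cong_loc2 y 0 2" "cong_loc2 (t $ 3) 0 2" "cong_loc2 v 0 2"
    unfolding Lambda2_def by auto
  then have z: "z = corner_arr (s $ 3 $ 3) (t $ 3) u v w (x $ 3) y z1 z2 z3"
    using l by (simp add: idem345_conj)
  obtain p q d x' y' t' v' where p: "p \<in> Z_loc2" "2 * w - 2 * z1 - z2 = 8 * p"
    and q: "q \<in> Z_loc2" "z2 - z3 = 4 * q" and d: "d \<in> Z_loc2" "z3 = 4 * d"
    and x': "x' \<in> Z_loc2" "x $ 3 = 4 * x'" and y': "y' \<in> Z_loc2" "y = 2 * y'"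
    and t': "t' \<in> Z_loc2" "t $ 3 = 2 * t'" and v': "v' \<in> Z_loc2" "v = 2 * v'"
    using c unfolding cong_loc2_def by auto
  \<comment> \<open>From \<open>z2 = 4 (q + d)\<close> and \<open>2 w = 2 z1 + z2 + 8 p\<close> one
    gets \<open>w = z1 + 2 (q + d + 2 p)\<close>, which gives \<open>b\<close>; then
    \<open>4 b + 8 c = z2\<close> forces \<open>c = - p\<close>.\<close>
  have "z = lattice_elem (s $ 3 $ 3) t' u v' x' y' z1 (q + d + 2 * p) (- p) d"
    unfolding z lattice_elem_def corner_arr_eq_iff using p q d x' y' t' v' by auto
  moreover have "{s $ 3 $ 3, t', u, v', x', y', z1, q + d + 2 * p, - p, d} \<subseteq> Z_loc2"
    using Z p q d x' y' t' v' by simp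
  ultimately show "z \<in> ?R" by blast
next
  fix z assume "z \<in> ?R"
  then obtain s t u v x y a b c d where z: "z = lattice_elem s t u v x y a b c d"
    and Z: "{s, t, u, v, x, y, a, b, c, d} \<subseteq> Z_loc2" by blast
  have "z = idem345 \<otimes>\<^bsub>alg_A\<^esub> z \<otimes>\<^bsub>alg_A\<^esub> idem345"
    by (simp add: z idem345_lattice_elem lattice_elem_mult)
  moreover have "z \<in> Lambda2"
  proof -
    have c: "cong_loc2 (2 * (a + 2 * b) - 2 * a) (4 * b + 8 * c) 8" "cong_loc2 (4 * b + 8 * c) (4 * d) 4"
      "cong_loc2 (4 * d) 0 4" "\<And>i. cong_loc2 (vec3 (4 * x) $ i) 0 4" "cong_loc2 (2 * y) 0 2"
      "\<And>i. cong_loc2 (vec3 (2 * t) $ i) 0 2" "cong_loc2 (2 * v) 0 2"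
    proof -
      \<comment> \<open>The difference of the two sides is exactly \<open>- 8 c\<close>.\<close>
      show "cong_loc2 (2 * (a + 2 * b) - 2 * a) (4 * b + 8 * c) 8"
        unfolding cong_loc2_def using Z by (intro bexI[of _ "- c"]) auto
      show "cong_loc2 (4 * b + 8 * c) (4 * d) 4"
        unfolding cong_loc2_def using Z by (intro bexI[of _ "b + 2 * c - d"]) auto
    qed (use Z in \<open>auto simp: cong_loc2_def mat33_simps\<close>)
    show ?thesis
      unfolding Lambda2_def mem_Collect_eq z lattice_elem_def corner_arr_def
      by (rule exI[of _ "mat33 s"], rule exI[of _ "vec3 (2 * t)"], rule exI[of _ u], rule exI[of _ "2 * v"],
          rule exI[of _ "a + 2 * b"], rule exI[of _ "vec3 (4 * x)"], rule exI[of _ "2 * y"], rule exI[of _ a],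
          rule exI[of _ "4 * b + 8 * c"], rule exI[of _ "4 * d"])
        (intro conjI refl allI c; use Z in \<open>auto simp: mat33_simps(1,2)\<close>)
  qed
  ultimately show "z \<in> carrier Lambda2'" by (auto simp: Lambda2'_def)
qed

lemma lattice_elem_mem:
  "{s, t, u, v, x, y, a, b, c, d} \<subseteq> Z_loc2 \<Longrightarrow> lattice_elem s t u v x y a b c d \<in> carrier Lambda2'"
  unfolding carrier_Lambda2' by blast

lemma Lambda2'_cases:
  assumes "z \<in> carrier Lambda2'"
  obtains s t u v x y a b c d where "z = lattice_elem s t u v x y a b c d"
    "{s, t, u, v, x, y, a, b, c, d} \<subseteq> Z_loc2"
  using assms unfolding carrier_Lambda2' by blast

lemma Lambda2'_sel [simp]:
  "mult Lambda2' = mult alg_A" "add Lambda2' = add alg_A" "zero Lambda2' = zero alg_A" "one Lambda2' = idem345"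
  by (simp_all add: Lambda2'_def)

lemma zero_alg_A: "\<zero>\<^bsub>alg_A\<^esub> = lattice_elem 0 0 0 0 0 0 0 0 0 0"
  by (simp add: lattice_elem_def corner_arr_def mat33_simps alg_A_def)

lemma abelian_group_Lambda2': "abelian_group Lambda2'"
proof (rule abelian_groupI; unfold Lambda2'_sel carrier_Lambda2' zero_alg_A)
  let ?R = "{lattice_elem s t u v x y a b c d | s t u v x y a b c d.
    {s, t, u, v, x, y, a, b, c, d} \<subseteq> Z_loc2}"
  {
    fix z z' assume "z \<in> ?R" "z' \<in> ?R"
    then show "z \<oplus>\<^bsub>alg_A\<^esub> z' \<in> ?R" by (fastforce simp: lattice_elem_add lattice_elem_eq_iff)
  next
    fix z z' z'' assume "z \<in> ?R" "z' \<in> ?R" "z'' \<in> ?R"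
    then show "z \<oplus>\<^bsub>alg_A\<^esub> z' \<oplus>\<^bsub>alg_A\<^esub> z'' = z \<oplus>\<^bsub>alg_A\<^esub> (z' \<oplus>\<^bsub>alg_A\<^esub> z'')"
      by (auto simp: lattice_elem_add add.assoc)
  next
    fix z z' assume "z \<in> ?R" "z' \<in> ?R"
    then show "z \<oplus>\<^bsub>alg_A\<^esub> z' = z' \<oplus>\<^bsub>alg_A\<^esub> z"
      by (auto simp: lattice_elem_add add.commute)
  next
    show "lattice_elem 0 0 0 0 0 0 0 0 0 0 \<in> ?R" by fastforce
  next
    fix z assume "z \<in> ?R"
    then show "lattice_elem 0 0 0 0 0 0 0 0 0 0 \<oplus>\<^bsub>alg_A\<^esub> z = z"
      by (auto simp: lattice_elem_add)
  next
    fix z assume "z \<in> ?R"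
    then obtain s t u v x y a b c d where z: "z = lattice_elem s t u v x y a b c d"
      "{s, t, u, v, x, y, a, b, c, d} \<subseteq> Z_loc2" by blast
    then have "lattice_elem (-s) (-t) (-u) (-v) (-x) (-y) (-a) (-b) (-c) (-d) \<in> ?R" by fastforce
    moreover have "lattice_elem (-s) (-t) (-u) (-v) (-x) (-y) (-a) (-b) (-c) (-d) \<oplus>\<^bsub>alg_A\<^esub> z =
      lattice_elem 0 0 0 0 0 0 0 0 0 0" by (simp add: z lattice_elem_add)
    ultimately show "\<exists>z'\<in>?R. z' \<oplus>\<^bsub>alg_A\<^esub> z = lattice_elem 0 0 0 0 0 0 0 0 0 0"
      by (rule bexI[rotated])
  }
qed

text \<open>Solves for the parameters of \<open>lattice_elem\<close>: \<open>w - z1\<close> is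
  \<open>2 b\<close>, and the coefficient of eta minus \<open>2 w - 2 z1\<close> is
  \<open>8 c\<close>.\<close>

definition reduce :: "arr \<Rightarrow> bit lam" where
  "reduce z = (let s = residue2 (blk11 z $ 3 $ 3); t = residue2 (blk14 z $ 3 / 2); u = residue2 (blk22 z);
     v = residue2 (blk24 z / 2); x = residue2 (blk41 z $ 3 / 4); y = residue2 (blk42 z / 2);
     a = residue2 (cf_one (blk44 z)); b = residue2 ((blk33 z - cf_one (blk44 z)) / 2);
     c = residue2 ((cf_eta (blk44 z) - 2 * blk33 z + 2 * cf_one (blk44 z)) / 8);
     d = residue2 (cf_xi (blk44 z) / 4) in Lam 0 0 0 0 0 0 0 0 s 0 0 t u v 0 0 x y a b c d)"

lemma reduce_lattice_elem:
  "reduce (lattice_elem s t u v x y a b c d) = Lam 0 0 0 0 0 0 0 0 (residue2 s) 0 0 (residue2 t) (residue2 u) (residue2 v) 0 0 (residue2 x) (residue2 y) (residue2 a) (residue2 b) (residue2 c) (residue2 d)"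
  by (simp add: reduce_def Let_def lattice_elem_def corner_arr_def mat33_simps)

lemma
  shows Lambda2'_coset: "z \<in> carrier Lambda2' \<Longrightarrow> two_Lambda2' +>\<^bsub>Lambda2'\<^esub> z =
      {z' \<in> carrier Lambda2'. reduce z' = reduce z}"
    and Lambda2'_quot_iso: "(\<lambda>b. {z \<in> carrier Lambda2'. reduce z = b}) \<in>
      ring_iso (corner lam_e) (Lambda2' Quot two_Lambda2')"
    and Lambda2'_quot_ring: "ring (Lambda2' Quot two_Lambda2')"
proof -
  have mult: "z \<otimes>\<^bsub>Lambda2'\<^esub> z' \<in> carrier Lambda2' \<and> reduce (z \<otimes>\<^bsub>Lambda2'\<^esub> z') = reduce z * reduce z'"
    if zz: "z \<in> carrier Lambda2'" "z' \<in> carrier Lambda2'" for z z'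
  proof -
    obtain s t u v x y a b c d where z: "z = lattice_elem s t u v x y a b c d"
      "{s, t, u, v, x, y, a, b, c, d} \<subseteq> Z_loc2" by (rule Lambda2'_cases[OF zz(1)])
    obtain s' t' u' v' x' y' a' b' c' d' where z': "z' = lattice_elem s' t' u' v' x' y' a' b' c' d'"
      "{s', t', u', v', x', y', a', b', c', d'} \<subseteq> Z_loc2" by (rule Lambda2'_cases[OF zz(2)])
    have "{s * s', s * t' + t * a', u * u', u * v' + v * a', x * s' + a * x', y * u' + a * y',
      a * a', a * b' + b * a' + 2 * b * b', a * c' + c * a' - b * b' + x * t' - 6 * y * v',
      a * d' + d * a' + y * v'} \<subseteq> Z_loc2"
      using z(2) z'(2) by simp
    then have "z \<otimes>\<^bsub>Lambda2'\<^esub> z' \<in> carrier Lambda2'"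
      unfolding Lambda2'_sel z z' lattice_elem_mult by (rule lattice_elem_mem)
    moreover have "reduce (z \<otimes>\<^bsub>Lambda2'\<^esub> z') = reduce z * reduce z'"
      unfolding Lambda2'_sel z z' lattice_elem_mult reduce_lattice_elem using z(2) z'(2)
      by (simp add: residue2_add residue2_mult residue2_diff lam_defs ac_simps del: add_bit_eq_xor mult_bit_eq_and)
    ultimately show ?thesis by blast
  qed
  have add: "reduce (z \<oplus>\<^bsub>Lambda2'\<^esub> z') = reduce z + reduce z'"
    if zz: "z \<in> carrier Lambda2'" "z' \<in> carrier Lambda2'" for z z'
  proof -
    obtain s t u v x y a b c d where z: "z = lattice_elem s t u v x y a b c d"
      "{s, t, u, v, x, y, a, b, c, d} \<subseteq> Z_loc2" by (rule Lambda2'_cases[OF zz(1)])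
    obtain s' t' u' v' x' y' a' b' c' d' where z': "z' = lattice_elem s' t' u' v' x' y' a' b' c' d'"
      "{s', t', u', v', x', y', a', b', c', d'} \<subseteq> Z_loc2" by (rule Lambda2'_cases[OF zz(2)])
    show ?thesis
      unfolding Lambda2'_sel z z' lattice_elem_add reduce_lattice_elem using z(2) z'(2)
      by (simp add: residue2_add lam_defs del: add_bit_eq_xor)
  qed
  have corner: "reduce z \<in> carrier (corner lam_e)" if "z \<in> carrier Lambda2'" for z
    by (rule Lambda2'_cases[OF that]) (auto simp: reduce_lattice_elem carrier_corner_lam_e simp del: corner_sel(5))
  have one: "idem345 \<in> carrier Lambda2'" "reduce idem345 = lam_e"
    unfolding idem345_lattice_elem reduce_lattice_elem
    by (rule lattice_elem_mem, simp, simp add: lam_e_def)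
  have surj: "\<exists>z\<in>carrier Lambda2'. reduce z = r" if r_mem: "r \<in> carrier (corner lam_e)" for r
  proof -
    define lift :: "bit \<Rightarrow> rat" where "lift k = (if k = 1 then 1 else 0)" for k
    have lift: "lift k \<in> Z_loc2" "residue2 (lift k) = k" for k by (simp_all add: lift_def)
    obtain s t u v x y a b c d where r: "r = Lam 0 0 0 0 0 0 0 0 s 0 0 t u v 0 0 x y a b c d"
      using r_mem unfolding carrier_corner_lam_e by blast
    let ?z = "lattice_elem (lift s) (lift t) (lift u) (lift v) (lift x) (lift y) (lift a) (lift b) (lift c) (lift d)"
    have "{lift s, lift t, lift u, lift v, lift x, lift y, lift a, lift b, lift c, lift d} \<subseteq> Z_loc2"
      by (simp add: lift)
    then have "?z \<in> carrier Lambda2'" by (rule lattice_elem_mem)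
    moreover have "reduce ?z = r" by (simp add: reduce_lattice_elem r lift)
    ultimately show ?thesis by blast
  qed
  have I: "two_Lambda2' = {z \<in> carrier Lambda2'. reduce z = \<zero>\<^bsub>corner lam_e\<^esub>}"
  proof (intro subset_antisym subsetI)
    fix z assume "z \<in> two_Lambda2'"
    then obtain z' where z': "z = z' \<oplus>\<^bsub>Lambda2'\<^esub> z'" "z' \<in> carrier Lambda2'"
      by (auto simp: two_Lambda2'_def)
    interpret abelian_group Lambda2' by (rule abelian_group_Lambda2')
    show "z \<in> {z \<in> carrier Lambda2'. reduce z = \<zero>\<^bsub>corner lam_e\<^esub>}"
      using z' add[OF z'(2) z'(2)] a_closed[OF z'(2) z'(2)] by (simp add: lam_bit_add_self)
  next
    fix z assume z: "z \<in> {z \<in> carrier Lambda2'. reduce z = \<zero>\<^bsub>corner lam_e\<^esub>}"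
    then obtain s t u v x y a b c d where z': "z = lattice_elem s t u v x y a b c d"
      "{s, t, u, v, x, y, a, b, c, d} \<subseteq> Z_loc2" by (auto elim: Lambda2'_cases)
    then have "residue2 k = 0" if "k \<in> {s, t, u, v, x, y, a, b, c, d}" for k
      using z that by (auto simp: reduce_lattice_elem zero_lam_def)
    then have half: "\<exists>q\<in>Z_loc2. k = 2 * q" if "k \<in> {s, t, u, v, x, y, a, b, c, d}" for k
      using residue2_zero_iff[of k] z'(2) that by blast
    \<comment> \<open>All ten parameters are even; they range freely over the localization, so their
      halves define an element of the order again.\<close>
    obtain s' t' u' v' x' y' a' b' c' d' where
      *: "s = 2 * s'" "t = 2 * t'" "u = 2 * u'" "v = 2 * v'" "x = 2 * x'" "y = 2 * y'" "a = 2 * a'"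
        "b = 2 * b'" "c = 2 * c'" "d = 2 * d'"
        "{s', t', u', v', x', y', a', b', c', d'} \<subseteq> Z_loc2"
      using half[of s] half[of t] half[of u] half[of v] half[of x] half[of y] half[of a] half[of b]
        half[of c] half[of d] by auto
    have "lattice_elem s' t' u' v' x' y' a' b' c' d' \<in> carrier Lambda2'"
      using *(11) by (rule lattice_elem_mem)
    moreover have "z = lattice_elem s' t' u' v' x' y' a' b' c' d' \<oplus>\<^bsub>Lambda2'\<^esub> lattice_elem s' t' u' v' x' y' a' b' c' d'"
      by (simp add: z' * lattice_elem_add)
    ultimately show "z \<in> two_Lambda2'" unfolding two_Lambda2'_def by blast
  qed
  show "z \<in> carrier Lambda2' \<Longrightarrow> two_Lambda2' +>\<^bsub>Lambda2'\<^esub> z = {z' \<in> carrier Lambda2'. reduce z' = reduce z}"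
    and "(\<lambda>b. {z \<in> carrier Lambda2'. reduce z = b}) \<in> ring_iso (corner lam_e) (Lambda2' Quot two_Lambda2')"
    and "ring (Lambda2' Quot two_Lambda2')"
    using quot_by_kernel[OF abelian_group_Lambda2' ring_corner[OF lam_e_idem] conjunct1[OF mult] _ corner _ _ _ surj I]
      mult add one by simp_all
qed

section \<open>Sums over the fibres of a map\<close>

text \<open>For \<open>f\<close> constant on the fibres of \<open>k\<close>, each fibre contributes one value.\<close>

definition fib_sum :: "'x set \<Rightarrow> ('x \<Rightarrow> 'c) \<Rightarrow> ('x \<Rightarrow> 't::comm_monoid_add) \<Rightarrow> 't" where
  "fib_sum X k f = (\<Sum>c\<in>k ` X. f (SOME x. x \<in> X \<and> k x = c))"

definition fib_const :: "'x set \<Rightarrow> ('x \<Rightarrow> 'c) \<Rightarrow> ('x \<Rightarrow> 't) \<Rightarrow> bool" where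
  "fib_const X k f \<longleftrightarrow> (\<forall>x\<in>X. \<forall>y\<in>X. k x = k y \<longrightarrow> f x = f y)"

lemma fib_rep:
  assumes "fib_const X k f" "x \<in> X"
  shows "f (SOME y. y \<in> X \<and> k y = k x) = f x"
proof -
  have "(SOME y. y \<in> X \<and> k y = k x) \<in> X \<and> k (SOME y. y \<in> X \<and> k y = k x) = k x"
    by (rule someI[of _ x]) (simp add: assms(2))
  then show ?thesis using assms unfolding fib_const_def by blast
qed

text \<open>By \<open>key\<close> and \<open>surj\<close>, \<open>g\<close> induces a bijection
  between the fibres, whatever it does inside them. This compares orbits on different sets: tensor
  products, sets of pairs and the group itself.\<close>

lemma fib_sum_transfer:
  assumes g: "\<And>x. x \<in> X \<Longrightarrow> g x \<in> Y"
    and key: "\<And>x x'. x \<in> X \<Longrightarrow> x' \<in> X \<Longrightarrow> k x = k x' \<longleftrightarrow> l (g x) = l (g x')"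
    and surj: "\<And>y. y \<in> Y \<Longrightarrow> \<exists>x\<in>X. l (g x) = l y"
    and f: "\<And>x. x \<in> X \<Longrightarrow> f x = f' (g x)" and f': "fib_const Y l f'"
  shows "fib_sum X k f = fib_sum Y l f'"
proof -
  have f_const: "fib_const X k f"
    using f' key f g unfolding fib_const_def by metis
  define T where "T c = l (g (SOME x. x \<in> X \<and> k x = c))" for c
  have T: "T (k x) = l (g x)" if "x \<in> X" for x
  proof -
    have "(SOME y. y \<in> X \<and> k y = k x) \<in> X \<and> k (SOME y. y \<in> X \<and> k y = k x) = k x"
      by (rule someI[of _ x]) (simp add: that)
    then show ?thesis unfolding T_def using key that by metis
  qed
  have bij: "bij_betw T (k ` X) (l ` Y)"
  proof (rule bij_betw_imageI)
    show "inj_on T (k ` X)" using T key by (auto simp: inj_on_def)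
    show "T ` k ` X = l ` Y"
    proof
      show "T ` k ` X \<subseteq> l ` Y" using T g by auto
      show "l ` Y \<subseteq> T ` k ` X"
      proof
        fix c assume "c \<in> l ` Y"
        then obtain y where "y \<in> Y" "c = l y" by blast
        then obtain x where "x \<in> X" "l (g x) = c" using surj by metis
        then show "c \<in> T ` k ` X" using T by force
      qed
    qed
  qed
  have "fib_sum X k f = (\<Sum>c\<in>k ` X. f' (SOME y. y \<in> Y \<and> l y = T c))"
    unfolding fib_sum_def
  proof (rule sum.cong[OF refl])
    fix c assume "c \<in> k ` X"
    then obtain x where x: "x \<in> X" "c = k x" by blast
    then show "f (SOME x. x \<in> X \<and> k x = c) = f' (SOME y. y \<in> Y \<and> l y = T c)"
      using fib_rep[OF f_const x(1)] fib_rep[OF f' g[OF x(1)]] f T by simp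
  qed
  also have "\<dots> = fib_sum Y l f'"
    unfolding fib_sum_def by (rule sum.reindex_bij_betw[OF bij])
  finally show ?thesis .
qed

text \<open>For \<open>k\<close> finer than \<open>j\<close>; it serves to sort the orbits on pairs
  by the pair of orbits of the components.\<close>

lemma fib_sum_refine:
  assumes "finite X" and kj: "\<And>x x'. x \<in> X \<Longrightarrow> x' \<in> X \<Longrightarrow> k x = k x' \<Longrightarrow> j x = j x'"
    and f: "fib_const X k f"
  shows "fib_sum X k f = (\<Sum>d\<in>j ` X. fib_sum {x \<in> X. j x = d} k f)"
proof -
  have sub: "fib_const {x \<in> X. j x = d} k f" for d
    using f unfolding fib_const_def by blast
  define T where "T c = j (SOME x. x \<in> X \<and> k x = c)" for c
  have T: "T (k x) = j x" if "x \<in> X" for x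
  proof -
    have "(SOME y. y \<in> X \<and> k y = k x) \<in> X \<and> k (SOME y. y \<in> X \<and> k y = k x) = k x"
      by (rule someI[of _ x]) (simp add: that)
    then show ?thesis unfolding T_def using kj that by metis
  qed
  have "fib_sum X k f = (\<Sum>d\<in>j ` X. \<Sum>c\<in>{c \<in> k ` X. T c = d}. f (SOME x. x \<in> X \<and> k x = c))"
    unfolding fib_sum_def using assms(1) T by (intro sum.group[symmetric]) auto
  also have "\<dots> = (\<Sum>d\<in>j ` X. fib_sum {x \<in> X. j x = d} k f)"
  proof (rule sum.cong[OF refl])
    fix d
    have "{c \<in> k ` X. T c = d} = k ` {x \<in> X. j x = d}" using T by auto
    moreover have "f (SOME x. x \<in> X \<and> k x = c) = f (SOME x. x \<in> {x \<in> X. j x = d} \<and> k x = c)"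
      if "c \<in> k ` {x \<in> X. j x = d}" for c
    proof -
      from that obtain x where "x \<in> {x \<in> X. j x = d}" "c = k x" by blast
      then show ?thesis using fib_rep[OF f, of x] fib_rep[OF sub, of x] by simp
    qed
    ultimately show "(\<Sum>c\<in>{c \<in> k ` X. T c = d}. f (SOME x. x \<in> X \<and> k x = c)) = fib_sum {x \<in> X. j x = d} k f"
      unfolding fib_sum_def by simp
  qed
  finally show ?thesis .
qed

lemma fib_sum_Un:
  assumes "finite X" "finite Y" and "\<And>x y. x \<in> X \<Longrightarrow> y \<in> Y \<Longrightarrow> k x \<noteq> k y"
    and f: "fib_const (X \<union> Y) k f"
  shows "fib_sum (X \<union> Y) k f = fib_sum X k f + fib_sum Y k f"
proof -
  have fX: "fib_const X k f" and fY: "fib_const Y k f" using f unfolding fib_const_def by blast+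
  have "f (SOME x. x \<in> X \<union> Y \<and> k x = k z) = f (SOME x. x \<in> X \<and> k x = k z)" if "z \<in> X" for z
    using fib_rep[OF f, of z] fib_rep[OF fX, of z] that by simp
  moreover have "f (SOME x. x \<in> X \<union> Y \<and> k x = k z) = f (SOME x. x \<in> Y \<and> k x = k z)" if "z \<in> Y" for z
    using fib_rep[OF f, of z] fib_rep[OF fY, of z] that by simp
  moreover have "k ` X \<inter> k ` Y = {}" using assms(3) by blast
  ultimately show ?thesis
    unfolding fib_sum_def image_Un using assms(1,2)
    by (subst sum.union_disjoint) (auto intro!: arg_cong2[of _ _ _ _ "(+)"] sum.cong)
qed

text \<open>An executable form: the head represents its fibre, and the rest of the fibre, recognized
  by \<open>r\<close>, is discarded.\<close>

fun fib_sum_list :: "('x \<Rightarrow> 'x \<Rightarrow> bool) \<Rightarrow> ('x \<Rightarrow> 't::comm_monoid_add) \<Rightarrow> 'x list \<Rightarrow> 't" where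
  "fib_sum_list r f [] = 0"
| "fib_sum_list r f (x # xs) = f x + fib_sum_list r f (filter (\<lambda>y. \<not> r x y) xs)"

lemma fib_sum_list:
  assumes "\<And>x y. x \<in> set xs \<Longrightarrow> y \<in> set xs \<Longrightarrow> r x y \<longleftrightarrow> k x = k y" and "fib_const (set xs) k f"
  shows "fib_sum (set xs) k f = fib_sum_list r f xs"
  using assms
proof (induction xs rule: length_induct)
  case (1 xs)
  show ?case
  proof (cases xs)
    case Nil
    then show ?thesis by (simp add: fib_sum_def)
  next
    case (Cons x ys)
    let ?A = "{y \<in> set xs. k y = k x}" and ?B = "set (filter (\<lambda>y. \<not> r x y) ys)"
    have AB: "set xs = ?A \<union> ?B" using "1.prems"(1) by (auto simp: Cons)
    have "fib_sum (?A \<union> ?B) k f = fib_sum ?A k f + fib_sum ?B k f"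
    proof (rule fib_sum_Un)
      show "fib_const (?A \<union> ?B) k f"
        using "1.prems"(2) by (simp only: AB[symmetric])
    qed (use "1.prems"(1) in \<open>auto simp: Cons\<close>)
    then have "fib_sum (set xs) k f = fib_sum ?A k f + fib_sum ?B k f"
      by (simp only: AB[symmetric])
    moreover have "fib_sum ?B k f = fib_sum_list r f (filter (\<lambda>y. \<not> r x y) ys)"
    proof (rule "1.IH"[rule_format])
      show "length (filter (\<lambda>y. \<not> r x y) ys) < length xs"
        by (simp add: Cons less_Suc_eq_le)
      show "fib_const (set (filter (\<lambda>y. \<not> r x y) ys)) k f"
        using "1.prems"(2) by (auto simp: fib_const_def Cons)
    qed (use "1.prems"(1) in \<open>auto simp: Cons\<close>)
    moreover have "fib_sum ?A k f = f x"
    proof -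
      have const: "fib_const ?A k f"
        using "1.prems"(2) unfolding fib_const_def by blast
      have x: "x \<in> ?A" by (simp add: Cons)
      then have "k ` ?A = {k x}" by auto
      then have "fib_sum ?A k f = f (SOME y. y \<in> ?A \<and> k y = k x)"
        unfolding fib_sum_def by (simp del: mem_Collect_eq)
      also have "\<dots> = f x" by (rule fib_rep[OF const x])
      finally show ?thesis .
    qed
    ultimately show ?thesis by (simp add: Cons)
  qed
qed


section \<open>Finite group actions\<close>

text \<open>The group is written additively, without commutativity, because \<open>group_add\<close>
  provides inverses and extends to pairs by componentwise operations.\<close>

locale finite_action =
  fixes X :: "'x set" and act :: "'p::group_add \<Rightarrow> 'x \<Rightarrow> 'x"
  assumes finite_X: "finite X" and act_closed: "x \<in> X \<Longrightarrow> act p x \<in> X"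
    and act_zero: "x \<in> X \<Longrightarrow> act 0 x = x"
    and act_add: "x \<in> X \<Longrightarrow> act (p + q) x = act p (act q x)"

definition orb :: "('p \<Rightarrow> 'x \<Rightarrow> 'x) \<Rightarrow> 'x \<Rightarrow> 'x set" where
  "orb act x = range (\<lambda>p. act p x)"

definition stab :: "('p \<Rightarrow> 'x \<Rightarrow> 'x) \<Rightarrow> 'x \<Rightarrow> 'p set" where
  "stab act x = {p. act p x = x}"

definition conj_by :: "'p::group_add \<Rightarrow> 'p set \<Rightarrow> 'p set" where
  "conj_by p U = (\<lambda>u. p + u - p) ` U"

definition is_subgroup :: "'p::group_add set \<Rightarrow> bool" where
  "is_subgroup U \<longleftrightarrow> 0 \<in> U \<and> (\<forall>u\<in>U. \<forall>v\<in>U. u + v \<in> U) \<and> (\<forall>u\<in>U. - u \<in> U)"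

context finite_action
begin

lemma act_uminus:
  assumes "x \<in> X"
  shows "act (- p) (act p x) = x" "act p (act (- p) x) = x"
  by (simp_all flip: act_add add: assms act_zero)

lemma act_eq_iff: "x \<in> X \<Longrightarrow> y \<in> X \<Longrightarrow> act p x = y \<longleftrightarrow> x = act (- p) y"
  using act_uminus by metis

lemma orb_self: "x \<in> X \<Longrightarrow> x \<in> orb act x"
  unfolding orb_def using act_zero by (metis rangeI)

lemma orb_act: "x \<in> X \<Longrightarrow> orb act (act p x) = orb act x"
proof
  assume x: "x \<in> X"
  show "orb act (act p x) \<subseteq> orb act x" by (auto simp: orb_def act_add[symmetric] x)
  have "act q x = act (q - p) (act p x)" for q using x by (simp flip: act_add)
  then show "orb act x \<subseteq> orb act (act p x)" unfolding orb_def by blast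
qed

lemma orb_eq_iff: "x \<in> X \<Longrightarrow> y \<in> X \<Longrightarrow> orb act x = orb act y \<longleftrightarrow> (\<exists>p. y = act p x)"
  using orb_act orb_self unfolding orb_def by (metis imageE)

lemma stab_act: "x \<in> X \<Longrightarrow> stab act (act p x) = conj_by p (stab act x)"
proof -
  assume x: "x \<in> X"
  have "act q (act p x) = act p x \<longleftrightarrow> act (- p + q + p) x = x" for q
    using x act_closed act_eq_iff by (simp add: act_add)
  then have "stab act (act p x) = {q. - p + q + p \<in> stab act x}" by (simp add: stab_def)
  also have "\<dots> = conj_by p (stab act x)"
  proof (intro Set.set_eqI iffI)
    fix q assume "q \<in> {q. - p + q + p \<in> stab act x}"
    moreover have "q = p + (- p + q + p) - p" by (simp add: add.assoc)
    ultimately show "q \<in> conj_by p (stab act x)" unfolding conj_by_def by blast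
  next
    fix q assume "q \<in> conj_by p (stab act x)"
    then show "q \<in> {q. - p + q + p \<in> stab act x}" by (auto simp: conj_by_def add.assoc)
  qed
  finally show ?thesis .
qed

lemma is_subgroup_stab: "x \<in> X \<Longrightarrow> is_subgroup (stab act x)"
  unfolding is_subgroup_def stab_def using act_zero act_add act_uminus(1) by auto metis

lemma fib_const_stab:
  assumes "\<And>p U. val (conj_by p U) = val U"
  shows "fib_const X (orb act) (\<lambda>x. val (stab act x))"
  unfolding fib_const_def using orb_eq_iff stab_act assms by metis

lemma finite_action_subset:
  assumes "Y \<subseteq> X" "\<And>y p. y \<in> Y \<Longrightarrow> act p y \<in> Y"
  shows "finite_action Y act"
  using assms finite_X finite_subset act_zero act_add by unfold_locales auto

lemma orb_subset: "x \<in> X \<Longrightarrow> orb act x \<subseteq> X"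
  unfolding orb_def using act_closed by blast

text \<open>Sending \<open>p x\<close> to \<open>p y\<close> is well defined and injective because
  the stabilizers agree.\<close>

lemma transitive_equivariant:
  assumes Y: "finite_action Y act'" and x: "x \<in> X" and y: "y \<in> Y"
    and stab: "stab act x = stab act' y"
  obtains f where "bij_betw f (orb act x) (orb act' y)"
    "\<And>p z. z \<in> orb act x \<Longrightarrow> f (act p z) = act' p (f z)"
proof -
  interpret Y: finite_action Y act' by fact
  have eq: "act p x = act q x \<longleftrightarrow> act' p y = act' q y" for p q
  proof -
    have "act p x = act q x \<longleftrightarrow> - q + p \<in> stab act x"
      using x act_closed act_eq_iff[of "act p x" x] unfolding stab_def mem_Collect_eq
      by (metis act_add act_eq_iff minus_minus)
    also have "\<dots> \<longleftrightarrow> act' p y = act' q y"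
      using y Y.act_closed unfolding stab unfolding stab_def mem_Collect_eq
      by (metis Y.act_add Y.act_eq_iff minus_minus)
    finally show ?thesis .
  qed
  define f where "f z = act' (SOME p. act p x = z) y" for z
  have f: "f (act p x) = act' p y" for p
    unfolding f_def using eq someI[of "\<lambda>q. act q x = act p x" p] by blast
  show thesis
  proof (rule that[of f])
    show "bij_betw f (orb act x) (orb act' y)"
      unfolding orb_def
      by (rule bij_betw_imageI) (auto simp: inj_on_def f eq image_image)
    show "f (act p z) = act' p (f z)" if "z \<in> orb act x" for p z
      using that f act_add[OF x] Y.act_add[OF y] unfolding orb_def by (metis imageE)
  qed
qed

end

text \<open>The additive extension of \<open>val\<close> from transitive sets to all finite ones,
  independent of the chosen points when \<open>val\<close> is invariant under conjugation.\<close>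

definition orbit_sum :: "('p set \<Rightarrow> 't::comm_monoid_add) \<Rightarrow> 'x set \<Rightarrow> ('p \<Rightarrow> 'x \<Rightarrow> 'x) \<Rightarrow> 't" where
  "orbit_sum val X act = fib_sum X (orb act) (\<lambda>x. val (stab act x))"

lemma orbit_sum_cong:
  assumes "finite_action X act" "finite_action Y act'"
    and val: "\<And>p U. val (conj_by p U) = val U"
    and f: "bij_betw f X Y" and equiv: "\<And>p x. x \<in> X \<Longrightarrow> f (act p x) = act' p (f x)"
  shows "orbit_sum val X act = orbit_sum val Y act'"
proof -
  interpret X: finite_action X act by fact
  interpret Y: finite_action Y act' by fact
  have mem: "f x \<in> Y" if "x \<in> X" for x using f that by (rule bij_betwE[rule_format])
  have inj: "f x = f y \<longleftrightarrow> x = y" if "x \<in> X" "y \<in> X" for x y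
    using f that by (auto simp: bij_betw_def inj_on_def)
  show ?thesis unfolding orbit_sum_def
  proof (rule fib_sum_transfer[of X f])
    fix x y assume xy: "x \<in> X" "y \<in> X"
    show "orb act x = orb act y \<longleftrightarrow> orb act' (f x) = orb act' (f y)"
      unfolding X.orb_eq_iff[OF xy] Y.orb_eq_iff[OF mem[OF xy(1)] mem[OF xy(2)]]
      using equiv xy inj X.act_closed by metis
    show "val (stab act x) = val (stab act' (f x))"
    proof -
      have "act p x = x \<longleftrightarrow> act' p (f x) = f x" for p
        using equiv[OF xy(1)] inj[OF X.act_closed[OF xy(1)] xy(1)] by metis
      then show ?thesis by (simp add: stab_def)
    qed
  next
    show "\<exists>x\<in>X. orb act' (f x) = orb act' y" if "y \<in> Y" for y
      using f that unfolding bij_betw_def by (metis imageE)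
    show "fib_const Y (orb act') (\<lambda>y. val (stab act' y))" by (rule Y.fib_const_stab[OF val])
  qed (rule mem)
qed

lemma orbit_sum_Un:
  assumes "finite_action (X \<union> Y) act" "X \<inter> Y = {}"
    and "\<And>x p. x \<in> X \<Longrightarrow> act p x \<in> X"
    and val: "\<And>p U. val (conj_by p U) = val U"
  shows "orbit_sum val (X \<union> Y) act = orbit_sum val X act + orbit_sum val Y act"
proof -
  interpret finite_action "X \<union> Y" act by fact
  have "orb act x \<noteq> orb act y" if "x \<in> X" "y \<in> Y" for x y
    using orb_eq_iff[of x y] that assms(2,3) by blast
  then show ?thesis
    unfolding orbit_sum_def using finite_X by (intro fib_sum_Un fib_const_stab[OF val]) auto
qed

lemma orbit_sum_transitive:
  assumes "finite_action X act" "x \<in> X" "orb act x = X" and val: "\<And>p U. val (conj_by p U) = val U"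
  shows "orbit_sum val X act = val (stab act x)"
proof -
  interpret finite_action X act by fact
  have "orb act ` X = {orb act x}"
    using orb_act[OF assms(2)] assms(2,3) unfolding orb_def by blast
  then show ?thesis
    unfolding orbit_sum_def fib_sum_def
    using fib_rep[OF fib_const_stab[OF val] assms(2)] by simp
qed

section \<open>Bisets as group actions\<close>

text \<open>The group \<open>G\<close> is coded by an additively written type; a biset becomes a set with a left action of
  pairs, \<open>(x, y)\<close> acting as $m \mapsto x m y^{-1}$.\<close>

locale coded_group = group G for G (structure) +
  fixes code :: "'s::{group_add, finite} \<Rightarrow> 'g"
  assumes code_bij: "bij_betw code UNIV (carrier G)"
    and code_add: "code (x + y) = code x \<otimes> code y"
begin

lemma code_closed [simp]: "code x \<in> carrier G"
  using code_bij by (auto simp: bij_betw_def)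

lemma code_zero: "code 0 = \<one>"
  by (metis add.right_neutral code_add code_closed r_cancel_one)

lemma code_uminus: "code (- x) = inv (code x)"
  by (metis ab_left_minus add.left_inverse code_add code_closed code_zero inv_equality)

lemma code_surj: "g \<in> carrier G \<Longrightarrow> \<exists>x. g = code x"
  using code_bij by (auto simp: bij_betw_def)

lemma code_ball: "(\<forall>g\<in>carrier G. P g) \<longleftrightarrow> (\<forall>x. P (code x))"
  using code_surj by fastforce

definition act :: "('g, 'x) biset \<Rightarrow> 's \<times> 's \<Rightarrow> 'x \<Rightarrow> 'x" where
  "act M p m = lact M (code (fst p)) (ract M m (code (- snd p)))"

lemma finite_bisetD:
  assumes "finite_biset G M"
  shows "finite (points M)"
    "m \<in> points M \<Longrightarrow> lact M (code x) m \<in> points M" "m \<in> points M \<Longrightarrow> ract M m (code x) \<in> points M"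
    "m \<in> points M \<Longrightarrow> lact M (code 0) m = m" "m \<in> points M \<Longrightarrow> ract M m (code 0) = m"
    "m \<in> points M \<Longrightarrow> lact M (code (x + y)) m = lact M (code x) (lact M (code y) m)"
    "m \<in> points M \<Longrightarrow> ract M m (code (x + y)) = ract M (ract M m (code x)) (code y)"
    "m \<in> points M \<Longrightarrow> ract M (lact M (code x) m) (code y) = lact M (code x) (ract M m (code y))"
  using assms unfolding finite_biset_def code_zero code_add by simp_all

lemma finite_action_act:
  assumes "finite_biset G M"
  shows "finite_action (points M) (act M)"
proof
  note M = finite_bisetD[OF assms]
  fix m and p q :: "'s \<times> 's" assume m: "m \<in> points M"
  have "ract M m (code (- snd (p + q))) = ract M (ract M m (code (- snd q))) (code (- snd p))"
    using M(7)[OF m, of "- snd q" "- snd p"] by (simp add: minus_add)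
  then show "act M (p + q) m = act M p (act M q m)"
    using M m by (simp add: act_def)
qed (simp_all add: finite_bisetD[OF assms] act_def)

lemma lact_eq_act: "finite_biset G M \<Longrightarrow> m \<in> points M \<Longrightarrow> lact M (code x) m = act M (x, 0) m"
  and ract_eq_act: "finite_biset G M \<Longrightarrow> m \<in> points M \<Longrightarrow> ract M m (code x) = act M (0, - x) m"
  by (simp_all add: act_def finite_bisetD)

text \<open>The left and right actions are recovered from the pairs \<open>(x, 0)\<close> and
  \<open>(0, - x)\<close>.\<close>

lemma biset_isomorphic_iff:
  assumes M: "finite_biset G M" and N: "finite_biset G N"
  shows "biset_isomorphic G M N \<longleftrightarrow>
    (\<exists>f. bij_betw f (points M) (points N) \<and> (\<forall>p. \<forall>m\<in>points M. f (act M p m) = act N p (f m)))"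
  unfolding biset_isomorphic_def
proof (intro ex_cong1 conj_cong refl iffI)
  fix f assume f: "bij_betw f (points M) (points N)"
  have mem: "m \<in> points M \<Longrightarrow> f m \<in> points N" for m using f bij_betwE by blast
  {
    assume *: "\<forall>g\<in>carrier G. \<forall>m\<in>points M. f (lact M g m) = lact N g (f m) \<and> f (ract M m g) = ract N (f m) g"
    show "\<forall>p. \<forall>m\<in>points M. f (act M p m) = act N p (f m)"
      using * finite_bisetD(3)[OF M] by (simp add: act_def)
  next
    assume *: "\<forall>p. \<forall>m\<in>points M. f (act M p m) = act N p (f m)"
    show "\<forall>g\<in>carrier G. \<forall>m\<in>points M. f (lact M g m) = lact N g (f m) \<and> f (ract M m g) = ract N (f m) g"
      unfolding code_ball using * mem by (simp add: lact_eq_act ract_eq_act M N)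
  }
qed

lemma biset_isomorphicI:
  assumes "finite_biset G M" "finite_biset G N" "bij_betw f (points M) (points N)"
    "\<And>p m. m \<in> points M \<Longrightarrow> f (act M p m) = act N p (f m)"
  shows "biset_isomorphic G M N"
  unfolding biset_isomorphic_iff[OF assms(1,2)] using assms(3,4) by blast

lemma biset_isomorphicE:
  assumes "biset_isomorphic G M N" "finite_biset G M" "finite_biset G N"
  obtains f where "bij_betw f (points M) (points N)"
    "\<And>p m. m \<in> points M \<Longrightarrow> f (act M p m) = act N p (f m)"
  using assms biset_isomorphic_iff by blast

lemma biset_isomorphic_sym:
  assumes "biset_isomorphic G M N" "finite_biset G M" "finite_biset G N"
  shows "biset_isomorphic G N M"
proof -
  interpret M: finite_action "points M" "act M" by (rule finite_action_act) fact
  obtain f where f: "bij_betw f (points M) (points N)"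
    "\<And>p m. m \<in> points M \<Longrightarrow> f (act M p m) = act N p (f m)"
    using biset_isomorphicE assms by blast
  show ?thesis
  proof (rule biset_isomorphicI[OF assms(3,2) bij_betw_inv_into[OF f(1)]])
    fix p n assume n: "n \<in> points N"
    let ?m = "inv_into (points M) f n"
    have m: "?m \<in> points M" "f ?m = n"
      using f(1) n by (auto simp: bij_betw_def inv_into_into f_inv_into_f)
    then have "act N p n = f (act M p ?m)" by (simp add: f(2))
    then show "inv_into (points M) f (act N p n) = act M p ?m"
      using bij_betw_inv_into_left[OF f(1)] m M.act_closed by simp
  qed
qed

lemma biset_isomorphic_trans:
  assumes "biset_isomorphic G L M" "biset_isomorphic G M N"
    "finite_biset G L" "finite_biset G M" "finite_biset G N"
  shows "biset_isomorphic G L N"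
proof -
  obtain f where f: "bij_betw f (points L) (points M)" "\<And>p m. m \<in> points L \<Longrightarrow> f (act L p m) = act M p (f m)"
    using biset_isomorphicE assms by blast
  obtain h where h: "bij_betw h (points M) (points N)" "\<And>p m. m \<in> points M \<Longrightarrow> h (act M p m) = act N p (h m)"
    using biset_isomorphicE assms by blast
  show ?thesis
    by (rule biset_isomorphicI[OF assms(3,5) bij_betw_trans[OF f(1) h(1)]])
      (use f h bij_betwE[OF f(1)] in auto)
qed

lemma biset_class_eqI:
  assumes "biset_isomorphic G M N" "finite_biset G M" "finite_biset G N"
  shows "biset_class G M = biset_class G N"
  unfolding biset_class_def
  using biset_isomorphic_trans[OF biset_isomorphic_sym[OF assms] _ assms(3,2)]
    biset_isomorphic_trans[OF assms(1) _ assms(2,3)]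
  by auto

text \<open>Classes consist of bisets on natural numbers, so this shows that the class of a finite
  biset on any type, for instance of a tensor product, is inhabited.\<close>

lemma nat_copy:
  fixes M :: "('g, 'x) biset"
  assumes "finite_biset G M"
  obtains N :: "('g, nat) biset" where "finite_biset G N" "biset_isomorphic G M N"
proof -
  note M = finite_bisetD[OF assms]
  obtain f :: "'x \<Rightarrow> nat" where f: "inj_on f (points M)"
    using finite_imp_inj_to_nat_seg[OF M(1)] by blast
  define h where "h = inv_into (points M) f"
  have h: "h (f m) = m" if "m \<in> points M" for m using f that by (simp add: h_def)
  define N where "N = \<lparr>points = f ` points M, lact = (\<lambda>g n. f (lact M g (h n))), ract = (\<lambda>n g. f (ract M (h n) g))\<rparr>"
  have N: "finite_biset G N"
    using M unfolding finite_biset_def code_ball unfolding code_zero[symmetric] code_add[symmetric]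
    by (simp add: N_def h)
  moreover have "biset_isomorphic G M N"
    unfolding biset_isomorphic_def code_ball
    by (rule exI[of _ f]) (use f in \<open>auto simp: bij_betw_def N_def h\<close>)
  ultimately show thesis by (rule that)
qed

lemma biset_class_mem:
  assumes "finite_biset G M"
  shows "biset_class G M \<in> biset_classes G"
proof -
  obtain N :: "('g, nat) biset" where "finite_biset G N" "biset_isomorphic G M N" by (rule nat_copy[OF assms])
  then show ?thesis using biset_class_eqI[OF _ assms] unfolding biset_classes_def by blast
qed

lemma finite_biset_sum:
  assumes "finite_biset G M" "finite_biset G N"
  shows "finite_biset G (biset_sum M N)"
  using finite_bisetD[OF assms(1)] finite_bisetD[OF assms(2)]
  unfolding finite_biset_def code_ball unfolding code_zero[symmetric] code_add[symmetric]
  by (auto simp: biset_sum_def Plus_def)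

lemma act_sum: "act (biset_sum M N) p (Inl m) = Inl (act M p m)" "act (biset_sum M N) p (Inr n) = Inr (act N p n)"
  by (simp_all add: act_def biset_sum_def)

lemma finite_biset_subset:
  assumes "finite_biset G M" "Y \<subseteq> points M" "\<And>p y. y \<in> Y \<Longrightarrow> act M p y \<in> Y"
  shows "finite_biset G (M\<lparr>points := Y\<rparr>)"
proof -
  have "lact M (code x) y \<in> Y" "ract M y (code x) \<in> Y" if "y \<in> Y" for x y
    using that assms lact_eq_act[OF assms(1)] ract_eq_act[OF assms(1)] by auto
  then show ?thesis
    using finite_bisetD[OF assms(1)] assms(2) finite_subset[OF assms(2)]
    unfolding finite_biset_def code_ball unfolding code_zero[symmetric] code_add[symmetric]
    by (simp add: subset_iff)
qed

lemma act_subset: "act (M\<lparr>points := Y\<rparr>) = act M"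
  by (simp add: act_def fun_eq_iff)


subsection \<open>Tensor products\<close>

text \<open>The class of \<open>(m, n)\<close> in the tensor product: \<open>k\<close> sends this
  pair to \<open>(m k^-1, k n)\<close>.\<close>

definition tensor_pt :: "('g, 'x) biset \<Rightarrow> ('g, 'y) biset \<Rightarrow> 'x \<times> 'y \<Rightarrow> ('x \<times> 'y) set" where
  "tensor_pt M N = (\<lambda>(m, n). range (\<lambda>k. (act M (0, k) m, act N (k, 0) n)))"

context
  fixes M :: "('g, 'x) biset" and N :: "('g, 'y) biset"
  assumes M: "finite_biset G M" and N: "finite_biset G N"
begin

interpretation M: finite_action "points M" "act M" by (rule finite_action_act[OF M])
interpretation N: finite_action "points N" "act N" by (rule finite_action_act[OF N])

lemma act_pair:
  "m \<in> points M \<Longrightarrow> act M (a + b, c + d) m = act M (a, c) (act M (b, d) m)"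
  "n \<in> points N \<Longrightarrow> act N (a + b, c + d) n = act N (a, c) (act N (b, d) n)"
  using M.act_add[of m "(a, c)" "(b, d)"] N.act_add[of n "(a, c)" "(b, d)"] by simp_all

lemma act_pair_zero: "m \<in> points M \<Longrightarrow> act M (0, 0) m = m" "n \<in> points N \<Longrightarrow> act N (0, 0) n = n"
  using M.act_zero N.act_zero by (simp_all flip: zero_prod_def)

lemma tensor_pt_eq_iff:
  assumes "m \<in> points M" "n \<in> points N" "m' \<in> points M" "n' \<in> points N"
  shows "tensor_pt M N (m, n) = tensor_pt M N (m', n') \<longleftrightarrow>
    (\<exists>k. m' = act M (0, k) m \<and> n' = act N (k, 0) n)"
proof
  assume "tensor_pt M N (m, n) = tensor_pt M N (m', n')"
  moreover have "(m', n') \<in> tensor_pt M N (m', n')"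
    using act_pair_zero assms unfolding tensor_pt_def by (auto intro!: range_eqI[of _ _ 0])
  ultimately have "(m', n') \<in> tensor_pt M N (m, n)" by simp
  then show "\<exists>k. m' = act M (0, k) m \<and> n' = act N (k, 0) n"
    unfolding tensor_pt_def by auto
next
  assume "\<exists>k. m' = act M (0, k) m \<and> n' = act N (k, 0) n"
  then obtain k where k: "m' = act M (0, k) m" "n' = act N (k, 0) n" by blast
  have 1: "act M (0, l) m' = act M (0, l + k) m" "act N (l, 0) n' = act N (l + k, 0) n" for l
    using assms act_pair(1)[of m 0 0 l k] act_pair(2)[of n l k 0 0] k by simp_all
  have 2: "act M (0, l) m = act M (0, l - k) m'" "act N (l, 0) n = act N (l - k, 0) n'" for l
    by (simp_all add: 1)
  show "tensor_pt M N (m, n) = tensor_pt M N (m', n')"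
  proof
    show "tensor_pt M N (m, n) \<subseteq> tensor_pt M N (m', n')"
      unfolding tensor_pt_def using 2 by blast
    show "tensor_pt M N (m', n') \<subseteq> tensor_pt M N (m, n)"
      unfolding tensor_pt_def using 1 by blast
  qed
qed

lemma points_tensor: "points (biset_tensor G M N) = tensor_pt M N ` (points M \<times> points N)"
proof -
  have "orbit G (\<lambda>g (m, n). (ract M m (inv g), lact N g n)) (m, n) = tensor_pt M N (m, n)"
    if "m \<in> points M" "n \<in> points N" for m n
  proof -
    have "orbit G (\<lambda>g (m, n). (ract M m (inv g), lact N g n)) (m, n) =
        range (\<lambda>k. (ract M m (inv (code k)), lact N (code k) n))"
      unfolding orbit_def using code_surj by auto
    also have "\<dots> = tensor_pt M N (m, n)"
      using that by (simp add: tensor_pt_def lact_eq_act[OF N] ract_eq_act[OF M] flip: code_uminus)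
    finally show ?thesis .
  qed
  note eq = this
  have "points (biset_tensor G M N) =
      orbit G (\<lambda>g (m, n). (ract M m (inv g), lact N g n)) ` (points M \<times> points N)"
    unfolding biset_tensor_def orbits_def by auto
  also have "\<dots> = tensor_pt M N ` (points M \<times> points N)"
    by (rule image_cong[OF refl]) (elim SigmaE, simp only: eq)
  finally show ?thesis .
qed

lemma tensor_lact_ract:
  assumes "m \<in> points M" "n \<in> points N"
  shows "lact (biset_tensor G M N) (code x) (tensor_pt M N (m, n)) = tensor_pt M N (act M (x, 0) m, n)"
    and "ract (biset_tensor G M N) (tensor_pt M N (m, n)) (code x) = tensor_pt M N (m, act N (0, - x) n)"
proof -
  have "lact M (code x) (act M (0, k) m) = act M (0, k) (act M (x, 0) m)" for k
    using act_pair(1)[OF assms(1), of x 0 0 k] act_pair(1)[OF assms(1), of 0 x k 0] M.act_closed assms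
    by (simp add: lact_eq_act[OF M])
  then show "lact (biset_tensor G M N) (code x) (tensor_pt M N (m, n)) = tensor_pt M N (act M (x, 0) m, n)"
    by (simp add: biset_tensor_def tensor_pt_def image_image)
  have "ract N (act N (k, 0) n) (code x) = act N (k, 0) (act N (0, - x) n)" for k
    using act_pair(2)[OF assms(2), of 0 k "- x" 0] act_pair(2)[OF assms(2), of k 0 0 "- x"] N.act_closed assms
    by (simp add: ract_eq_act[OF N])
  then show "ract (biset_tensor G M N) (tensor_pt M N (m, n)) (code x) = tensor_pt M N (m, act N (0, - x) n)"
    by (simp add: biset_tensor_def tensor_pt_def image_image)
qed

lemma finite_biset_tensor: "finite_biset G (biset_tensor G M N)"
  unfolding finite_biset_def code_ball points_tensor
  unfolding code_zero[symmetric] code_add[symmetric]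
proof (intro conjI allI ballI; (elim imageE SigmaE)?; hypsubst?)
  show "finite (tensor_pt M N ` (points M \<times> points N))"
    using M.finite_X N.finite_X by blast
next
  fix m n x y assume mn: "m \<in> points M" "n \<in> points N"
  note simps = tensor_lact_ract M.act_closed N.act_closed mn act_pair_zero
  show "lact (biset_tensor G M N) (code x) (tensor_pt M N (m, n)) \<in> tensor_pt M N ` (points M \<times> points N)"
    "ract (biset_tensor G M N) (tensor_pt M N (m, n)) (code x) \<in> tensor_pt M N ` (points M \<times> points N)"
    "lact (biset_tensor G M N) (code 0) (tensor_pt M N (m, n)) = tensor_pt M N (m, n)"
    "ract (biset_tensor G M N) (tensor_pt M N (m, n)) (code 0) = tensor_pt M N (m, n)"
    by (simp_all add: simps)
  show "lact (biset_tensor G M N) (code (x + y)) (tensor_pt M N (m, n)) =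
    lact (biset_tensor G M N) (code x) (lact (biset_tensor G M N) (code y) (tensor_pt M N (m, n)))"
    using act_pair(1)[OF mn(1), of x y 0 0] by (simp add: simps)
  show "ract (biset_tensor G M N) (tensor_pt M N (m, n)) (code (x + y)) =
    ract (biset_tensor G M N) (ract (biset_tensor G M N) (tensor_pt M N (m, n)) (code x)) (code y)"
    using act_pair(2)[OF mn(2), of 0 0 "- y" "- x"] by (simp add: simps minus_add)
  show "ract (biset_tensor G M N) (lact (biset_tensor G M N) (code x) (tensor_pt M N (m, n))) (code y) =
    lact (biset_tensor G M N) (code x) (ract (biset_tensor G M N) (tensor_pt M N (m, n)) (code y))"
    by (simp add: simps)
qed

lemma act_tensor:
  assumes "m \<in> points M" "n \<in> points N"
  shows "act (biset_tensor G M N) (a, b) (tensor_pt M N (m, n)) = tensor_pt M N (act M (a, 0) m, act N (0, b) n)"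
  using assms by (simp add: act_def[of "biset_tensor G M N"] tensor_lact_ract N.act_closed)

text \<open>Orbits of triples, where \<open>(a, k, b)\<close> sends \<open>(m, n)\<close> to
  \<open>(a m k^-1, k n b^-1)\<close>. They correspond to the orbits on the tensor product and avoid
  computing with classes.\<close>

definition tri_orb :: "'x \<times> 'y \<Rightarrow> ('x \<times> 'y) set" where
  "tri_orb = (\<lambda>(m, n). {(act M (a, k) m, act N (k, b) n) |a k b. True})"

lemma orb_tensor_eq_iff:
  assumes mn: "m \<in> points M" "n \<in> points N" "m' \<in> points M" "n' \<in> points N"
  shows "orb (act (biset_tensor G M N)) (tensor_pt M N (m, n)) = orb (act (biset_tensor G M N)) (tensor_pt M N (m', n'))
    \<longleftrightarrow> (\<exists>a k b. m' = act M (a, k) m \<and> n' = act N (k, b) n)"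
proof -
  interpret T: finite_action "points (biset_tensor G M N)" "act (biset_tensor G M N)"
    by (rule finite_action_act[OF finite_biset_tensor])
  have "tensor_pt M N (m, n) \<in> points (biset_tensor G M N)" "tensor_pt M N (m', n') \<in> points (biset_tensor G M N)"
    using mn by (auto simp: points_tensor)
  then have "orb (act (biset_tensor G M N)) (tensor_pt M N (m, n)) = orb (act (biset_tensor G M N)) (tensor_pt M N (m', n'))
    \<longleftrightarrow> (\<exists>a b. tensor_pt M N (act M (a, 0) m, act N (0, b) n) = tensor_pt M N (m', n'))"
    by (subst T.orb_eq_iff) (auto simp: act_tensor mn)
  also have "\<dots> \<longleftrightarrow> (\<exists>a b k. m' = act M (0, k) (act M (a, 0) m) \<and> n' = act N (k, 0) (act N (0, b) n))"
    by (simp add: tensor_pt_eq_iff mn M.act_closed N.act_closed)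
  also have "\<dots> \<longleftrightarrow> (\<exists>a k b. m' = act M (a, k) m \<and> n' = act N (k, b) n)"
  proof -
    have "act M (0, k) (act M (a, 0) m) = act M (a, k) m" "act N (k, 0) (act N (0, b) n) = act N (k, b) n" for a b k
      using act_pair(1)[OF mn(1), of 0 a k 0] act_pair(2)[OF mn(2), of k 0 0 b] by simp_all
    then show ?thesis by (simp only:) blast
  qed
  finally show ?thesis .
qed

lemma tri_orb_eq_iff:
  assumes mn: "m \<in> points M" "n \<in> points N" "m' \<in> points M" "n' \<in> points N"
  shows "tri_orb (m, n) = tri_orb (m', n') \<longleftrightarrow> (\<exists>a k b. m' = act M (a, k) m \<and> n' = act N (k, b) n)"
proof
  assume "tri_orb (m, n) = tri_orb (m', n')"
  moreover have "(m', n') \<in> tri_orb (m', n')"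
    using act_pair_zero(1)[of m'] act_pair_zero(2)[of n'] mn unfolding tri_orb_def by (auto intro!: exI[of _ 0])
  ultimately have "(m', n') \<in> tri_orb (m, n)" by simp
  then show "\<exists>a k b. m' = act M (a, k) m \<and> n' = act N (k, b) n"
    unfolding tri_orb_def by auto
next
  assume "\<exists>a k b. m' = act M (a, k) m \<and> n' = act N (k, b) n"
  then obtain a k b where *: "m' = act M (a, k) m" "n' = act N (k, b) n" by blast
  have 1: "act M (a', k') m' = act M (a' + a, k' + k) m" "act N (k', b') n' = act N (k' + k, b' + b) n" for a' k' b'
    using act_pair mn * by simp_all
  have 2: "act M (a', k') m = act M (a' - a, k' - k) m'" "act N (k', b') n = act N (k' - k, b' - b) n'" for a' k' b'
    by (simp_all add: 1)
  show "tri_orb (m, n) = tri_orb (m', n')"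
  proof
    show "tri_orb (m, n) \<subseteq> tri_orb (m', n')"
      unfolding tri_orb_def using 2 by blast
    show "tri_orb (m', n') \<subseteq> tri_orb (m, n)"
      unfolding tri_orb_def using 1 by blast
  qed
qed

text \<open>A pair \<open>(a, b)\<close> fixes the class of \<open>(m, n)\<close> iff some
  \<open>k\<close> carries \<open>(a m, n b^-1)\<close> back to \<open>(m, n)\<close>; this
  \<open>k\<close> is the middle element of the relational composite.\<close>

lemma stab_tensor:
  assumes mn: "m \<in> points M" "n \<in> points N"
  shows "stab (act (biset_tensor G M N)) (tensor_pt M N (m, n)) = stab (act M) m O stab (act N) n"
proof -
  have "act (biset_tensor G M N) (a, b) (tensor_pt M N (m, n)) = tensor_pt M N (m, n) \<longleftrightarrow>
    (\<exists>k. (a, k) \<in> stab (act M) m \<and> (k, b) \<in> stab (act N) n)" for a b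
  proof -
    have "act (biset_tensor G M N) (a, b) (tensor_pt M N (m, n)) = tensor_pt M N (m, n) \<longleftrightarrow>
      (\<exists>k. m = act M (0, k) (act M (a, 0) m) \<and> n = act N (k, 0) (act N (0, b) n))"
      by (simp add: act_tensor mn tensor_pt_eq_iff M.act_closed N.act_closed)
    also have "\<dots> \<longleftrightarrow> (\<exists>k. m = act M (a, k) m \<and> n = act N (k, b) n)"
    proof -
      have "act M (0, k) (act M (a, 0) m) = act M (a, k) m" "act N (k, 0) (act N (0, b) n) = act N (k, b) n" for k
        using act_pair(1)[OF mn(1), of 0 a k 0] act_pair(2)[OF mn(2), of k 0 0 b] by simp_all
      then show ?thesis by (simp only:)
    qed
    finally show ?thesis unfolding stab_def mem_Collect_eq by (simp only: eq_commute[of m] eq_commute[of n])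
  qed
  then show ?thesis by (auto simp: stab_def[of "act (biset_tensor G M N)"])
qed

end

lemma biset_tensor_cong:
  assumes iso: "biset_isomorphic G M M'" "biset_isomorphic G N N'"
    and fin: "finite_biset G M" "finite_biset G M'" "finite_biset G N" "finite_biset G N'"
  shows "biset_isomorphic G (biset_tensor G M N) (biset_tensor G M' N')"
proof -
  interpret M: finite_action "points M" "act M" by (rule finite_action_act[OF fin(1)])
  interpret N: finite_action "points N" "act N" by (rule finite_action_act[OF fin(3)])
  obtain f where f: "bij_betw f (points M) (points M')" "\<And>p m. m \<in> points M \<Longrightarrow> f (act M p m) = act M' p (f m)"
    using biset_isomorphicE[OF iso(1) fin(1,2)] by blast
  obtain h where h: "bij_betw h (points N) (points N')" "\<And>p m. m \<in> points N \<Longrightarrow> h (act N p m) = act N' p (h m)"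
    using biset_isomorphicE[OF iso(2) fin(3,4)] by blast
  have mem: "f m \<in> points M'" "h n \<in> points N'" if "m \<in> points M" "n \<in> points N" for m n
    using f(1) h(1) that bij_betwE by blast+
  have img: "map_prod f h ` tensor_pt M N (m, n) = tensor_pt M' N' (f m, h n)"
    if "m \<in> points M" "n \<in> points N" for m n
    using that by (simp add: tensor_pt_def image_image f h)
  show ?thesis
  proof (rule biset_isomorphicI[OF finite_biset_tensor[OF fin(1,3)] finite_biset_tensor[OF fin(2,4)]])
    \<comment> \<open>Points of the tensor product are sets of pairs, so the isomorphism is an image
      map, injective on all subsets.\<close>
    have "inj_on (map_prod f h) (points M \<times> points N)"
      using f(1) h(1) by (intro map_prod_inj_on) (auto simp: bij_betw_def)
    then have "inj_on (image (map_prod f h)) (Pow (points M \<times> points N))"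
      by (rule inj_on_image_Pow)
    moreover have "points (biset_tensor G M N) \<subseteq> Pow (points M \<times> points N)"
      unfolding points_tensor[OF fin(1,3)] using M.act_closed N.act_closed by (auto simp: tensor_pt_def)
    ultimately have "inj_on (image (map_prod f h)) (points (biset_tensor G M N))"
      by (rule inj_on_subset)
    moreover have "image (map_prod f h) ` points (biset_tensor G M N) = points (biset_tensor G M' N')"
    proof -
      have "image (map_prod f h) ` points (biset_tensor G M N) =
          (\<lambda>(m, n). tensor_pt M' N' (f m, h n)) ` (points M \<times> points N)"
        unfolding points_tensor[OF fin(1,3)] image_image by (rule image_cong[OF refl]) (elim SigmaE, simp only: img prod.case)
      also have "\<dots> = tensor_pt M' N' ` (map_prod f h ` (points M \<times> points N))"
        by (simp add: image_image case_prod_unfold map_prod_def)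
      also have "map_prod f h ` (points M \<times> points N) = points M' \<times> points N'"
        using f(1) h(1) by (intro map_prod_surj_on) (simp_all add: bij_betw_def)
      finally show ?thesis by (simp add: points_tensor[OF fin(2,4)])
    qed
    ultimately show "bij_betw (image (map_prod f h)) (points (biset_tensor G M N)) (points (biset_tensor G M' N'))"
      by (simp add: bij_betw_def)
  next
    fix p :: "'s \<times> 's" and t assume "t \<in> points (biset_tensor G M N)"
    then obtain m n where mn: "m \<in> points M" "n \<in> points N" "t = tensor_pt M N (m, n)"
      unfolding points_tensor[OF fin(1,3)] by blast
    obtain a b where [simp]: "p = (a, b)" by (cases p)
    show "map_prod f h ` act (biset_tensor G M N) p t = act (biset_tensor G M' N') p (map_prod f h ` t)"
      using mn mem M.act_closed N.act_closed
      by (simp add: act_tensor fin img f(2) h(2))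
  qed
qed

end

section \<open>Transitive bisets\<close>

context coded_group
begin

text \<open>The cosets \<open>p + U\<close> in the group of pairs. The right action of
  \<open>g\<close> is translation by \<open>(0, g^-1)\<close>, since second components act through
  their inverses.\<close>

definition coset_biset :: "('s \<times> 's) set \<Rightarrow> ('g, ('s \<times> 's) set) biset" where
  "coset_biset U = \<lparr>points = range (\<lambda>p. (+) p ` U),
     lact = (\<lambda>g X. (+) (inv_into UNIV code g, 0) ` X), ract = (\<lambda>X g. (+) (0, - inv_into UNIV code g) ` X)\<rparr>"

lemma inv_code [simp]: "inv_into UNIV code (code x) = x"
  using code_bij by (simp add: bij_betw_def)

lemma coset_biset_sel:
  "points (coset_biset U) = range (\<lambda>p. (+) p ` U)"
  "lact (coset_biset U) (code x) X = (+) (x, 0) ` X" "ract (coset_biset U) X (code x) = (+) (0, - x) ` X"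
  by (simp_all add: coset_biset_def)

lemma translate_translate: "(+) p ` (+) q ` X = (+) (p + q) ` X" for p :: "'s \<times> 's"
  by (simp add: image_image add.assoc)

lemma act_coset_biset: "act (coset_biset U) p X = (+) p ` X"
  by (cases p) (simp add: act_def coset_biset_sel translate_translate)

lemma finite_coset_biset: "finite_biset G (coset_biset U)"
  unfolding finite_biset_def code_ball unfolding code_zero[symmetric] code_add[symmetric] coset_biset_sel
proof (intro conjI allI ballI)
  fix x y :: 's and X :: "('s \<times> 's) set"
  show "(+) (x + y, 0) ` X = (+) (x, 0) ` (+) (y, 0) ` X" "(+) (0, - (x + y)) ` X = (+) (0, - y) ` (+) (0, - x) ` X"
    "(+) (0, - y) ` (+) (x, 0) ` X = (+) (x, 0) ` (+) (0, - y) ` X"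
    by (simp_all add: translate_translate minus_add)
qed (auto simp: translate_translate simp flip: zero_prod_def)

lemma stab_coset_biset:
  assumes "is_subgroup U"
  shows "U \<in> points (coset_biset U)" "orb (act (coset_biset U)) U = points (coset_biset U)"
    "stab (act (coset_biset U)) U = U"
proof -
  have U: "0 \<in> U" "\<And>u v. u \<in> U \<Longrightarrow> v \<in> U \<Longrightarrow> u + v \<in> U" "\<And>u. u \<in> U \<Longrightarrow> - u \<in> U"
    using assms by (auto simp: is_subgroup_def)
  show "U \<in> points (coset_biset U)"
    by (simp add: coset_biset_def) (rule range_eqI[of _ _ 0], simp)
  show "orb (act (coset_biset U)) U = points (coset_biset U)"
    by (simp add: orb_def act_coset_biset) (simp add: coset_biset_def)
  have "(+) p ` U = U \<longleftrightarrow> p \<in> U" for p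
  proof
    assume "(+) p ` U = U"
    with U(1) show "p \<in> U" by (metis add.right_neutral image_eqI)
  next
    assume p: "p \<in> U"
    have "u \<in> (+) p ` U" if "u \<in> U" for u
      using U(2)[OF U(3)[OF p] that] by (intro image_eqI[of _ _ "- p + u"]) (simp_all add: add.assoc[symmetric])
    with U(2)[OF p] show "(+) p ` U = U" by auto
  qed
  then show "stab (act (coset_biset U)) U = U"
    by (simp add: stab_def act_coset_biset)
qed

lemma transitive_isomorphic:
  assumes M: "finite_biset G M" and m: "m \<in> points M" "orb (act M) m = points M"
    and N: "finite_biset G N" and n: "n \<in> points N" "orb (act N) n = points N"
    and stab: "stab (act M) m = stab (act N) n"
  shows "biset_isomorphic G M N"
proof -
  interpret finite_action "points M" "act M" by (rule finite_action_act[OF M])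
  obtain f where "bij_betw f (orb (act M) m) (orb (act N) n)"
    "\<And>p z. z \<in> orb (act M) m \<Longrightarrow> f (act M p z) = act N p (f z)"
    by (rule transitive_equivariant[OF finite_action_act[OF N] m(1) n(1) stab]) blast
  then show ?thesis using m n by (intro biset_isomorphicI[OF M N, of f]) simp_all
qed

end

text \<open>\<open>Domain V\<close> and \<open>Range U\<close> are the projections that meet when
  points with stabilizers \<open>U\<close> and \<open>V\<close> are paired. The element
  \<open>t\<close> stands for the pair \<open>(m t^-1, n)\<close>.\<close>

definition double_coset :: "('s::group_add \<times> 's) set \<Rightarrow> ('s \<times> 's) set \<Rightarrow> 's \<Rightarrow> 's set" where
  "double_coset U V t = {k + t + y |k y. k \<in> Domain V \<and> y \<in> Range U}"

lemma double_coset_eq_iff: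
  assumes U: "is_subgroup U" and V: "is_subgroup V"
  shows "double_coset U V t = double_coset U V t' \<longleftrightarrow> t' \<in> double_coset U V t"
proof -
  have D: "0 \<in> Domain V" "\<And>k l. k \<in> Domain V \<Longrightarrow> l \<in> Domain V \<Longrightarrow> k + l \<in> Domain V"
    "\<And>k. k \<in> Domain V \<Longrightarrow> - k \<in> Domain V"
    using V unfolding is_subgroup_def by (force simp: zero_prod_def)+
  have R: "0 \<in> Range U" "\<And>k l. k \<in> Range U \<Longrightarrow> l \<in> Range U \<Longrightarrow> k + l \<in> Range U"
    "\<And>k. k \<in> Range U \<Longrightarrow> - k \<in> Range U"
    using U unfolding is_subgroup_def by (force simp: zero_prod_def)+
  show ?thesis
  proof
    have "t' \<in> double_coset U V t'"
      using D(1) R(1) unfolding double_coset_def by (auto intro!: exI[of _ 0])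
    then show "double_coset U V t = double_coset U V t' \<Longrightarrow> t' \<in> double_coset U V t" by simp
  next
    assume "t' \<in> double_coset U V t"
    then obtain k y where t': "t' = k + t + y" "k \<in> Domain V" "y \<in> Range U"
      unfolding double_coset_def by blast
    have eq: "l + t' + z = (l + k) + t + (y + z)" "l + t + z = (l - k) + t' + (- y + z)" for l z
      by (simp_all add: t'(1) add.assoc)
        (metis add.assoc add.right_neutral diff_conv_add_uminus left_minus)+
    show "double_coset U V t = double_coset U V t'"
    proof
      show "double_coset U V t \<subseteq> double_coset U V t'"
      proof
        fix s assume "s \<in> double_coset U V t"
        then obtain l z where s: "s = l + t + z" "l \<in> Domain V" "z \<in> Range U"
          unfolding double_coset_def by blast
        then have "s = (l - k) + t' + (- y + z)" "l - k \<in> Domain V" "- y + z \<in> Range U"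
          using eq(2) D(2)[OF s(2) D(3)[OF t'(2)]] R(2)[OF R(3)[OF t'(3)] s(3)] by simp_all
        then show "s \<in> double_coset U V t'" unfolding double_coset_def by blast
      qed
      show "double_coset U V t' \<subseteq> double_coset U V t"
      proof
        fix s assume "s \<in> double_coset U V t'"
        then obtain l z where s: "s = l + t' + z" "l \<in> Domain V" "z \<in> Range U"
          unfolding double_coset_def by blast
        then have "s = (l + k) + t + (y + z)" "l + k \<in> Domain V" "y + z \<in> Range U"
          using eq(1) D(2)[OF s(2) t'(2)] R(2)[OF t'(3) s(3)] by simp_all
        then show "s \<in> double_coset U V t" unfolding double_coset_def by blast
      qed
    qed
  qed
qed

lemma conj_by_pair: "(x, y) \<in> conj_by (0, t) U \<longleftrightarrow> (x, - t + y + t) \<in> U" for t :: "'s::group_add"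
proof
  assume "(x, y) \<in> conj_by (0, t) U"
  then show "(x, - t + y + t) \<in> U" by (auto simp: conj_by_def add.assoc)
next
  assume "(x, - t + y + t) \<in> U"
  moreover have "(x, y) = (0, t) + (x, - t + y + t) - (0, t)" by (simp add: add.assoc)
  ultimately show "(x, y) \<in> conj_by (0, t) U" unfolding conj_by_def by blast
qed

text \<open>Up to conjugation, the composite in Mackey's formula depends only on the double coset.
  If \<open>t' = k + t + y\<close> with \<open>(k, b)\<close> in \<open>V\<close> and
  \<open>(a, y)\<close> in \<open>U\<close>, then conjugation by \<open>(a, y)\<close> preserves
  \<open>U\<close>, conjugation by \<open>(k, b)\<close> preserves \<open>V\<close>, and what is
  left is conjugation by \<open>(- a, b)\<close>.\<close>

lemma double_coset_conj:
  assumes U: "is_subgroup U" and V: "is_subgroup V" and t': "t' \<in> double_coset U V t"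
  shows "\<exists>p. conj_by (0, t') U O V = conj_by p (conj_by (0, t) U O V)"
proof -
  obtain k b a y where *: "(k, b) \<in> V" "(a, y) \<in> U" "t' = k + t + y"
    using t' unfolding double_coset_def by blast
  have conj_mem: "u \<in> U \<longleftrightarrow> p + u - p \<in> U" if "p \<in> U" and "is_subgroup U" for p u and U :: "('a \<times> 'a) set"
  proof -
    have "u = - p + (p + u - p) + p" by (simp add: add.assoc)
    then show ?thesis using that unfolding is_subgroup_def
      by (metis add_uminus_conv_diff)
  qed
  have 1: "(x, z) \<in> conj_by (0, t') U O V \<longleftrightarrow> (a + x - a, - b + z + b) \<in> conj_by (0, t) U O V" for x z
  proof
    assume "(x, z) \<in> conj_by (0, t') U O V"
    then obtain w where w: "(x, - t' + w + t') \<in> U" "(w, z) \<in> V" by (auto simp: conj_by_pair)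
    have "(a, y) + (x, - t' + w + t') - (a, y) \<in> U"
      using conj_mem[OF *(2) U] w(1) by blast
    \<comment> \<open>The middle element \<open>w\<close> of the composite is replaced by
      \<open>- k + w + k\<close>.\<close>
    moreover have "y + (- t' + w + t') - y = - t + (- k + w + k) + t"
      by (simp add: *(3) minus_add add.assoc diff_conv_add_uminus del: add_uminus_conv_diff)
    moreover have "- (k, b) + (w, z) - - (k, b) \<in> V"
      using conj_mem[of "- (k, b)" V] V w(2) *(1) unfolding is_subgroup_def by blast
    ultimately show "(a + x - a, - b + z + b) \<in> conj_by (0, t) U O V"
      by (intro relcompI[of _ "- k + w + k"]) (simp_all add: conj_by_pair)
  next
    assume "(a + x - a, - b + z + b) \<in> conj_by (0, t) U O V"
    then obtain w where w: "(a + x - a, - t + w + t) \<in> U" "(w, - b + z + b) \<in> V" by (auto simp: conj_by_pair)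
    have "- (a, y) + (a + x - a, - t + w + t) - - (a, y) \<in> U"
      using conj_mem[of "- (a, y)" U] U w(1) *(2) unfolding is_subgroup_def by blast
    moreover have "- y + (- t + w + t) + y = - t' + (k + w - k) + t'"
      by (simp add: *(3) minus_add add.assoc diff_conv_add_uminus del: add_uminus_conv_diff)
    moreover have "- a + (a + x - a) + a = x" by (simp add: add.assoc)
    ultimately have "(x, - t' + (k + w - k) + t') \<in> U" by simp
    moreover have "(k, b) + (w, - b + z + b) - (k, b) \<in> V"
      using conj_mem[OF *(1) V] w(2) by blast
    then have "(k + w - k, z) \<in> V" by (simp add: add.assoc)
    ultimately show "(x, z) \<in> conj_by (0, t') U O V"
      by (intro relcompI[of _ "k + w - k"]) (simp_all add: conj_by_pair)
  qed
  have 2: "(x, z) \<in> conj_by (- a, b) W \<longleftrightarrow> (a + x - a, - b + z + b) \<in> W" for x z and W :: "('a \<times> 'a) set"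
  proof
    assume "(x, z) \<in> conj_by (- a, b) W"
    then show "(a + x - a, - b + z + b) \<in> W" by (auto simp: conj_by_def add.assoc)
  next
    assume "(a + x - a, - b + z + b) \<in> W"
    moreover have "(x, z) = (- a, b) + (a + x - a, - b + z + b) - (- a, b)" by (simp add: add.assoc)
    ultimately show "(x, z) \<in> conj_by (- a, b) W" unfolding conj_by_def by blast
  qed
  have "u \<in> conj_by (0, t') U O V \<longleftrightarrow> u \<in> conj_by (- a, b) (conj_by (0, t) U O V)" for u
    by (cases u) (simp only: 1 2)
  then have "conj_by (0, t') U O V = conj_by (- a, b) (conj_by (0, t) U O V)" by blast
  then show ?thesis by blast
qed

text \<open>Sending a transitive biset with point stabilizer \<open>U\<close> to \<open>val U\<close> gives a ring homomorphism by
  \<open>val_mult\<close>, which is Mackey's formula; \<open>coef\<close> inverts it on the classes of transitive bisets.\<close>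

locale burnside_rep = coded_group G code for G (structure) and code :: "'s::{group_add, finite} \<Rightarrow> 'g" +
  fixes val :: "('s \<times> 's) set \<Rightarrow> 't::ring_1" and reps :: "('s \<times> 's) set set"
    and coef :: "'t \<Rightarrow> ('s \<times> 's) set \<Rightarrow> bit"
  assumes two: "x + x = (0::'t)"
    and val_conj: "val (conj_by p U) = val U"
    and val_one: "val {(x, x) |x. True} = 1"
    and finite_reps: "finite reps"
    and reps_subgroup: "U \<in> reps \<Longrightarrow> is_subgroup U"
    and reps_conj: "is_subgroup U \<Longrightarrow> \<exists>p. conj_by p U \<in> reps"
    and val_mult: "U \<in> reps \<Longrightarrow> V \<in> reps \<Longrightarrow>
      val U * val V = fib_sum UNIV (double_coset U V) (\<lambda>t. val (conj_by (0, t) U O V))"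
    and coef_add: "coef (x + y) U = coef x U + coef y U"
    and coef_val: "U \<in> reps \<Longrightarrow> V \<in> reps \<Longrightarrow> coef (val U) V = (if U = V then 1 else 0)"
    and val_coef: "(\<Sum>U\<in>reps. if coef x U = 0 then 0 else val U) = x"
begin

abbreviation orbsum :: "('g, 'x) biset \<Rightarrow> 't" where
  "orbsum M \<equiv> orbit_sum val (points M) (act M)"

lemma orbsum_cong:
  assumes "biset_isomorphic G M N" "finite_biset G M" "finite_biset G N"
  shows "orbsum M = orbsum N"
proof -
  obtain f where "bij_betw f (points M) (points N)"
    "\<And>p m. m \<in> points M \<Longrightarrow> f (act M p m) = act N p (f m)"
    using biset_isomorphicE assms by blast
  then show ?thesis
    by (intro orbit_sum_cong[OF finite_action_act[OF assms(2)] finite_action_act[OF assms(3)] val_conj])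
qed

lemma orbsum_sum:
  assumes M: "finite_biset G M" and N: "finite_biset G N"
  shows "orbsum (biset_sum M N) = orbsum M + orbsum N"
proof -
  let ?S = "biset_sum M N"
  have S: "finite_action (points ?S) (act ?S)" by (rule finite_action_act[OF finite_biset_sum[OF M N]])
  have pts: "points ?S = Inl ` points M \<union> Inr ` points N" by (simp add: biset_sum_def Plus_def)
  interpret S: finite_action "points ?S" "act ?S" by (rule S)
  interpret M: finite_action "points M" "act M" by (rule finite_action_act[OF M])
  interpret N: finite_action "points N" "act N" by (rule finite_action_act[OF N])
  have l: "act ?S p y \<in> Inl ` points M" if "y \<in> Inl ` points M" for p y
    using that by (auto simp: act_sum intro: M.act_closed)
  have r: "act ?S p y \<in> Inr ` points N" if "y \<in> Inr ` points N" for p y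
    using that by (auto simp: act_sum intro: N.act_closed)
  have "orbsum ?S = orbit_sum val (Inl ` points M) (act ?S) + orbit_sum val (Inr ` points N) (act ?S)"
    unfolding pts by (rule orbit_sum_Un[OF S[unfolded pts] _ l val_conj]) auto
  moreover have "orbsum M = orbit_sum val (Inl ` points M) (act ?S)"
    by (rule orbit_sum_cong[OF M.finite_action_axioms S.finite_action_subset[OF _ l] val_conj, of Inl])
      (auto simp: pts bij_betw_def act_sum)
  moreover have "orbsum N = orbit_sum val (Inr ` points N) (act ?S)"
    by (rule orbit_sum_cong[OF N.finite_action_axioms S.finite_action_subset[OF _ r] val_conj, of Inr])
      (auto simp: pts bij_betw_def act_sum)
  ultimately show ?thesis by simp
qed

lemma orbit_rep:
  assumes M: "finite_biset G M" and m: "m \<in> points M"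
  obtains m' where "m' \<in> points M" "orb (act M) m' = orb (act M) m" "stab (act M) m' \<in> reps"
proof -
  interpret finite_action "points M" "act M" by (rule finite_action_act[OF M])
  obtain p where "conj_by p (stab (act M) m) \<in> reps" using reps_conj is_subgroup_stab[OF m] by blast
  then show thesis using that[of "act M p m"] act_closed[OF m] orb_act[OF m] stab_act[OF m] by simp
qed

text \<open>Orbits on the tensor product are orbits of triples on pairs. Those over a fixed pair of
  orbits correspond to double cosets, \<open>t\<close> yielding the pair
  \<open>(m0 t^-1, n0)\<close>, and with the stabilizers of tensor points their sum is the
  right-hand side of \<open>val_mult\<close>. Distributivity then gives the product of the two orbit
  sums.\<close>

lemma orbsum_tensor:
  assumes M: "finite_biset G M" and N: "finite_biset G N"
  shows "orbsum (biset_tensor G M N) = orbsum M * orbsum N"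
proof -
  let ?T = "biset_tensor G M N" and ?X = "points M \<times> points N"
  let ?F = "\<lambda>(m, n). val (stab (act M) m O stab (act N) n)"
  let ?j = "\<lambda>(m, n). (orb (act M) m, orb (act N) n)"
  interpret M: finite_action "points M" "act M" by (rule finite_action_act[OF M])
  interpret N: finite_action "points N" "act N" by (rule finite_action_act[OF N])
  interpret T: finite_action "points ?T" "act ?T" by (rule finite_action_act[OF finite_biset_tensor[OF M N]])
  have tri: "tri_orb M N (m, n) = tri_orb M N (m', n') \<longleftrightarrow>
      orb (act ?T) (tensor_pt M N (m, n)) = orb (act ?T) (tensor_pt M N (m', n'))"
    if "m \<in> points M" "n \<in> points N" "m' \<in> points M" "n' \<in> points N" for m n m' n'
    using tri_orb_eq_iff[OF M N that] orb_tensor_eq_iff[OF M N that] by simp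
  have const: "fib_const ?X (tri_orb M N) ?F"
    unfolding fib_const_def
  proof (intro ballI impI)
    fix x y assume "x \<in> ?X" "y \<in> ?X" and eq: "tri_orb M N x = tri_orb M N y"
    then obtain m n m' n' where mn: "x = (m, n)" "y = (m', n')"
      "m \<in> points M" "n \<in> points N" "m' \<in> points M" "n' \<in> points N" by blast
    have "tensor_pt M N (m, n) \<in> points ?T" "tensor_pt M N (m', n') \<in> points ?T"
      using mn by (auto simp: points_tensor[OF M N])
    then have "val (stab (act ?T) (tensor_pt M N (m, n))) = val (stab (act ?T) (tensor_pt M N (m', n')))"
      using T.fib_const_stab[of val, OF val_conj] eq tri[OF mn(3-6)] mn(1,2)
      unfolding fib_const_def by blast
    then show "?F x = ?F y"
      using mn by (simp add: stab_tensor[OF M N])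
  qed
  have "orbsum ?T = fib_sum ?X (tri_orb M N) ?F"
    unfolding orbit_sum_def
  proof (rule fib_sum_transfer[symmetric, of _ "tensor_pt M N"])
    show "fib_const (points ?T) (orb (act ?T)) (\<lambda>x. val (stab (act ?T) x))"
      by (rule T.fib_const_stab[OF val_conj])
    show "\<exists>x\<in>?X. orb (act ?T) (tensor_pt M N x) = orb (act ?T) y" if "y \<in> points ?T" for y
      using that unfolding points_tensor[OF M N] by blast
    fix x x' assume "x \<in> ?X" "x' \<in> ?X"
    then show "tri_orb M N x = tri_orb M N x' \<longleftrightarrow>
        orb (act ?T) (tensor_pt M N x) = orb (act ?T) (tensor_pt M N x')"
      by (elim SigmaE, simp only: tri)
  next
    fix x assume "x \<in> ?X"
    then show "tensor_pt M N x \<in> points ?T" "?F x = val (stab (act ?T) (tensor_pt M N x))"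
      unfolding points_tensor[OF M N] by (blast, elim SigmaE, simp only: stab_tensor[OF M N] prod.case)
  qed
  also have "\<dots> = (\<Sum>d\<in>?j ` ?X. fib_sum {x \<in> ?X. ?j x = d} (tri_orb M N) ?F)"
  proof (rule fib_sum_refine[OF _ _ const])
    show "finite ?X" using M.finite_X N.finite_X by simp
    fix x x' assume "x \<in> ?X" "x' \<in> ?X" and eq: "tri_orb M N x = tri_orb M N x'"
    then obtain m n m' n' where mn: "x = (m, n)" "x' = (m', n')"
      "m \<in> points M" "n \<in> points N" "m' \<in> points M" "n' \<in> points N" by blast
    then obtain a k b where "m' = act M (a, k) m" "n' = act N (k, b) n"
      using tri_orb_eq_iff[OF M N mn(3-6)] eq by auto
    then show "?j x = ?j x'" using mn M.orb_act N.orb_act by simp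
  qed
  also have "\<dots> = (\<Sum>d\<in>orb (act M) ` points M \<times> orb (act N) ` points N.
      val (stab (act M) (SOME x. x \<in> points M \<and> orb (act M) x = fst d)) *
      val (stab (act N) (SOME x. x \<in> points N \<and> orb (act N) x = snd d)))"
  proof (rule sum.cong)
    show "?j ` ?X = orb (act M) ` points M \<times> orb (act N) ` points N" by auto
    fix d assume "d \<in> orb (act M) ` points M \<times> orb (act N) ` points N"
    then obtain m n where d: "d = (orb (act M) m, orb (act N) n)" "m \<in> points M" "n \<in> points N" by auto
    \<comment> \<open>Base points with stabilizers in \<open>reps\<close>, where
      \<open>val_mult\<close> applies; the points chosen inside \<open>fib_sum\<close> lie in the
      same orbits and have the same values.\<close>
    obtain m0 where m0: "m0 \<in> points M" "orb (act M) m0 = orb (act M) m" "stab (act M) m0 \<in> reps"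
      using orbit_rep[OF M d(2)] by blast
    obtain n0 where n0: "n0 \<in> points N" "orb (act N) n0 = orb (act N) n" "stab (act N) n0 \<in> reps"
      using orbit_rep[OF N d(3)] by blast
    let ?U = "stab (act M) m0" and ?V = "stab (act N) n0"
    have rep: "val (stab (act M) (SOME x. x \<in> points M \<and> orb (act M) x = fst d)) = val ?U"
      "val (stab (act N) (SOME x. x \<in> points N \<and> orb (act N) x = snd d)) = val ?V"
      using fib_rep[OF M.fib_const_stab[of val, OF val_conj] m0(1)] fib_rep[OF N.fib_const_stab[of val, OF val_conj] n0(1)]
      by (simp_all add: d m0 n0)
    have "fib_sum UNIV (double_coset ?U ?V) (\<lambda>t. val (conj_by (0, t) ?U O ?V)) =
      fib_sum {x \<in> ?X. ?j x = d} (tri_orb M N) ?F"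
    proof (rule fib_sum_transfer[of _ "\<lambda>t. (act M (0, t) m0, n0)"])
      fix t
      show "(act M (0, t) m0, n0) \<in> {x \<in> ?X. ?j x = d}"
        using m0 n0 M.act_closed M.orb_act by (simp add: d)
      show "val (conj_by (0, t) ?U O ?V) = ?F (act M (0, t) m0, n0)"
        using M.stab_act[OF m0(1)] by simp
    next
      fix t t'
      have "tri_orb M N (act M (0, t) m0, n0) = tri_orb M N (act M (0, t') m0, n0) \<longleftrightarrow>
        (\<exists>a k b. act M (0, t') m0 = act M (a, k) (act M (0, t) m0) \<and> n0 = act N (k, b) n0)"
        by (rule tri_orb_eq_iff[OF M N]) (simp_all add: M.act_closed m0 n0)
      also have "\<dots> \<longleftrightarrow> (\<exists>a k b. (a, - t' + k + t) \<in> ?U \<and> (k, b) \<in> ?V)"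
      proof -
        have "act M (0, t') m0 = act M (a, k) (act M (0, t) m0) \<longleftrightarrow> (a, - t' + k + t) \<in> ?U" for a k
        proof -
          have "act M (0, t') m0 = act M (a, k) (act M (0, t) m0) \<longleftrightarrow>
              act M (a, k + t) m0 = act M (0, t') m0"
            using act_pair(1)[OF M N m0(1), of a 0 k t] by auto
          also have "\<dots> \<longleftrightarrow> act M (0, - t') (act M (a, k + t) m0) = m0"
            using M.act_eq_iff[of "act M (a, k + t) m0" m0 "(0, - t')"] M.act_closed[OF m0(1)] m0(1) by simp
          also have "act M (0, - t') (act M (a, k + t) m0) = act M (a, - t' + k + t) m0"
            using act_pair(1)[OF M N m0(1), of 0 a "- t'" "k + t"] by (simp add: add.assoc)
          finally show ?thesis by (simp add: stab_def)
        qed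
        moreover have "n0 = act N (k, b) n0 \<longleftrightarrow> (k, b) \<in> ?V" for k b
          by (auto simp: stab_def)
        ultimately show ?thesis by (simp only:)
      qed
      also have "\<dots> \<longleftrightarrow> (\<exists>k\<in>Domain ?V. \<exists>y\<in>Range ?U. t' = k + t + y)"
      proof
        assume "\<exists>a k b. (a, - t' + k + t) \<in> ?U \<and> (k, b) \<in> ?V"
        then obtain a k b where *: "(a, - t' + k + t) \<in> ?U" "(k, b) \<in> ?V" by blast
        then have "- (a, - t' + k + t) \<in> ?U"
          using M.is_subgroup_stab[OF m0(1)] unfolding is_subgroup_def by blast
        \<comment> \<open>Solving for \<open>t'\<close> brings in the inverse of
          \<open>- t' + k + t\<close>, hence the subgroup property of \<open>?U\<close>.\<close>
        then have "- (- t' + k + t) \<in> Range ?U" by auto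
        moreover have "t' = k + t + - (- t' + k + t)" by (simp add: minus_add add.assoc del: add_uminus_conv_diff)
        ultimately show "\<exists>k\<in>Domain ?V. \<exists>y\<in>Range ?U. t' = k + t + y" using *(2) by blast
      next
        assume "\<exists>k\<in>Domain ?V. \<exists>y\<in>Range ?U. t' = k + t + y"
        then obtain k b a y where *: "(k, b) \<in> ?V" "(a, y) \<in> ?U" "t' = k + t + y" by blast
        then have "- (a, y) \<in> ?U"
          using M.is_subgroup_stab[OF m0(1)] unfolding is_subgroup_def by blast
        moreover have "- y = - t' + k + t" by (simp add: * minus_add add.assoc del: add_uminus_conv_diff)
        ultimately show "\<exists>a k b. (a, - t' + k + t) \<in> ?U \<and> (k, b) \<in> ?V" using *(1) by auto
      qed
      also have "\<dots> \<longleftrightarrow> double_coset ?U ?V t = double_coset ?U ?V t'"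
        using double_coset_eq_iff[OF M.is_subgroup_stab[OF m0(1)] N.is_subgroup_stab[OF n0(1)], of t t']
        unfolding double_coset_def by blast
      finally show "double_coset ?U ?V t = double_coset ?U ?V t' \<longleftrightarrow>
        tri_orb M N (act M (0, t) m0, n0) = tri_orb M N (act M (0, t') m0, n0)" by simp
    next
      fix x assume "x \<in> {x \<in> ?X. ?j x = d}"
      then obtain m' n' where x: "x = (m', n')" "m' \<in> points M" "n' \<in> points N"
        "orb (act M) m0 = orb (act M) m'" "orb (act N) n0 = orb (act N) n'" using m0 n0 d by auto
      then obtain p q where pq: "m' = act M p m0" "n' = act N q n0"
        using M.orb_eq_iff[OF m0(1)] N.orb_eq_iff[OF n0(1)] by metis
      obtain a k k' b where [simp]: "p = (a, k)" "q = (k', b)" by (metis surj_pair)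
      \<comment> \<open>The triple \<open>(a, k', b)\<close> sends the pair belonging to
        \<open>t = - k' + k\<close> to \<open>(m', n')\<close>.\<close>
      have "m' = act M (a, k') (act M (0, - k' + k) m0)"
        using act_pair(1)[OF M N m0(1), of a 0 k' "- k' + k"] pq by (simp add: add.assoc[symmetric])
      then have "tri_orb M N (act M (0, - k' + k) m0, n0) = tri_orb M N x"
        unfolding x(1) using pq x(2,3) m0(1) n0(1) M.act_closed
        by (subst tri_orb_eq_iff[OF M N]) auto
      then show "\<exists>t\<in>UNIV. tri_orb M N (act M (0, t) m0, n0) = tri_orb M N x" by blast
    next
      show "fib_const {x \<in> ?X. ?j x = d} (tri_orb M N) ?F"
        using const unfolding fib_const_def by blast
    qed
    then show "fib_sum {x \<in> ?X. ?j x = d} (tri_orb M N) ?F =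
      val (stab (act M) (SOME x. x \<in> points M \<and> orb (act M) x = fst d)) *
      val (stab (act N) (SOME x. x \<in> points N \<and> orb (act N) x = snd d))"
      unfolding rep val_mult[OF m0(3) n0(3)] by simp
  qed
  also have "\<dots> = orbsum M * orbsum N"
    unfolding orbit_sum_def fib_sum_def sum_product sum.cartesian_product by (simp add: case_prod_unfold)
  finally show ?thesis .
qed

end

subsection \<open>The double Burnside algebra over the field with two elements\<close>

context burnside_rep
begin

definition class_val :: "'g biset_class \<Rightarrow> 't" where
  "class_val C = orbsum (SOME M. M \<in> C)"

lemma class_val_class:
  assumes "finite_biset G M"
  shows "class_val (biset_class G M) = orbsum M"
proof -
  obtain N :: "('g, nat) biset" where "finite_biset G N" "biset_isomorphic G M N" by (rule nat_copy[OF assms])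
  then have "N \<in> biset_class G M" by (simp add: biset_class_def)
  then have "(SOME N. N \<in> biset_class G M) \<in> biset_class G M" by (rule someI)
  then have "finite_biset G (SOME N. N \<in> biset_class G M)" "biset_isomorphic G M (SOME N. N \<in> biset_class G M)"
    unfolding biset_class_def by simp_all
  then show ?thesis
    unfolding class_val_def by (intro orbsum_cong[symmetric] assms)
qed

text \<open>The definition takes a union over all representatives. They yield the same class by
  \<open>biset_tensor_cong\<close>, and there is at least one by \<open>nat_copy\<close>.\<close>

lemma biset_class_mult_class:
  assumes M: "finite_biset G M" and N: "finite_biset G N"
  shows "biset_class_mult G (biset_class G M) (biset_class G N) = biset_class G (biset_tensor G M N)"
proof -
  obtain M0 :: "('g, nat) biset" where M0: "finite_biset G M0" "biset_isomorphic G M M0" by (rule nat_copy[OF M])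
  obtain N0 :: "('g, nat) biset" where N0: "finite_biset G N0" "biset_isomorphic G N N0" by (rule nat_copy[OF N])
  have "M0 \<in> biset_class G M" "N0 \<in> biset_class G N" using M0 N0 by (auto simp: biset_class_def)
  moreover have "biset_class G (biset_tensor G M' N') = biset_class G (biset_tensor G M N)"
    if "M' \<in> biset_class G M" "N' \<in> biset_class G N" for M' N' :: "('g, nat) biset"
  proof -
    have *: "finite_biset G M'" "biset_isomorphic G M M'" "finite_biset G N'" "biset_isomorphic G N N'"
      using that by (auto simp: biset_class_def)
    show ?thesis
      by (rule biset_class_eqI[OF biset_isomorphic_sym[OF biset_tensor_cong[OF *(2,4) M *(1) N *(3)]]])
        (rule finite_biset_tensor M N *)+
  qed
  ultimately show ?thesis unfolding biset_class_mult_def by blast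
qed

lemma biset_classesE:
  assumes "C \<in> biset_classes G"
  obtains M :: "('g, nat) biset" where "finite_biset G M" "C = biset_class G M"
  using assms unfolding biset_classes_def by blast

lemma class_val_mult:
  assumes "C \<in> biset_classes G" "D \<in> biset_classes G"
  shows "class_val C * class_val D = class_val (biset_class_mult G C D)"
proof -
  obtain M N :: "('g, nat) biset" where "finite_biset G M" "C = biset_class G M" "finite_biset G N" "D = biset_class G N"
    using biset_classesE assms by metis
  then show ?thesis
    by (simp add: biset_class_mult_class class_val_class finite_biset_tensor orbsum_tensor)
qed

lemma biset_class_mult_closed:
  assumes "C \<in> biset_classes G" "D \<in> biset_classes G"
  shows "biset_class_mult G C D \<in> biset_classes G"
proof -
  obtain M N :: "('g, nat) biset" where "finite_biset G M" "C = biset_class G M" "finite_biset G N" "D = biset_class G N"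
    using biset_classesE assms by metis
  then show ?thesis
    by (simp add: biset_class_mult_class biset_class_mem finite_biset_tensor)
qed

lemma finite_regular_biset: "finite_biset G (regular_biset G)"
  unfolding finite_biset_def regular_biset_def
  using bij_betw_finite[OF code_bij] by (auto simp: m_assoc)

text \<open>The regular biset is transitive, and the stabilizer of 1 is the diagonal.\<close>

lemma orbsum_regular: "orbsum (regular_biset G) = 1"
proof -
  have mem: "\<one> \<in> points (regular_biset G)" by (simp add: regular_biset_def)
  have act: "act (regular_biset G) (x, y) (code z) = code (x + z - y)" for x y z
    by (simp add: act_def regular_biset_def add_diff_eq flip: code_add code_uminus)
  interpret finite_action "points (regular_biset G)" "act (regular_biset G)"
    by (rule finite_action_act[OF finite_regular_biset])
  have "code z \<in> orb (act (regular_biset G)) (code 0)" for z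
    unfolding orb_def by (rule range_eqI[of _ _ "(z, 0)"]) (simp add: act)
  then have "points (regular_biset G) \<subseteq> orb (act (regular_biset G)) (code 0)"
    using code_surj by (auto simp: regular_biset_def)
  then have orb: "orb (act (regular_biset G)) (code 0) = points (regular_biset G)"
    using orb_subset[OF mem] by (simp add: code_zero)
  have inj: "code a = code b \<longleftrightarrow> a = b" for a b using code_bij by (auto simp: bij_betw_def inj_on_def)
  have "stab (act (regular_biset G)) (code 0) = {(x, x) |x. True}"
    by (auto simp: stab_def act inj)
  then show ?thesis
    using orbit_sum_transitive[OF finite_action_act[OF finite_regular_biset] _ orb val_conj] val_one mem
    by (simp add: code_zero)
qed

section \<open>Normal forms modulo the relations \<open>[M + N] = [M] + [N]\<close>\<close>

abbreviation rep_class :: "('s \<times> 's) set \<Rightarrow> 'g biset_class" where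
  "rep_class U \<equiv> biset_class G (coset_biset U)"

lemma class_val_rep: "U \<in> reps \<Longrightarrow> class_val (rep_class U) = val U"
  using orbit_sum_transitive[OF finite_action_act[OF finite_coset_biset] stab_coset_biset(1,2)[OF reps_subgroup] val_conj]
    stab_coset_biset(3)[OF reps_subgroup]
  by (simp add: class_val_class[OF finite_coset_biset])

definition normal_form :: "'t \<Rightarrow> 'g biset_class \<Rightarrow> bit" where
  "normal_form x = (\<lambda>C. \<Sum>U\<in>reps. coef x U * basis_elem (rep_class U) C)"

lemma coef_zero: "coef 0 U = 0"
  using coef_add[of 0 0 U] by (cases "coef 0 U") auto

lemma normal_form_zero: "normal_form 0 = (\<lambda>_. 0)"
  by (simp add: normal_form_def coef_zero)

lemma normal_form_add: "normal_form (x + y) = (\<lambda>C. normal_form x C + normal_form y C)"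
  unfolding normal_form_def
  by (simp add: coef_add distrib_right sum.distrib del: add_bit_eq_xor mult_bit_eq_and)

lemma normal_form_val:
  assumes "U \<in> reps"
  shows "normal_form (val U) = basis_elem (rep_class U)"
proof
  fix C
  have "normal_form (val U) C = (\<Sum>V\<in>reps. if U = V then basis_elem (rep_class V) C else 0)"
    unfolding normal_form_def using assms
    by (intro sum.cong) (auto simp: coef_val simp del: mult_bit_eq_and)
  then show "normal_form (val U) C = basis_elem (rep_class U) C"
    using assms finite_reps by simp
qed

abbreviation "burnside_alg \<equiv> (free_biset_alg G :: (bit, 'g biset_class \<Rightarrow> bit) module)"

lemma rep_class_mem: "rep_class U \<in> biset_classes G"
  by (rule biset_class_mem[OF finite_coset_biset])

lemma normal_form_closed:
  "normal_form x \<in> carrier burnside_alg" "lin_ext class_val (normal_form x) = x"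
proof -
  have "(\<lambda>C. \<Sum>U\<in>R. coef x U * basis_elem (rep_class U) C) \<in> carrier burnside_alg \<and>
    lin_ext class_val (\<lambda>C. \<Sum>U\<in>R. coef x U * basis_elem (rep_class U) C) = (\<Sum>U\<in>R. if coef x U = 0 then 0 else val U)"
    if "finite R" "R \<subseteq> reps" for R
    using that
  proof (induction R)
    case empty
    then show ?case by (simp add: free_biset_alg_def)
  next
    case (insert U R)
    interpret abelian_group burnside_alg
      unfolding free_biset_alg_def by (rule abelian_group_basis_alg)
    let ?f = "\<lambda>C. coef x U * basis_elem (rep_class U) C" and ?g = "\<lambda>C. \<Sum>U\<in>R. coef x U * basis_elem (rep_class U) C"
    have f: "?f \<in> carrier burnside_alg" "lin_ext class_val ?f = (if coef x U = 0 then 0 else val U)"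
    proof (atomize (full), cases "coef x U")
      case zero
      then show "?f \<in> carrier burnside_alg \<and> lin_ext class_val ?f = (if coef x U = 0 then 0 else val U)"
        by (simp add: free_biset_alg_def)
    next
      case one
      then show "?f \<in> carrier burnside_alg \<and> lin_ext class_val ?f = (if coef x U = 0 then 0 else val U)"
        using basis_elem_carrier[OF rep_class_mem] class_val_rep[of U] insert.prems
        by (simp add: free_biset_alg_def del: mult_bit_eq_and basis_alg_sel(1))
    qed
    have g: "?g \<in> carrier burnside_alg"
      "lin_ext class_val ?g = (\<Sum>U\<in>R. if coef x U = 0 then 0 else val U)" using insert by auto
    have eq: "(\<lambda>C. \<Sum>U\<in>insert U R. coef x U * basis_elem (rep_class U) C) = (\<lambda>C. ?f C + ?g C)"
      using insert.hyps by (simp del: add_bit_eq_xor mult_bit_eq_and)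
    have "(\<lambda>C. ?f C + ?g C) \<in> carrier burnside_alg"
      using a_closed[OF f(1) g(1)] by (simp add: free_biset_alg_def del: basis_alg_sel(1) add_bit_eq_xor mult_bit_eq_and)
    moreover have "lin_ext class_val (\<lambda>C. ?f C + ?g C) = lin_ext class_val ?f + lin_ext class_val ?g"
      using f(1) g(1) by (intro lin_ext_add two) (simp_all add: free_biset_alg_def del: add_bit_eq_xor mult_bit_eq_and)
    ultimately show ?case
      unfolding eq f(2) g(2) using insert.hyps by simp
  qed
  from this[OF finite_reps order_refl] show "normal_form x \<in> carrier burnside_alg" "lin_ext class_val (normal_form x) = x"
    unfolding val_coef normal_form_def by auto
qed

abbreviation "burnside_relations \<equiv> module_span burnside_alg (biset_sum_relations G)"

lemma relation_eq:
  fixes M N :: "('g, nat) biset"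
  assumes "finite_biset G M" "finite_biset G N"
  shows "basis_elem (biset_class G (biset_sum M N)) \<ominus>\<^bsub>burnside_alg\<^esub>
      (basis_elem (biset_class G M) \<oplus>\<^bsub>burnside_alg\<^esub> basis_elem (biset_class G N)) =
    (\<lambda>C. basis_elem (biset_class G (biset_sum M N)) C + (basis_elem (biset_class G M) C + basis_elem (biset_class G N) C))"
proof -
  interpret abelian_group burnside_alg
    unfolding free_biset_alg_def by (rule abelian_group_basis_alg)
  have "basis_elem (biset_class G M) \<oplus>\<^bsub>burnside_alg\<^esub> basis_elem (biset_class G N) \<in> carrier burnside_alg"
    using assms by (intro a_closed) (auto simp: free_biset_alg_def intro!: basis_elem_carrier biset_class_mem simp del: basis_alg_sel(1))
  then show ?thesis
    unfolding free_biset_alg_def by (subst basis_alg_bit_minus) simp_all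
qed

lemma relation_mem:
  fixes M N :: "('g, nat) biset"
  assumes "finite_biset G M" "finite_biset G N"
  shows "(\<lambda>C. basis_elem (biset_class G (biset_sum M N)) C + (basis_elem (biset_class G M) C + basis_elem (biset_class G N) C))
    \<in> burnside_relations"
  unfolding relation_eq[OF assms, symmetric] biset_sum_relations_def
  using assms by (intro module_span_superset) blast

lemma burnside_alg_sel:
  "\<zero>\<^bsub>burnside_alg\<^esub> = (\<lambda>_. 0)" "f \<oplus>\<^bsub>burnside_alg\<^esub> g = (\<lambda>s. f s + g s)" "c \<odot>\<^bsub>burnside_alg\<^esub> f = (\<lambda>s. c * f s)"
  by (simp_all add: free_biset_alg_def)

lemma relations_kernel: "f \<in> burnside_relations \<Longrightarrow> f \<in> carrier burnside_alg \<and> lin_ext class_val f = 0"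
proof -
  interpret abelian_group burnside_alg
    unfolding free_biset_alg_def by (rule abelian_group_basis_alg)
  have fin: "finite {p. f p \<noteq> 0}" if "f \<in> carrier burnside_alg" for f
    using that by (simp add: free_biset_alg_def)
  have add: "lin_ext class_val (f \<oplus>\<^bsub>burnside_alg\<^esub> g) = lin_ext class_val f + lin_ext class_val g"
    if "f \<in> carrier burnside_alg" "g \<in> carrier burnside_alg" for f g
    unfolding burnside_alg_sel by (intro lin_ext_add two fin that)
  have be: "basis_elem (biset_class G M) \<in> carrier burnside_alg" if "finite_biset G M" for M :: "('g, 'x) biset"
    unfolding free_biset_alg_def by (intro basis_elem_carrier biset_class_mem that)
  have "burnside_relations \<subseteq> {f \<in> carrier burnside_alg. lin_ext class_val f = 0}"
  proof (rule module_span_least)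
    show "biset_sum_relations G \<subseteq> {f \<in> carrier burnside_alg. lin_ext class_val f = 0}"
    proof
      fix r assume "r \<in> (biset_sum_relations G :: ('g biset_class \<Rightarrow> bit) set)"
      then obtain M N :: "('g, nat) biset" where MN: "finite_biset G M" "finite_biset G N" and
        r: "r = basis_elem (biset_class G (biset_sum M N)) \<ominus>\<^bsub>burnside_alg\<^esub>
          (basis_elem (biset_class G M) \<oplus>\<^bsub>burnside_alg\<^esub> basis_elem (biset_class G N))"
        unfolding biset_sum_relations_def by blast
      note b = be[OF MN(1)] be[OF MN(2)] be[OF finite_biset_sum[OF MN]]
      have r': "r = basis_elem (biset_class G (biset_sum M N)) \<oplus>\<^bsub>burnside_alg\<^esub>
          (basis_elem (biset_class G M) \<oplus>\<^bsub>burnside_alg\<^esub> basis_elem (biset_class G N))"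
        by (simp only: r relation_eq[OF MN]) (simp only: burnside_alg_sel)
      have "lin_ext class_val r = orbsum (biset_sum M N) + (orbsum M + orbsum N)"
        unfolding r' using b by (simp add: add class_val_class MN finite_biset_sum)
      also have "\<dots> = 0" by (simp add: orbsum_sum MN two)
      finally show "r \<in> {f \<in> carrier burnside_alg. lin_ext class_val f = 0}"
        using b unfolding r' by simp
    qed
    show "\<zero>\<^bsub>burnside_alg\<^esub> \<in> {f \<in> carrier burnside_alg. lin_ext class_val f = 0}"
      using zero_closed by (simp add: burnside_alg_sel)
    show "c \<odot>\<^bsub>burnside_alg\<^esub> f \<in> {f \<in> carrier burnside_alg. lin_ext class_val f = 0}"
      if "f \<in> {f \<in> carrier burnside_alg. lin_ext class_val f = 0}" for c f
      using that zero_closed by (cases c) (simp_all add: burnside_alg_sel del: mult_bit_eq_and)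
  qed (auto simp: add)
  then show "f \<in> burnside_relations \<Longrightarrow> f \<in> carrier burnside_alg \<and> lin_ext class_val f = 0" by blast
qed

text \<open>Induction on the number of points: a relation splits off one orbit, and this orbit is a
  coset biset. In characteristic 2 congruence means that the sum lies in the span.\<close>

lemma basis_elem_normal:
  fixes M :: "('g, nat) biset"
  assumes "finite_biset G M"
  shows "(\<lambda>C. basis_elem (biset_class G M) C + normal_form (orbsum M) C) \<in> burnside_relations"
  using assms
proof (induction "card (points M)" arbitrary: M rule: less_induct)
  case less
  note M = less.prems
  interpret finite_action "points M" "act M" by (rule finite_action_act[OF M])
  show ?case
  proof (cases "points M = {}")
    case True
    \<comment> \<open>For the empty biset, \<open>M + M\<close> is isomorphic to \<open>M\<close>,
      so the relation reads \<open>[M] + ([M] + [M])\<close>, which is \<open>[M]\<close>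
      itself.\<close>
    have "biset_isomorphic G (biset_sum M M) M"
      unfolding biset_isomorphic_def by (rule exI[of _ undefined]) (simp add: biset_sum_def True bij_betw_def Plus_def)
    then have eq: "biset_class G (biset_sum M M) = biset_class G M"
      by (rule biset_class_eqI[OF _ finite_biset_sum[OF M M] M])
    have "orbsum M = 0" by (simp add: orbit_sum_def fib_sum_def True)
    then show ?thesis
      using relation_mem[OF M M] by (simp add: eq normal_form_zero)
  next
    case False
    then obtain m where m: "m \<in> points M" "stab (act M) m \<in> reps" using orbit_rep[OF M] by blast
    let ?O = "orb (act M) m" and ?U = "stab (act M) m"
    let ?M1 = "M\<lparr>points := ?O\<rparr>" and ?M2 = "M\<lparr>points := points M - ?O\<rparr>"
    have cl1: "act M p y \<in> ?O" if "y \<in> ?O" for p y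
      using that m(1) unfolding orb_def by (auto simp: act_add[symmetric])
    have cl2: "act M p y \<in> points M - ?O" if "y \<in> points M - ?O" for p y
      using that cl1[of "act M p y" "- p"] act_uminus(1)[of y p] act_closed[of y p] by auto
    have M1: "finite_biset G ?M1" by (rule finite_biset_subset[OF M orb_subset[OF m(1)] cl1])
    have M2: "finite_biset G ?M2" by (rule finite_biset_subset[OF M _ cl2]) auto
    have sub: "?O \<subseteq> points M" "m \<in> ?O" using orb_subset orb_self m(1) by blast+
    have "biset_isomorphic G (biset_sum ?M1 ?M2) M"
    proof (rule biset_isomorphicI[OF finite_biset_sum[OF M1 M2] M, of "case_sum id id"])
      show "bij_betw (case_sum id id) (points (biset_sum ?M1 ?M2)) (points M)"
        using sub(1) by (auto simp: bij_betw_def inj_on_def biset_sum_def Plus_def image_Un image_image)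
      show "case_sum id id (act (biset_sum ?M1 ?M2) p y) = act M p (case_sum id id y)"
        if "y \<in> points (biset_sum ?M1 ?M2)" for p y
        by (cases y) (simp_all add: act_sum act_subset)
    qed
    then have eq: "biset_class G (biset_sum ?M1 ?M2) = biset_class G M"
      by (rule biset_class_eqI[OF _ finite_biset_sum[OF M1 M2] M])
    \<comment> \<open>As \<open>m\<close> was chosen with stabilizer in \<open>reps\<close>, its
      orbit is matched with the coset biset of this very subgroup.\<close>
    have "biset_isomorphic G ?M1 (coset_biset ?U)"
      by (rule transitive_isomorphic[OF M1, of m _ ?U])
        (simp_all add: sub act_subset finite_coset_biset stab_coset_biset[OF reps_subgroup[OF m(2)]])
    then have eq1: "biset_class G ?M1 = rep_class ?U"
      by (rule biset_class_eqI[OF _ M1 finite_coset_biset])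
    have "orbsum M = orbsum ?M1 + orbsum ?M2"
      using orbit_sum_Un[of ?O "points M - ?O" "act M" val] finite_action_axioms sub(1) cl1 val_conj
      by (simp add: act_subset Un_absorb1)
    moreover have "orbsum ?M1 = val ?U"
      using class_val_class[OF M1] class_val_rep[OF m(2)] by (simp add: eq1)
    ultimately have nf: "normal_form (orbsum M) = (\<lambda>C. basis_elem (rep_class ?U) C + normal_form (orbsum ?M2) C)"
      by (simp only: normal_form_add normal_form_val[OF m(2)])
    have "card (points ?M2) < card (points M)"
      using sub finite_X by (auto intro!: psubset_card_mono)
    then have IH: "(\<lambda>C. basis_elem (biset_class G ?M2) C + normal_form (orbsum ?M2) C) \<in> burnside_relations"
      by (rule less.hyps[OF _ M2])
    have cancel: "(x + (y + z)) + (z + w) = x + (y + w)" for x y z w :: bit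
      by (cases x; cases y; cases z; cases w) simp_all
    show ?thesis
      using module_span_add[OF relation_mem[OF M1 M2] IH]
      unfolding burnside_alg_sel eq eq1 nf by (simp only: cancel)
  qed
qed

lemma relations_eq_kernel: "burnside_relations = {f \<in> carrier burnside_alg. lin_ext class_val f = 0}"
proof -
  let ?A = "basis_alg (biset_classes G) (\<lambda>C D. Some (biset_class_mult G C D))
    (basis_elem (biset_class G (regular_biset G)))"
  have A: "burnside_alg = ?A" by (simp add: free_biset_alg_def)
  have "burnside_relations = {f \<in> carrier ?A. lin_ext class_val f = 0}"
  proof (rule lin_ext_kernel)
    fix C assume "C \<in> biset_classes G"
    then obtain M :: "('g, nat) biset" where "finite_biset G M" "C = biset_class G M" by (rule biset_classesE)
    then show "(\<lambda>D. basis_elem C D + normal_form (class_val C) D) \<in> burnside_relations"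
      using basis_elem_normal by (simp only: class_val_class)
  next
    fix f f' assume "f \<in> burnside_relations" "f' \<in> burnside_relations"
    then show "(\<lambda>p. f p + f' p) \<in> burnside_relations"
      using module_span_add[of f burnside_alg _ f'] by (simp only: burnside_alg_sel)
  next
    show "(\<lambda>_. 0) \<in> burnside_relations"
      using module_span_zero[of burnside_alg] by (simp add: burnside_alg_sel)
    show "f \<in> carrier ?A \<and> lin_ext class_val f = 0" if "f \<in> burnside_relations" for f
      using relations_kernel[OF that] unfolding A .
  qed (rule two normal_form_zero normal_form_add)+
  then show ?thesis unfolding A .
qed

theorem double_burnside_iso:
  "(\<lambda>x. {f \<in> carrier burnside_alg. lin_ext class_val f = x}) \<in>
    ring_iso (corner 1) (double_burnside G :: (bit, ('g biset_class \<Rightarrow> bit) set) module)"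
  "ring (double_burnside G :: (bit, ('g biset_class \<Rightarrow> bit) set) module)"
proof -
  let ?f = "\<lambda>x. {f \<in> carrier burnside_alg. lin_ext class_val f = x}"
  have "?f \<in> ring_iso (corner 1) (burnside_alg Quot burnside_relations)"
  proof (rule quot_by_kernel(2))
    show "abelian_group burnside_alg" unfolding free_biset_alg_def by (rule abelian_group_basis_alg)
    show "ring (corner (1::'t))" by (rule ring_corner) simp
    show "f \<otimes>\<^bsub>burnside_alg\<^esub> g \<in> carrier burnside_alg" if "f \<in> carrier burnside_alg" "g \<in> carrier burnside_alg" for f g
      using that unfolding free_biset_alg_def
      by (rule basis_alg_mult_closed) (auto simp: biset_class_mult_closed)
    show "\<one>\<^bsub>burnside_alg\<^esub> \<in> carrier burnside_alg"
      unfolding free_biset_alg_def basis_alg_sel(3)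
      by (intro basis_elem_carrier biset_class_mem finite_regular_biset)
    show "lin_ext class_val (f \<oplus>\<^bsub>burnside_alg\<^esub> g) = lin_ext class_val f \<oplus>\<^bsub>corner 1\<^esub> lin_ext class_val g"
      if "f \<in> carrier burnside_alg" "g \<in> carrier burnside_alg" for f g
      unfolding burnside_alg_sel corner_sel using that
      by (intro lin_ext_add two) (simp_all add: free_biset_alg_def)
    show "lin_ext class_val (f \<otimes>\<^bsub>burnside_alg\<^esub> g) = lin_ext class_val f \<otimes>\<^bsub>corner 1\<^esub> lin_ext class_val g"
      if "f \<in> carrier burnside_alg" "g \<in> carrier burnside_alg" for f g
      using that unfolding corner_sel free_biset_alg_def
      by (rule lin_ext_mult) (simp_all add: two class_val_mult)
    show "lin_ext class_val \<one>\<^bsub>burnside_alg\<^esub> = \<one>\<^bsub>corner 1\<^esub>"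
      by (simp add: free_biset_alg_def class_val_class finite_regular_biset orbsum_regular)
    show "\<exists>f\<in>carrier burnside_alg. lin_ext class_val f = x" for x
      using normal_form_closed by blast
  qed (simp_all add: relations_eq_kernel)
  then show iso: "?f \<in> ring_iso (corner 1) (double_burnside G :: (bit, ('g biset_class \<Rightarrow> bit) set) module)"
    unfolding double_burnside_def by (rule ring_iso_cong) simp_all
  show "ring (double_burnside G :: (bit, ('g biset_class \<Rightarrow> bit) set) module)"
  proof (rule ring_transfer_iso[OF _ iso])
    show "ring (corner (1::'t))" by (rule ring_corner) simp
    show "?f \<zero>\<^bsub>corner 1\<^esub> = \<zero>\<^bsub>double_burnside G\<^esub>"
      by (simp add: double_burnside_def FactRing_def relations_eq_kernel)
  qed
qed

end

section \<open>The symmetric group of degree three\<close>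

text \<open>\<open>Rk\<close> is the rotation $n \mapsto n + k$ and \<open>Fk\<close> the reflection $n \mapsto k - n$ of the
  residues modulo 3.\<close>

datatype s3 = R0 | R1 | R2 | F0 | F1 | F2

definition s3_list :: "s3 list" where "s3_list = [R0, R1, R2, F0, F1, F2]"

lemma set_s3_list: "set s3_list = UNIV"
  unfolding s3_list_def using s3.exhaust by auto

instance s3 :: finite
  by standard (metis set_s3_list List.finite_set)

instantiation s3 :: group_add
begin

definition zero_s3 :: s3 where "0 = R0"

fun plus_s3 :: "s3 \<Rightarrow> s3 \<Rightarrow> s3" where
  "R0 + R0 = R0" | "R0 + R1 = R1" | "R0 + R2 = R2" | "R0 + F0 = F0" | "R0 + F1 = F1" | "R0 + F2 = F2"
| "R1 + R0 = R1" | "R1 + R1 = R2" | "R1 + R2 = R0" | "R1 + F0 = F1" | "R1 + F1 = F2" | "R1 + F2 = F0"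
| "R2 + R0 = R2" | "R2 + R1 = R0" | "R2 + R2 = R1" | "R2 + F0 = F2" | "R2 + F1 = F0" | "R2 + F2 = F1"
| "F0 + R0 = F0" | "F0 + R1 = F2" | "F0 + R2 = F1" | "F0 + F0 = R0" | "F0 + F1 = R2" | "F0 + F2 = R1"
| "F1 + R0 = F1" | "F1 + R1 = F0" | "F1 + R2 = F2" | "F1 + F0 = R1" | "F1 + F1 = R0" | "F1 + F2 = R2"
| "F2 + R0 = F2" | "F2 + R1 = F1" | "F2 + R2 = F0" | "F2 + F0 = R2" | "F2 + F1 = R1" | "F2 + F2 = R0"

fun uminus_s3 :: "s3 \<Rightarrow> s3" where
  "- R0 = R0" | "- R1 = R2" | "- R2 = R1" | "- F0 = F0" | "- F1 = F1" | "- F2 = F2"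

definition minus_s3 :: "s3 \<Rightarrow> s3 \<Rightarrow> s3" where "x - y = x + - (y :: s3)"

instance
proof
  fix x y z :: s3
  show "x + y + z = x + (y + z)" by (cases x; cases y; cases z; simp only: plus_s3.simps)
  show "0 + x = x" "x + 0 = x" "- x + x = 0" by (cases x; simp add: zero_s3_def)+
  show "x + - y = x - y" by (simp add: minus_s3_def)
qed

end

text \<open>The residue 0 is represented by 3, and the numbers other than 1, 2, 3 are fixed, as
  \<open>sym_group 3\<close> requires.\<close>

fun s3_perm :: "s3 \<Rightarrow> nat \<Rightarrow> nat" where
  "s3_perm R0 = (\<lambda>n. if n = 1 then 1 else if n = 2 then 2 else if n = 3 then 3 else n)"
| "s3_perm R1 = (\<lambda>n. if n = 1 then 2 else if n = 2 then 3 else if n = 3 then 1 else n)"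
| "s3_perm R2 = (\<lambda>n. if n = 1 then 3 else if n = 2 then 1 else if n = 3 then 2 else n)"
| "s3_perm F0 = (\<lambda>n. if n = 1 then 2 else if n = 2 then 1 else if n = 3 then 3 else n)"
| "s3_perm F1 = (\<lambda>n. if n = 1 then 3 else if n = 2 then 2 else if n = 3 then 1 else n)"
| "s3_perm F2 = (\<lambda>n. if n = 1 then 1 else if n = 2 then 3 else if n = 3 then 2 else n)"

lemma s3_perm_add: "s3_perm (x + y) = s3_perm x \<circ> s3_perm y"
  by (cases x; cases y) (auto simp: fun_eq_iff)

lemma coded_sym_group_3: "coded_group (sym_group 3) s3_perm"
proof (intro coded_group.intro coded_group_axioms.intro)
  show "group (sym_group 3)" by (rule sym_group_is_group)
  show "s3_perm (x + y) = s3_perm x \<otimes>\<^bsub>sym_group 3\<^esub> s3_perm y" for x y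
    by (simp add: s3_perm_add sym_group_mult)
  have inj: "inj s3_perm"
  proof (rule injI)
    fix x y assume "s3_perm x = s3_perm y"
    then have "s3_perm x 1 = s3_perm y 1 \<and> s3_perm x 2 = s3_perm y 2" by simp
    then show "x = y" by (cases x; cases y) auto
  qed
  have "s3_perm x permutes {1..3}" for x
    unfolding permutes_def
  proof (intro conjI allI impI)
    have "s3_perm x \<circ> s3_perm (- x) = id" "s3_perm (- x) \<circ> s3_perm x = id"
      by (simp_all flip: s3_perm_add) (auto simp: zero_s3_def fun_eq_iff)
    then have "bij (s3_perm x)" using o_bij by blast
    then show "\<exists>!n. s3_perm x n = m" for m by (simp add: bij_iff)
    show "s3_perm x n = n" if "n \<notin> {1..3}" for n
      using that by (cases x) auto
  qed
  then have sub: "range s3_perm \<subseteq> {p. p permutes {1..3::nat}}" by blast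
  \<comment> \<open>Both sets have 6 elements, so the inclusion is an equality.\<close>
  have "card (range s3_perm) = card (UNIV :: s3 set)" by (rule card_image[OF inj])
  also have "\<dots> = card {p. p permutes {1..3::nat}}"
    unfolding set_s3_list[symmetric] by (simp add: card_permutations s3_list_def fact_numeral)
  finally have "range s3_perm = {p. p permutes {1..3}}"
    by (intro card_subset_eq finite_permutations sub) auto
  then show "bij_betw s3_perm UNIV (carrier (sym_group 3))"
    using inj by (simp add: bij_betw_def sym_group_def)
qed


section \<open>The subgroups of the square of the symmetric group\<close>

text \<open>The three conjugacy classes of the group.\<close>

datatype s3_kind = Triv | Rot | Flip

fun kind :: "s3 \<Rightarrow> s3_kind" where
  "kind R0 = Triv" | "kind R1 = Rot" | "kind R2 = Rot" | "kind F0 = Flip" | "kind F1 = Flip" | "kind F2 = Flip"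

lemma kind_conj: "kind (x + y - x) = kind y"
  by (cases x; cases y) (simp_all add: minus_s3_def zero_s3_def)

type_synonym signature = "bool \<times> bool \<times> bool \<times> bool \<times> bool \<times> bool"

text \<open>Which conjugacy classes of pairs meet \<open>U\<close>. The kinds
  \<open>(Rot, Flip)\<close> and \<open>(Flip, Rot)\<close> are omitted: in a subgroup the third and
  fourth powers of such a pair isolate its two components, so the other kinds decide.\<close>

definition signature :: "(s3 \<times> s3) set \<Rightarrow> signature" where
  "signature U = (let has = (\<lambda>k. \<exists>u\<in>U. map_prod kind kind u = k) in
     (has (Rot, Triv), has (Triv, Rot), has (Rot, Rot), has (Flip, Triv), has (Triv, Flip), has (Flip, Flip)))"

lemma signature_conj_by: "signature (conj_by p U) = signature U"
proof -
  have "map_prod kind kind (p + u - p) = map_prod kind kind u" for u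
    by (cases p; cases u) (simp add: kind_conj)
  then show ?thesis by (simp add: signature_def conj_by_def)
qed

text \<open>In \<open>in_rep a b d d' f g h\<close> the first four arguments tell which of \<open>(R1, R0)\<close>, \<open>(R0, R1)\<close>, \<open>(R1, R1)\<close>,
  \<open>(R1, R2)\<close> belong to a subgroup, and the last three do this for \<open>(F0, R0)\<close>, \<open>(R0, F0)\<close>, \<open>(F0, F0)\<close>.\<close>

fun rot_in_rep :: "bool \<Rightarrow> bool \<Rightarrow> bool \<Rightarrow> bool \<Rightarrow> s3 \<Rightarrow> s3 \<Rightarrow> bool" where
  "rot_in_rep a b d d' x y = (if x = R0 then y = R0 \<or> b else if y = R0 then a else if x = y then d else d')"

fun in_rep :: "bool \<Rightarrow> bool \<Rightarrow> bool \<Rightarrow> bool \<Rightarrow> bool \<Rightarrow> bool \<Rightarrow> bool \<Rightarrow> s3 \<times> s3 \<Rightarrow> bool" where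
  "in_rep a b d d' f g h (x, y) =
    (if kind x = Flip then if kind y = Flip then h \<and> rot_in_rep a b d d' (x + F0) (y + F0)
       else f \<and> rot_in_rep a b d d' (x + F0) y
     else if kind y = Flip then g \<and> rot_in_rep a b d d' x (y + F0) else rot_in_rep a b d d' x y)"

text \<open>The bit for \<open>(R1, R2)\<close> is \<open>a \<and> b\<close>: a diagonal group of
  rotations is represented by the one through \<open>(R1, R1)\<close>, to which the one through
  \<open>(R1, R2)\<close> is conjugate.\<close>

fun rep_list :: "signature \<Rightarrow> (s3 \<times> s3) list" where
  "rep_list (a, b, d, f, g, h) = filter (in_rep a b d (a \<and> b) f g h) (List.product s3_list s3_list)"

text \<open>The images of the transitive bisets.  The table was found by lifting matrix units from the quotient
  by the radical: the 16 bisets $G/H \times K\backslash G$ span an ideal that is a Munn algebra whose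
  sandwich matrix, counting the double cosets $K\backslash G/H$, has rank 3 modulo 2.\<close>

definition val_table :: "(signature \<times> bit lam) list" where
  "val_table = [
  ((False, False, False, False, False, False), Lam 0 1 0 0 0 0 0 0 0 0 0 0 0 0 0 0 0 0 0 0 0 0),
  ((False, False, False, True, False, False), Lam 0 0 0 0 1 0 0 1 0 0 0 0 0 0 0 0 0 0 0 0 0 0),
  ((False, False, False, False, True, False), Lam 1 1 1 0 0 0 0 0 0 0 0 0 0 0 0 0 0 0 0 0 0 0),
  ((False, False, False, False, False, True), Lam 1 0 1 0 1 0 0 1 0 0 0 0 1 1 0 0 0 0 0 0 0 0),
  ((False, False, False, True, True, True), Lam 0 0 0 1 1 1 1 1 1 0 0 0 0 0 0 0 0 0 0 0 0 0),
  ((True, False, False, False, False, False), Lam 0 1 0 0 0 0 0 0 0 0 0 0 0 0 0 1 0 0 0 0 0 0),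
  ((True, False, False, True, False, False), Lam 0 0 0 0 1 0 0 0 0 0 0 0 0 0 0 0 0 0 0 0 0 0),
  ((True, False, False, False, True, False), Lam 1 1 1 0 0 0 0 0 0 0 0 0 0 0 1 1 1 0 0 0 0 0),
  ((True, False, False, False, False, True), Lam 1 0 1 0 1 0 0 0 0 0 0 0 1 1 1 0 1 1 0 0 0 1),
  ((True, False, False, True, True, True), Lam 0 0 0 1 1 1 0 0 0 0 0 0 0 0 0 0 0 0 0 0 0 0),
  ((False, True, False, False, False, False), Lam 0 1 0 0 0 0 0 0 0 1 0 0 0 0 0 0 0 0 0 0 0 0),
  ((False, True, False, True, False, False), Lam 0 0 0 0 1 0 0 1 0 0 1 1 0 0 0 0 0 0 0 0 0 0),
  ((False, True, False, False, True, False), Lam 1 1 0 0 0 0 0 0 0 0 0 0 0 0 0 0 0 0 0 0 0 0),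
  ((False, True, False, False, False, True), Lam 1 0 0 0 1 0 0 1 0 1 1 1 1 0 0 0 0 0 0 0 0 0),
  ((False, True, False, True, True, True), Lam 0 0 0 1 1 0 1 1 0 0 0 0 0 0 0 0 0 0 0 0 0 0),
  ((False, False, True, False, False, False), Lam 0 1 0 0 0 0 0 0 0 1 0 1 0 0 0 1 1 0 0 1 0 1),
  ((False, False, True, False, False, True), Lam 1 0 0 0 1 0 0 0 1 0 0 0 1 0 0 0 0 0 1 0 0 0),
  ((True, True, True, False, False, False), Lam 0 1 0 0 0 0 0 0 0 1 0 0 0 0 0 1 0 0 0 0 1 0),
  ((True, True, True, True, False, False), Lam 0 0 0 0 1 0 0 0 0 0 1 0 0 0 0 0 0 0 0 0 0 0),
  ((True, True, True, False, True, False), Lam 1 1 0 0 0 0 0 0 0 0 0 0 0 0 1 1 0 0 0 0 0 0),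
  ((True, True, True, False, False, True), Lam 1 0 0 0 1 0 0 0 0 1 1 0 1 0 1 0 0 1 0 0 1 0),
  ((True, True, True, True, True, True), Lam 0 0 0 1 1 0 0 0 0 0 0 0 0 0 0 0 0 0 0 0 0 0)]"

definition signatures :: "signature list" where "signatures = map fst val_table"

definition sig_val :: "signature \<Rightarrow> bit lam" where
  "sig_val s = (case map_of val_table s of None \<Rightarrow> 0 | Some x \<Rightarrow> x)"

definition s3_reps :: "(s3 \<times> s3) set set" where
  "s3_reps = (\<lambda>s. set (rep_list s)) ` set signatures"

text \<open>Closure under products: two of the three kinds of rotation pairs, or of flip pairs,
  produce the third. A one-sided flip conjugates \<open>(R1, R1)\<close> to \<open>(R1, R2)\<close>
  up to inversion, and these two together generate one-sided rotations.\<close>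

lemma mem_signatures:
  "(a, b, d, f, g, h) \<in> set signatures \<longleftrightarrow> (a \<and> b \<longrightarrow> d) \<and> (a \<and> d \<longrightarrow> b) \<and> (b \<and> d \<longrightarrow> a) \<and>
    (f \<and> g \<longrightarrow> h) \<and> (f \<and> h \<longrightarrow> g) \<and> (g \<and> h \<longrightarrow> f) \<and> ((f \<or> g) \<and> d \<longrightarrow> a)"
proof -
  have eq: "signatures = [(False, False, False, False, False, False),
    (False, False, False, True, False, False),
    (False, False, False, False, True, False),
    (False, False, False, False, False, True),
    (False, False, False, True, True, True),
    (True, False, False, False, False, False),
    (True, False, False, True, False, False),
    (True, False, False, False, True, False),
    (True, False, False, False, False, True),
    (True, False, False, True, True, True),
    (False, True, False, False, False, False),
    (False, True, False, True, False, False),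
    (False, True, False, False, True, False),
    (False, True, False, False, False, True),
    (False, True, False, True, True, True),
    (False, False, True, False, False, False),
    (False, False, True, False, False, True),
    (True, True, True, False, False, False),
    (True, True, True, True, False, False),
    (True, True, True, False, True, False),
    (True, True, True, False, False, True),
    (True, True, True, True, True, True)]"
    by (simp add: signatures_def val_table_def)
  show ?thesis
    unfolding eq by (cases a; cases b; cases d; cases f; cases g; cases h) simp_all
qed

lemma set_rep_list: "set (rep_list (a, b, d, f, g, h)) = {u. in_rep a b d (a \<and> b) f g h u}"
  by (auto simp: set_s3_list)

fun sig_list :: "(s3 \<times> s3) list \<Rightarrow> signature" where
  "sig_list l = (let has = (\<lambda>k. list_ex (\<lambda>u. map_prod kind kind u = k) l) in
     (has (Rot, Triv), has (Triv, Rot), has (Rot, Rot), has (Flip, Triv), has (Triv, Flip), has (Flip, Flip)))"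

lemma signature_set: "signature (set l) = sig_list l"
  by (simp add: signature_def list_ex_iff Let_def)

lemma sig_list_rep_list: "s \<in> set signatures \<Longrightarrow> sig_list (rep_list s) = s"
proof -
  have "list_all (\<lambda>s. sig_list (rep_list s) = s) signatures" by code_simp
  then show "s \<in> set signatures \<Longrightarrow> sig_list (rep_list s) = s" by (simp add: list_all_iff)
qed

lemma is_subgroup_rep_list: "s \<in> set signatures \<Longrightarrow> is_subgroup (set (rep_list s))"
proof -
  have "list_all (\<lambda>s. let l = rep_list s in List.member l (R0, R0) \<and>
      list_all (\<lambda>(x, y). List.member l (- x, - y) \<and> list_all (\<lambda>(x', y'). List.member l (x + x', y + y')) l) l) signatures"
    by code_simp
  then show "s \<in> set signatures \<Longrightarrow> is_subgroup (set (rep_list s))"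
    unfolding is_subgroup_def by (fastforce simp: list_all_iff Let_def zero_s3_def zero_prod_def)
qed

section \<open>Conjugating a subgroup to a representative\<close>

lemma mem_conj_by: "u \<in> conj_by p U \<longleftrightarrow> - p + u + p \<in> U"
proof
  assume "- p + u + p \<in> U"
  moreover have "u = p + (- p + u + p) - p" by (simp add: add.assoc)
  ultimately show "u \<in> conj_by p U" unfolding conj_by_def by blast
qed (auto simp: conj_by_def add.assoc)

lemma is_subgroup_conj_by:
  assumes "is_subgroup U"
  shows "is_subgroup (conj_by p U)"
proof -
  have "- p + (u + v) + p = (- p + u + p) + (- p + v + p)" "- p + - u + p = - (- p + u + p)" for u v
    by (simp_all add: add.assoc minus_add del: add_uminus_conv_diff)
  then show ?thesis
    using assms unfolding is_subgroup_def by (simp add: mem_conj_by del: add_uminus_conv_diff)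
qed

lemma conj_by_add: "conj_by p (conj_by q U) = conj_by (p + q) U"
  by (simp add: conj_by_def image_image add.assoc minus_add diff_conv_add_uminus del: add_uminus_conv_diff)

text \<open>Each pattern of flips occurring in \<open>U\<close> (left, right, both) is realized by
  \<open>F0\<close> in the flipped components and \<open>R0\<close> in the other one.\<close>

definition flips_normal :: "(s3 \<times> s3) set \<Rightarrow> bool" where
  "flips_normal U \<longleftrightarrow> (\<forall>(x, y)\<in>U. (kind x = Flip \<and> kind y \<noteq> Flip \<longrightarrow> (F0, R0) \<in> U) \<and>
     (kind x \<noteq> Flip \<and> kind y = Flip \<longrightarrow> (R0, F0) \<in> U) \<and> (kind x = Flip \<and> kind y = Flip \<longrightarrow> (F0, F0) \<in> U))"

lemma flip_conj: "kind x = Flip \<Longrightarrow> \<exists>z. - z + F0 + z = x"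
  by (cases x) (auto intro: exI[of _ R0] exI[of _ R1] exI[of _ R2])

text \<open>Tripling keeps flips and kills rotations, and doubling is an involution on rotations;
  this separates the components of a pair.\<close>

lemma s3_multiples:
  "kind x = Flip \<Longrightarrow> x + x + x = x" "kind x \<noteq> Flip \<Longrightarrow> x + x + x = R0"
  "kind x \<noteq> Flip \<Longrightarrow> x + x + (x + x) = x"
  by (cases x; simp)+

text \<open>Tripling a mixed pair leaves a one-sided flip. All flips are conjugate, and the two
  components are conjugated independently; the cases ensure that one choice of \<open>(p, q)\<close>
  serves all patterns that occur.\<close>

lemma ex_flips_normal:
  assumes U: "is_subgroup U"
  shows "\<exists>p. flips_normal (conj_by p U)"
proof -
  have add: "(x + x', y + y') \<in> U" if "(x, y) \<in> U" "(x', y') \<in> U" for x y x' y'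
    using U that unfolding is_subgroup_def by (metis add_Pair)
  have l: "(x, R0) \<in> U" if "(x, y) \<in> U" "kind x = Flip" "kind y \<noteq> Flip" for x y
  proof -
    have "x + x + x = x" "y + y + y = R0" using that by (simp_all only: s3_multiples not_False_eq_True)
    then show ?thesis using add[OF add[OF that(1) that(1)] that(1)] by simp
  qed
  have r: "(R0, y) \<in> U" if "(x, y) \<in> U" "kind x \<noteq> Flip" "kind y = Flip" for x y
  proof -
    have "x + x + x = R0" "y + y + y = y" using that by (simp_all only: s3_multiples not_False_eq_True)
    then show ?thesis using add[OF add[OF that(1) that(1)] that(1)] by simp
  qed
  have kind_add: "kind (x + y) = Flip \<longleftrightarrow> (kind x = Flip) \<noteq> (kind y = Flip)" for x y
    by (cases x; cases y) simp_all
  have kind_conj': "kind (- x + y + x) = kind y" for x y using kind_conj[of "- x" y] by simp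
  have normal: "flips_normal (conj_by (p, q) U)"
    if *: "\<And>x y. (x, y) \<in> U \<Longrightarrow> kind x = Flip \<Longrightarrow> kind y \<noteq> Flip \<Longrightarrow> (- p + F0 + p, R0) \<in> U"
      "\<And>x y. (x, y) \<in> U \<Longrightarrow> kind x \<noteq> Flip \<Longrightarrow> kind y = Flip \<Longrightarrow> (R0, - q + F0 + q) \<in> U"
      "\<And>x y. (x, y) \<in> U \<Longrightarrow> kind x = Flip \<Longrightarrow> kind y = Flip \<Longrightarrow> (- p + F0 + p, - q + F0 + q) \<in> U" for p q
  proof -
    have R0: "- z + R0 + z = R0" for z by (cases z) simp_all
    show ?thesis
      unfolding flips_normal_def
    proof (intro ballI, clarify, intro conjI impI)
      fix x y assume "(x, y) \<in> conj_by (p, q) U"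
      then have u: "(- p + x + p, - q + y + q) \<in> U" by (simp add: mem_conj_by)
      show "(F0, R0) \<in> conj_by (p, q) U" if "kind x = Flip \<and> kind y \<noteq> Flip"
        using *(1)[OF u] that by (simp add: mem_conj_by kind_conj' R0)
      show "(R0, F0) \<in> conj_by (p, q) U" if "kind x \<noteq> Flip \<and> kind y = Flip"
        using *(2)[OF u] that by (simp add: mem_conj_by kind_conj' R0)
      show "(F0, F0) \<in> conj_by (p, q) U" if "kind x = Flip \<and> kind y = Flip"
        using *(3)[OF u] that by (simp add: mem_conj_by kind_conj')
    qed
  qed
  consider (both) x y where "(x, R0) \<in> U" "kind x = Flip" "(R0, y) \<in> U" "kind y = Flip"
    | (left) x where "(x, R0) \<in> U" "kind x = Flip" "\<nexists>x y. (x, y) \<in> U \<and> kind x \<noteq> Flip \<and> kind y = Flip"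
    | (right) y where "(R0, y) \<in> U" "kind y = Flip" "\<nexists>x y. (x, y) \<in> U \<and> kind x = Flip \<and> kind y \<noteq> Flip"
    | (neither) "\<nexists>x y. (x, y) \<in> U \<and> kind x \<noteq> Flip \<and> kind y = Flip" "\<nexists>x y. (x, y) \<in> U \<and> kind x = Flip \<and> kind y \<noteq> Flip"
    using l r by metis
  then show ?thesis
  proof cases
    case both
    obtain p q where "- p + F0 + p = x" "- q + F0 + q = y" using flip_conj both by metis
    then show ?thesis using normal[of p q] both add[OF both(1,3)] by (auto simp: zero_s3_def[symmetric])
  next
    case left
    \<comment> \<open>The product of \<open>(x, R0)\<close> with a two-sided flip would be a flip on
      the right only, which is excluded here.\<close>
    have "\<not> (kind x' = Flip \<and> kind y' = Flip)" if "(x', y') \<in> U" for x' y'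
      using add[OF left(1) that] left(2,3) kind_add[of x x'] kind_add[of R0 y'] by auto
    moreover obtain p where "- p + F0 + p = x" using flip_conj left by metis
    ultimately show ?thesis using normal[of p 0] left by blast
  next
    case right
    have "\<not> (kind x' = Flip \<and> kind y' = Flip)" if "(x', y') \<in> U" for x' y'
      using add[OF right(1) that] right(2,3) kind_add[of y y'] kind_add[of R0 x'] by auto
    moreover obtain q where "- q + F0 + q = y" using flip_conj right by metis
    ultimately show ?thesis using normal[of 0 q] right by blast
  next
    case neither
    show ?thesis
    proof (cases "\<exists>x y. (x, y) \<in> U \<and> kind x = Flip \<and> kind y = Flip")
      case True
      then obtain x y where xy: "(x, y) \<in> U" "kind x = Flip" "kind y = Flip" by blast
      obtain p q where "- p + F0 + p = x" "- q + F0 + q = y" using flip_conj xy by metis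
      then show ?thesis using normal[of p q] neither xy by blast
    next
      case False
      then show ?thesis using normal[of 0 0] neither by blast
    qed
  qed
qed

text \<open>Adding the standard flip pair reduces membership to pairs of rotations. There a pair and
  its double belong together, so \<open>(R1, R0)\<close>, \<open>(R0, R1)\<close>,
  \<open>(R1, R1)\<close> and \<open>(R1, R2)\<close> test the four subgroups of order 3.\<close>

lemma member_normal:
  assumes U: "is_subgroup U" and n: "flips_normal U"
  shows "u \<in> U \<longleftrightarrow> in_rep ((R1, R0) \<in> U) ((R0, R1) \<in> U) ((R1, R1) \<in> U) ((R1, R2) \<in> U)
    ((F0, R0) \<in> U) ((R0, F0) \<in> U) ((F0, F0) \<in> U) u"
proof -
  have zero: "(R0, R0) \<in> U" using U by (simp add: is_subgroup_def zero_prod_def zero_s3_def)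
  have add: "(x + x', y + y') \<in> U" if "(x, y) \<in> U" "(x', y') \<in> U" for x y x' y'
    using U that unfolding is_subgroup_def by (metis add_Pair)
  have double: "(x + x, y + y) \<in> U \<longleftrightarrow> (x, y) \<in> U" if "kind x \<noteq> Flip" "kind y \<noteq> Flip" for x y
  proof
    assume 2: "(x + x, y + y) \<in> U"
    have "(x + x + (x + x), y + y + (y + y)) \<in> U" by (rule add[OF 2 2])
    moreover have "x + x + (x + x) = x" "y + y + (y + y) = y" using that by (simp_all only: s3_multiples not_False_eq_True)
    ultimately show "(x, y) \<in> U" by (simp only:)
  qed (rule add)
  have rot: "(x, y) \<in> U \<longleftrightarrow> rot_in_rep ((R1, R0) \<in> U) ((R0, R1) \<in> U) ((R1, R1) \<in> U) ((R1, R2) \<in> U) x y"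
    if "kind x \<noteq> Flip" "kind y \<noteq> Flip" for x y
    using that double[of R1 R0] double[of R0 R1] double[of R1 R1] double[of R1 R2] zero
    by (cases x; cases y) simp_all
  have shift: "(x, y) \<in> U \<longleftrightarrow> (f, g) \<in> U \<and> (x + f, y + g) \<in> U"
    if "(x, y) \<in> U \<Longrightarrow> (f, g) \<in> U" "f + f = R0" "g + g = R0" for x y f g
  proof -
    have "x + f + f = x" "y + g + g = y" using that(2,3) by (simp_all add: add.assoc flip: zero_s3_def)
    then show ?thesis using add[of x y f g] add[of "x + f" "y + g" f g] that(1) by metis
  qed
  have kind: "kind (x + F0) \<noteq> Flip \<longleftrightarrow> kind x = Flip" for x by (cases x) simp_all
  obtain x y where [simp]: "u = (x, y)" by (cases u)
  have R0: "z + R0 = z" for z by (cases z) simp_all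
  show ?thesis
  proof (cases "kind x = Flip"; cases "kind y = Flip")
    assume *: "kind x = Flip" "kind y = Flip"
    then have "(x, y) \<in> U \<Longrightarrow> (F0, F0) \<in> U" using n unfolding flips_normal_def by blast
    then show ?thesis using shift[of x y F0 F0] rot[of "x + F0" "y + F0"] * kind by (simp del: rot_in_rep.simps)
  next
    assume *: "kind x = Flip" "kind y \<noteq> Flip"
    then have "(x, y) \<in> U \<Longrightarrow> (F0, R0) \<in> U" using n unfolding flips_normal_def by blast
    then show ?thesis using shift[of x y F0 R0] rot[of "x + F0" y] * kind by (simp add: R0 del: rot_in_rep.simps)
  next
    assume *: "kind x \<noteq> Flip" "kind y = Flip"
    then have "(x, y) \<in> U \<Longrightarrow> (R0, F0) \<in> U" using n unfolding flips_normal_def by blast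
    then show ?thesis using shift[of x y R0 F0] rot[of x "y + F0"] * kind by (simp add: R0 del: rot_in_rep.simps)
  next
    assume *: "kind x \<noteq> Flip" "kind y \<noteq> Flip"
    then show ?thesis using rot[of x y] by (simp del: rot_in_rep.simps)
  qed
qed

text \<open>After normalization seven membership bits determine the subgroup. Closure leaves the
  listed signatures, or the case that \<open>(R1, R2)\<close> generates the rotations, which one
  more conjugation removes.\<close>

lemma subgroup_conj_rep:
  assumes "is_subgroup U"
  shows "\<exists>p. conj_by p U \<in> s3_reps"
proof -
  obtain p where "flips_normal (conj_by p U)" using ex_flips_normal[OF assms] by blast
  define V where "V = conj_by p U"
  have V: "is_subgroup V" "flips_normal V"
    using is_subgroup_conj_by[OF assms] \<open>flips_normal _\<close> by (simp_all add: V_def)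
  define a b d d' f g h where defs: "a = ((R1, R0) \<in> V)" "b = ((R0, R1) \<in> V)" "d = ((R1, R1) \<in> V)" "d' = ((R1, R2) \<in> V)"
    "f = ((F0, R0) \<in> V)" "g = ((R0, F0) \<in> V)" "h = ((F0, F0) \<in> V)"
  have mem: "u \<in> V \<longleftrightarrow> in_rep a b d d' f g h u" for u
    unfolding defs by (rule member_normal[OF V])
  have add: "in_rep a b d d' f g h (x + x', y + y')"
    if "in_rep a b d d' f g h (x, y)" "in_rep a b d d' f g h (x', y')" for x y x' y'
    using V(1) that unfolding is_subgroup_def mem[symmetric] by (metis add_Pair)
  have ab: "a \<and> b \<longrightarrow> d" "a \<and> d \<longrightarrow> b" "b \<and> d \<longrightarrow> a" "a \<and> b \<longrightarrow> d'" "d \<and> d' \<longrightarrow> a"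
    "a \<and> d' \<longrightarrow> b" "b \<and> d' \<longrightarrow> a"
    using add[of R1 R0 R0 R1, simplified] add[of R2 R0 R1 R1, simplified] add[of R0 R2 R1 R1, simplified] add[of R1 R0 R0 R2, simplified] add[of R1 R1 R1 R2, simplified]
      add[of R2 R0 R1 R2, simplified] add[of R0 R1 R1 R2, simplified] by blast+
  have fgh: "f \<and> g \<longrightarrow> h" "f \<and> h \<longrightarrow> g" "g \<and> h \<longrightarrow> f"
    using add[of F0 R0 R0 F0, simplified] add[of F0 R0 F0 F0, simplified] add[of R0 F0 F0 F0, simplified] by blast+
  \<comment> \<open>A one-sided flip conjugates \<open>(R1, R1)\<close> to \<open>(R1, R2)\<close>
    up to inversion, and conversely.\<close>
  have fd: "f \<and> d \<longrightarrow> d'" "f \<and> d' \<longrightarrow> d" "g \<and> d \<longrightarrow> d'" "g \<and> d' \<longrightarrow> d"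
    using add[OF add[of F0 R0 R1 R1], of F0 R0, simplified] add[OF add[of F0 R0 R1 R2], of F0 R0, simplified]
      add[OF add[of R0 F0 R1 R1], of R0 F0, simplified] add[OF add[of R0 F0 R1 R2], of R0 F0, simplified] by blast+
  have sig: "(a, b, d, f, g, h) \<in> set signatures" if "d' \<longleftrightarrow> a \<and> b"
    using that ab fgh fd unfolding mem_signatures by argo
  show ?thesis
  proof (cases "d' \<longleftrightarrow> a \<and> b")
    case True
    then have "V = set (rep_list (a, b, d, f, g, h))" using mem unfolding set_rep_list by blast
    then show ?thesis using sig[OF True] unfolding s3_reps_def V_def by blast
  next
    case False
    then have F: "d'" "\<not> a" "\<not> b" "\<not> d" "\<not> f" "\<not> g" using ab fd by argo+
    \<comment> \<open>Conjugation by \<open>(F0, R0)\<close> inverts the rotation in the first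
      component, turning the group generated by \<open>(R1, R2)\<close> into that of
      \<open>(R1, R1)\<close>, and fixes \<open>(F0, F0)\<close>.\<close>
    have "u \<in> conj_by (F0, R0) V \<longleftrightarrow> in_rep False False True False False False h u" for u
    proof -
      obtain x y where [simp]: "u = (x, y)" by (cases u)
      show ?thesis
        unfolding mem_conj_by mem using F by (cases x; cases y) simp_all
    qed
    then have "conj_by (F0, R0) V = set (rep_list (False, False, True, False, False, h))"
      unfolding set_rep_list by auto
    moreover have "(False, False, True, False, False, h) \<in> set signatures"
      unfolding mem_signatures by blast
    ultimately show ?thesis unfolding s3_reps_def V_def conj_by_add by blast
  qed
qed

section \<open>Evaluation of Mackey's formula\<close>

definition comp_list :: "s3 \<Rightarrow> (s3 \<times> s3) list \<Rightarrow> (s3 \<times> s3) list \<Rightarrow> (s3 \<times> s3) list" where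
  "comp_list t L M = concat (map (\<lambda>(x, y). let w = t + y - t in
     map (\<lambda>(_, z). (x, z)) (filter (\<lambda>(w', _). w = w') M)) L)"

lemma set_comp_list: "set (comp_list t L M) = conj_by (0, t) (set L) O set M"
proof -
  have "(x, z) \<in> set (comp_list t L M) \<longleftrightarrow> (\<exists>y. (x, y) \<in> set L \<and> (t + y - t, z) \<in> set M)" for x z
    by (force simp: comp_list_def Let_def)
  moreover have "(x, w) \<in> conj_by (0, t) (set L) \<longleftrightarrow> (\<exists>y. (x, y) \<in> set L \<and> w = t + y - t)" for x w
    by (force simp: conj_by_def)
  ultimately have "(x, z) \<in> set (comp_list t L M) \<longleftrightarrow> (\<exists>w. (x, w) \<in> conj_by (0, t) (set L) \<and> (w, z) \<in> set M)" for x z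
    by (simp only:) blast
  then have "u \<in> set (comp_list t L M) \<longleftrightarrow> u \<in> conj_by (0, t) (set L) O set M" for u
    by (cases u) (simp only: relcomp.simps, blast)
  then show ?thesis by blast
qed

definition same_double_coset :: "(s3 \<times> s3) list \<Rightarrow> (s3 \<times> s3) list \<Rightarrow> s3 \<Rightarrow> s3 \<Rightarrow> bool" where
  "same_double_coset L M t t' \<longleftrightarrow>
     (let Y = remdups (map snd L) in list_ex (\<lambda>k. list_ex (\<lambda>y. t' = k + t + y) Y) (remdups (map fst M)))"

lemma same_double_coset: "same_double_coset L M t t' \<longleftrightarrow> t' \<in> double_coset (set L) (set M) t"
  unfolding same_double_coset_def double_coset_def Domain_fst Range_snd
  by (auto simp: list_ex_iff Let_def)

text \<open>Evaluation of the product table: the equations below only apply to constructor terms, so that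
  the simplifier does not unfold sums and products before their arguments are evaluated.\<close>

lemma lam_add_mult_code [code]:
  "Lam s11 s12 s13 s21 s22 s23 s31 s32 s33 t1 t2 t3 u v x1 x2 x3 y a b c d + Lam s11' s12' s13' s21' s22' s23' s31' s32' s33' t1' t2' t3' u' v' x1' x2' x3' y' a' b' c' d' =
    Lam (s11 + s11') (s12 + s12') (s13 + s13') (s21 + s21') (s22 + s22')
      (s23 + s23') (s31 + s31') (s32 + s32') (s33 + s33') (t1 + t1')
      (t2 + t2') (t3 + t3') (u + u') (v + v') (x1 + x1')
      (x2 + x2') (x3 + x3') (y + y') (a + a') (b + b')
      (c + c') (d + d')"
  "Lam s11 s12 s13 s21 s22 s23 s31 s32 s33 t1 t2 t3 u v x1 x2 x3 y a b c d * Lam s11' s12' s13' s21' s22' s23' s31' s32' s33' t1' t2' t3' u' v' x1' x2' x3' y' a' b' c' d' =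
    Lam (s11 * s11' + s12 * s21' + s13 * s31')
      (s11 * s12' + s12 * s22' + s13 * s32')
      (s11 * s13' + s12 * s23' + s13 * s33')
      (s21 * s11' + s22 * s21' + s23 * s31')
      (s21 * s12' + s22 * s22' + s23 * s32')
      (s21 * s13' + s22 * s23' + s23 * s33')
      (s31 * s11' + s32 * s21' + s33 * s31')
      (s31 * s12' + s32 * s22' + s33 * s32')
      (s31 * s13' + s32 * s23' + s33 * s33')
      (s11 * t1' + s12 * t2' + s13 * t3' + t1 * a')
      (s21 * t1' + s22 * t2' + s23 * t3' + t2 * a')
      (s31 * t1' + s32 * t2' + s33 * t3' + t3 * a')
      (u * u')
      (u * v' + v * a')
      (x1 * s11' + x2 * s21' + x3 * s31' + a * x1')
      (x1 * s12' + x2 * s22' + x3 * s32' + a * x2')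
      (x1 * s13' + x2 * s23' + x3 * s33' + a * x3')
      (y * u' + a * y')
      (a * a')
      (a * b' + b * a')
      (a * c' + c * a' + b * b' + x1 * t1' + x2 * t2' + x3 * t3')
      (a * d' + d * a' + y * v')"
  by (simp_all add: plus_lam_def times_lam_def)

definition comp_val :: "(s3 \<times> s3) list \<Rightarrow> (s3 \<times> s3) list \<Rightarrow> s3 \<Rightarrow> bit lam" where
  "comp_val L M t = sig_val (sig_list (comp_list t L M))"

text \<open>Carries the value along with the representative, so that \<open>mult_ok\<close> receives
  lists and coordinates instead of signatures.\<close>

definition rep_entry :: "signature \<Rightarrow> (s3 \<times> s3) list \<times> bit lam" where
  "rep_entry s = (rep_list s, sig_val s)"

fun mult_ok :: "(s3 \<times> s3) list \<times> bit lam \<Rightarrow> (s3 \<times> s3) list \<times> bit lam \<Rightarrow> bool" where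
  "mult_ok (L, x) (M, x') \<longleftrightarrow> x * x' = fib_sum_list (same_double_coset L M) (comp_val L M) s3_list"

definition mult_row_ok where "mult_row_ok T p \<longleftrightarrow> list_all (mult_ok p) T"

text \<open>The 22 * 22 instances of Mackey's formula, by evaluation; here the entries of
  \<open>val_table\<close> are tested for multiplicativity.\<close>

lemma sig_val_mult:
  assumes "s \<in> set signatures" "s' \<in> set signatures"
  shows "sig_val s * sig_val s' =
    fib_sum_list (same_double_coset (rep_list s) (rep_list s')) (comp_val (rep_list s) (rep_list s')) s3_list"
proof -
  have "list_all (mult_row_ok (map rep_entry signatures)) (map rep_entry signatures)"
    by code_simp
  then show ?thesis using assms by (simp add: list_all_iff mult_row_ok_def rep_entry_def)
qed

definition s3_val :: "(s3 \<times> s3) set \<Rightarrow> bit lam" where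
  "s3_val U = sig_val (signature U)"

lemma s3_val_conj_by: "s3_val (conj_by p U) = s3_val U"
  by (simp add: s3_val_def signature_conj_by)

lemma s3_val_mult:
  assumes "U \<in> s3_reps" "V \<in> s3_reps"
  shows "s3_val U * s3_val V = fib_sum UNIV (double_coset U V) (\<lambda>t. s3_val (conj_by (0, t) U O V))"
proof -
  obtain s s' where s: "s \<in> set signatures" "U = set (rep_list s)" "s' \<in> set signatures" "V = set (rep_list s')"
    using assms unfolding s3_reps_def by blast
  note sub = is_subgroup_rep_list[OF s(1), folded s(2)] is_subgroup_rep_list[OF s(3), folded s(4)]
  \<comment> \<open>Equal double cosets give conjugate composites, and these have the same
    value.\<close>
  have const: "fib_const (set s3_list) (double_coset U V) (\<lambda>t. s3_val (conj_by (0, t) U O V))"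
    unfolding fib_const_def using double_coset_conj[OF sub] double_coset_eq_iff[OF sub] s3_val_conj_by by metis
  have "fib_sum (set s3_list) (double_coset U V) (\<lambda>t. s3_val (conj_by (0, t) U O V)) =
    fib_sum_list (same_double_coset (rep_list s) (rep_list s')) (\<lambda>t. s3_val (conj_by (0, t) U O V)) s3_list"
    by (rule fib_sum_list[OF _ const]) (simp add: same_double_coset double_coset_eq_iff[OF sub] flip: s(2,4))
  also have "\<dots> = sig_val s * sig_val s'"
    unfolding sig_val_mult[OF s(1,3)] by (simp add: s3_val_def s signature_set comp_val_def[abs_def] flip: set_comp_list)
  finally show ?thesis
    by (simp add: set_s3_list s3_val_def s(2,4) signature_set sig_list_rep_list s(1,3) del: sig_list.simps)
qed


section \<open>The basis of bisets\<close>

definition lam_coords :: "'k lam \<Rightarrow> 'k list" where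
  "lam_coords x = [c_s11 x, c_s12 x, c_s13 x, c_s21 x, c_s22 x, c_s23 x, c_s31 x, c_s32 x, c_s33 x, c_t1 x, c_t2 x, c_t3 x, c_u x, c_v x, c_x1 x, c_x2 x, c_x3 x, c_y x, c_a x, c_b x, c_c x, c_d x]"

definition lam_units :: "bit lam list" where
  "lam_units = [
  Lam 1 0 0 0 0 0 0 0 0 0 0 0 0 0 0 0 0 0 0 0 0 0,
  Lam 0 1 0 0 0 0 0 0 0 0 0 0 0 0 0 0 0 0 0 0 0 0,
  Lam 0 0 1 0 0 0 0 0 0 0 0 0 0 0 0 0 0 0 0 0 0 0,
  Lam 0 0 0 1 0 0 0 0 0 0 0 0 0 0 0 0 0 0 0 0 0 0,
  Lam 0 0 0 0 1 0 0 0 0 0 0 0 0 0 0 0 0 0 0 0 0 0,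
  Lam 0 0 0 0 0 1 0 0 0 0 0 0 0 0 0 0 0 0 0 0 0 0,
  Lam 0 0 0 0 0 0 1 0 0 0 0 0 0 0 0 0 0 0 0 0 0 0,
  Lam 0 0 0 0 0 0 0 1 0 0 0 0 0 0 0 0 0 0 0 0 0 0,
  Lam 0 0 0 0 0 0 0 0 1 0 0 0 0 0 0 0 0 0 0 0 0 0,
  Lam 0 0 0 0 0 0 0 0 0 1 0 0 0 0 0 0 0 0 0 0 0 0,
  Lam 0 0 0 0 0 0 0 0 0 0 1 0 0 0 0 0 0 0 0 0 0 0,
  Lam 0 0 0 0 0 0 0 0 0 0 0 1 0 0 0 0 0 0 0 0 0 0,
  Lam 0 0 0 0 0 0 0 0 0 0 0 0 1 0 0 0 0 0 0 0 0 0,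
  Lam 0 0 0 0 0 0 0 0 0 0 0 0 0 1 0 0 0 0 0 0 0 0,
  Lam 0 0 0 0 0 0 0 0 0 0 0 0 0 0 1 0 0 0 0 0 0 0,
  Lam 0 0 0 0 0 0 0 0 0 0 0 0 0 0 0 1 0 0 0 0 0 0,
  Lam 0 0 0 0 0 0 0 0 0 0 0 0 0 0 0 0 1 0 0 0 0 0,
  Lam 0 0 0 0 0 0 0 0 0 0 0 0 0 0 0 0 0 1 0 0 0 0,
  Lam 0 0 0 0 0 0 0 0 0 0 0 0 0 0 0 0 0 0 1 0 0 0,
  Lam 0 0 0 0 0 0 0 0 0 0 0 0 0 0 0 0 0 0 0 1 0 0,
  Lam 0 0 0 0 0 0 0 0 0 0 0 0 0 0 0 0 0 0 0 0 1 0,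
  Lam 0 0 0 0 0 0 0 0 0 0 0 0 0 0 0 0 0 0 0 0 0 1]"

text \<open>The row of a signature lists its coefficients in the expansions of \<^const>\<open>lam_units\<close> in terms of
  \<^const>\<open>sig_val\<close>.\<close>

definition coef_table :: "(signature \<times> bit list) list" where
  "coef_table = [
  ((False, False, False, False, False, False), [1, 1, 0, 0, 0, 0, 0, 0, 0, 1, 0, 0, 0, 1, 1, 1, 0, 0, 1, 0, 1, 1]),
  ((False, False, False, True, False, False), [0, 0, 0, 0, 0, 0, 1, 1, 0, 0, 0, 1, 0, 1, 0, 0, 0, 0, 0, 0, 0, 1]),
  ((False, False, False, False, True, False), [0, 0, 1, 0, 0, 0, 0, 0, 0, 0, 0, 0, 0, 1, 0, 0, 1, 0, 0, 0, 0, 1]),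
  ((False, False, False, False, False, True), [0, 0, 0, 0, 0, 0, 0, 0, 0, 0, 0, 0, 0, 1, 0, 0, 0, 0, 0, 1, 0, 1]),
  ((False, False, False, True, True, True), [0, 0, 0, 0, 0, 0, 0, 0, 1, 0, 0, 0, 0, 0, 0, 0, 0, 0, 1, 0, 0, 0]),
  ((True, False, False, False, False, False), [0, 0, 0, 0, 0, 0, 0, 0, 0, 0, 0, 0, 0, 0, 1, 1, 0, 0, 0, 0, 1, 1]),
  ((True, False, False, True, False, False), [0, 0, 0, 1, 1, 0, 1, 1, 0, 0, 1, 1, 0, 0, 0, 0, 0, 0, 1, 0, 0, 1]),
  ((True, False, False, False, True, False), [0, 0, 0, 0, 0, 0, 0, 0, 0, 0, 0, 0, 0, 0, 0, 0, 1, 0, 0, 0, 0, 1]),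
  ((True, False, False, False, False, True), [0, 0, 0, 0, 0, 0, 0, 0, 0, 0, 0, 0, 0, 0, 0, 0, 0, 0, 0, 1, 0, 1]),
  ((True, False, False, True, True, True), [0, 0, 0, 0, 0, 1, 0, 0, 1, 0, 0, 0, 0, 0, 0, 0, 0, 0, 1, 0, 0, 0]),
  ((False, True, False, False, False, False), [0, 0, 0, 0, 0, 0, 0, 0, 0, 1, 0, 0, 1, 1, 0, 0, 0, 1, 1, 0, 1, 1]),
  ((False, True, False, True, False, False), [0, 0, 0, 0, 0, 0, 0, 0, 0, 0, 0, 1, 1, 1, 0, 0, 0, 1, 1, 0, 0, 1]),
  ((False, True, False, False, True, False), [1, 0, 1, 0, 0, 0, 0, 0, 0, 0, 0, 0, 1, 1, 1, 0, 1, 1, 0, 0, 0, 1]),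
  ((False, True, False, False, False, True), [0, 0, 0, 0, 0, 0, 0, 0, 0, 0, 0, 0, 1, 1, 0, 0, 0, 1, 1, 1, 0, 1]),
  ((False, True, False, True, True, True), [0, 0, 0, 0, 0, 0, 1, 0, 1, 0, 0, 0, 0, 0, 0, 0, 0, 0, 1, 0, 0, 0]),
  ((False, False, True, False, False, False), [0, 0, 0, 0, 0, 0, 0, 0, 0, 0, 0, 0, 0, 0, 0, 0, 0, 0, 0, 1, 0, 0]),
  ((False, False, True, False, False, True), [0, 0, 0, 0, 0, 0, 0, 0, 0, 0, 0, 0, 0, 0, 0, 0, 0, 0, 1, 0, 0, 0]),
  ((True, True, True, False, False, False), [0, 0, 0, 0, 0, 0, 0, 0, 0, 0, 0, 0, 0, 0, 0, 0, 0, 1, 0, 1, 1, 1]),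
  ((True, True, True, True, False, False), [0, 0, 0, 0, 0, 0, 0, 0, 0, 0, 1, 1, 0, 0, 0, 0, 0, 1, 0, 0, 0, 1]),
  ((True, True, True, False, True, False), [0, 0, 0, 0, 0, 0, 0, 0, 0, 0, 0, 0, 0, 0, 1, 0, 1, 1, 0, 0, 0, 1]),
  ((True, True, True, False, False, True), [0, 0, 0, 0, 0, 0, 0, 0, 0, 0, 0, 0, 0, 0, 0, 0, 0, 1, 0, 1, 0, 1]),
  ((True, True, True, True, True, True), [0, 0, 0, 1, 0, 1, 1, 0, 1, 0, 0, 0, 0, 0, 0, 0, 0, 0, 1, 0, 0, 0])]"

text \<open>The row of \<open>s\<close> as a linear functional; these functionals form the dual
  basis of the values of the signatures.\<close>

definition sig_coef :: "bit lam \<Rightarrow> signature \<Rightarrow> bit" where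
  "sig_coef x s = sum_list (map2 (*) (lam_coords x) (case map_of coef_table s of None \<Rightarrow> [] | Some r \<Rightarrow> r))"

lemma lam_coords_add: "lam_coords (x + y) = map2 (+) (lam_coords x) (lam_coords y)"
  by (simp add: lam_coords_def plus_lam_def)

lemma sum_list_map2_add:
  "length l = length l' \<Longrightarrow> sum_list (map2 (*) (map2 (+) l l') r) = sum_list (map2 (*) l r) + sum_list (map2 (*) l' r)"
  for l :: "'k::comm_ring_1 list"
proof (induction l l' arbitrary: r rule: list_induct2)
  case (Cons x l y l')
  then show ?case by (cases r) (simp_all add: algebra_simps)
qed simp

lemma sig_coef_add: "sig_coef (x + y) s = sig_coef x s + sig_coef y s"
  unfolding sig_coef_def lam_coords_add
  by (rule sum_list_map2_add) (simp add: lam_coords_def)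

lemma sig_coef_sig_val:
  "s \<in> set signatures \<Longrightarrow> s' \<in> set signatures \<Longrightarrow> sig_coef (sig_val s) s' = (if s = s' then 1 else 0)"
proof -
  have "list_all (\<lambda>s. let x = sig_val s in list_all (\<lambda>s'. sig_coef x s' = (if s = s' then 1 else 0)) signatures) signatures"
    by code_simp
  then show "s \<in> set signatures \<Longrightarrow> s' \<in> set signatures \<Longrightarrow> sig_coef (sig_val s) s' = (if s = s' then 1 else 0)"
    by (simp add: list_all_iff Let_def)
qed

definition expand :: "bit lam \<Rightarrow> bit lam" where
  "expand x = sum_list (map (\<lambda>s. if sig_coef x s = 0 then 0 else sig_val s) signatures)"

lemma expand_add: "expand (x + y) = expand x + expand y"
proof -
  have "(if k + l = 0 then 0 else z) = (if k = 0 then 0 else z) + (if l = 0 then 0 else z)" for k l :: bit and z :: "bit lam"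
    by (cases k; cases l) (simp_all add: lam_bit_add_self)
  then show ?thesis
    unfolding expand_def sig_coef_add by (simp add: sum_list_addf del: add_bit_eq_xor)
qed

lemma sum_lam_units: "sum_list (map2 (\<lambda>k z. if k = 1 then z else 0) (lam_coords x) lam_units) = x"
  unfolding lam_if
  by (simp add: lam_units_def lam_coords_def lam_defs del: add_bit_eq_xor mult_bit_eq_and)

text \<open>By linearity it suffices to evaluate on the 22 coordinate vectors. Together with
  \<open>sig_coef_sig_val\<close> this makes the values of the signatures a basis.\<close>

lemma expand: "expand x = x"
proof -
  have zero: "expand 0 = 0" using expand_add[of 0 0] by simp
  have units: "list_all (\<lambda>z. expand z = z) lam_units" by code_simp
  have "expand (sum_list (map2 (\<lambda>k z. if k = 1 then z else 0) l U)) = sum_list (map2 (\<lambda>k z. if k = 1 then z else 0) l U)"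
    if "list_all (\<lambda>z. expand z = z) U" for l :: "bit list" and U
    using that
  proof (induction U arbitrary: l)
    case (Cons z U)
    then show ?case by (cases l) (auto simp: zero expand_add)
  qed (simp add: zero)
  from this[OF units, of "lam_coords x"] show ?thesis unfolding sum_lam_units .
qed

lemma signature_rep_list: "s \<in> set signatures \<Longrightarrow> signature (set (rep_list s)) = s"
  unfolding signature_set by (rule sig_list_rep_list)

lemma burnside_rep_s3: "burnside_rep (sym_group 3) s3_perm s3_val s3_reps (\<lambda>x U. sig_coef x (signature U))"
proof (intro burnside_rep.intro coded_sym_group_3 burnside_rep_axioms.intro)
  show "s3_val {(x, x) |x. True} = 1"
  proof -
    have eq: "{(x, x) |x. True} = set (rep_list (False, False, True, False, False, True))"
      (is "?D = set ?l")
    proof (intro Set.set_eqI iffI)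
      fix u :: "s3 \<times> s3"
      obtain x y where [simp]: "u = (x, y)" by (cases u)
      show "u \<in> ?D \<Longrightarrow> u \<in> set ?l" "u \<in> set ?l \<Longrightarrow> u \<in> ?D"
        unfolding set_rep_list by (cases x; cases y; simp)+
    qed
    have "signature {(x, x) |x. True} = (False, False, True, False, False, True)"
      unfolding eq by (rule signature_rep_list) (simp add: mem_signatures)
    then show ?thesis by (simp add: s3_val_def sig_val_def val_table_def one_lam_def)
  qed
  show "finite s3_reps" by (simp add: s3_reps_def)
  show "is_subgroup U" if "U \<in> s3_reps" for U
    using that is_subgroup_rep_list unfolding s3_reps_def by blast
  show "sig_coef (s3_val U) (signature V) = (if U = V then 1 else 0)" if UV: "U \<in> s3_reps" "V \<in> s3_reps" for U V
  proof -
    obtain s s' where s: "s \<in> set signatures" "U = set (rep_list s)" "s' \<in> set signatures" "V = set (rep_list s')"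
      using UV unfolding s3_reps_def by blast
    then have "signature U = s" "signature V = s'" using signature_rep_list by auto
    then show ?thesis using s sig_coef_sig_val[OF s(1,3)] by (auto simp: s3_val_def)
  qed
  show "(\<Sum>U\<in>s3_reps. if sig_coef x (signature U) = 0 then 0 else s3_val U) = x" for x
  proof -
    have "(\<Sum>U\<in>s3_reps. if sig_coef x (signature U) = 0 then 0 else s3_val U) =
        (\<Sum>s\<in>set signatures. if sig_coef x s = 0 then 0 else sig_val s)"
    proof -
      \<comment> \<open>The signature recovers the index of a representative.\<close>
      have "inj_on (\<lambda>s. set (rep_list s)) (set signatures)"
        by (rule inj_on_inverseI[of _ signature]) (rule signature_rep_list)
      then have "(\<Sum>U\<in>s3_reps. if sig_coef x (signature U) = 0 then 0 else s3_val U) =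
          (\<Sum>s\<in>set signatures. if sig_coef x (signature (set (rep_list s))) = 0 then 0 else s3_val (set (rep_list s)))"
        unfolding s3_reps_def by (simp only: sum.reindex o_def)
      also have "\<dots> = (\<Sum>s\<in>set signatures. if sig_coef x s = 0 then 0 else sig_val s)"
        by (rule sum.cong[OF refl]) (simp only: s3_val_def signature_rep_list)
      finally show ?thesis .
    qed
    also have "\<dots> = expand x"
    proof -
      have "distinct signatures" by code_simp
      then show ?thesis unfolding expand_def by (simp add: sum_list_distinct_conv_sum_set)
    qed
    finally show ?thesis by (simp add: expand)
  qed
qed (rule lam_bit_add_self s3_val_conj_by subgroup_conj_rep s3_val_mult sig_coef_add; assumption?)+

lemma finite_bit_lam: "finite (UNIV :: bit lam set)"
proof (rule finite_imageD[of lam_coords])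
  have "finite (UNIV :: bit set)"
  proof -
    have "(UNIV :: bit set) = {0, 1}" using bit.exhaust by auto
    then show ?thesis by (metis finite.emptyI finite.insertI)
  qed
  then have "finite {l :: bit list. set l \<subseteq> UNIV \<and> length l = 22}" by (rule finite_lists_length_eq)
  moreover have "range (lam_coords :: bit lam \<Rightarrow> _) \<subseteq> {l. set l \<subseteq> UNIV \<and> length l = 22}"
    by (auto simp: lam_coords_def)
  ultimately show "finite (range (lam_coords :: bit lam \<Rightarrow> _))" by (rule finite_subset[rotated])
  show "inj (lam_coords :: bit lam \<Rightarrow> _)"
    by (rule injI) (simp add: lam_coords_def lam.expand)
qed

section \<open>The isomorphism of the quotients and the Morita equivalence\<close>

lemma Lambda2'_mod2_sel:
  "carrier Lambda2'_mod2 = carrier (Lambda2' Quot two_Lambda2')" "mult Lambda2'_mod2 = mult (Lambda2' Quot two_Lambda2')"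
  "one Lambda2'_mod2 = one (Lambda2' Quot two_Lambda2')" "zero Lambda2'_mod2 = zero (Lambda2' Quot two_Lambda2')"
  "add Lambda2'_mod2 = add (Lambda2' Quot two_Lambda2')" "c \<odot>\<^bsub>Lambda2'_mod2\<^esub> X = (if c = 1 then X else two_Lambda2')"
  by (simp_all add: Lambda2'_mod2_def ring.defs module.defs)

lemma reduce_iso: "(\<lambda>b. {z \<in> carrier Lambda2'. reduce z = b}) \<in> ring_iso (corner lam_e) Lambda2'_mod2"
  by (rule ring_iso_cong[OF Lambda2'_quot_iso]) (rule Lambda2'_mod2_sel)+

lemma Lambda2'_mod2_zero: "\<zero>\<^bsub>Lambda2'_mod2\<^esub> = two_Lambda2'"
  by (simp add: Lambda2'_mod2_sel FactRing_def)

lemma reduce_zero: "{z \<in> carrier Lambda2'. reduce z = 0} = two_Lambda2'"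
proof -
  interpret h: ring_hom_ring "corner lam_e" "Lambda2' Quot two_Lambda2'" "\<lambda>b. {z \<in> carrier Lambda2'. reduce z = b}"
    using Lambda2'_quot_iso by (intro ring_hom_ringI2 ring_corner lam_e_idem Lambda2'_quot_ring) (simp add: ring_iso_def)
  show ?thesis using h.hom_zero by (simp add: FactRing_def)
qed

lemma ring_Lambda2'_mod2: "ring Lambda2'_mod2"
  by (rule ring_transfer_iso[OF ring_corner[OF lam_e_idem] reduce_iso])
    (simp add: reduce_zero Lambda2'_mod2_zero)

lemma path_quot_iso:
  "(\<lambda>z. {f \<in> carrier F2Psi. lin_ext path_val f = z}) \<in>
    ring_iso (corner lam_e) (quot_alg F2Psi (Idl\<^bsub>F2Psi\<^esub> Psi_relations))"
  by (rule ring_iso_cong[OF F2Psi_quot_iso(1)]) simp_all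

text \<open>Both quotients consist of fibres over the corner at \<open>lam_e\<close>, and
  \<open>h\<close> matches the fibres over the same element. Scalars are 0 or 1, and on both sides
  \<open>c\<close> sends the fibre over \<open>b\<close> to the fibre over
  \<open>c b\<close>.\<close>

lemma alg_iso_quotients: "alg_iso Lambda2'_mod2 (quot_alg F2Psi (Idl\<^bsub>F2Psi\<^esub> Psi_relations)) \<noteq> {}"
proof -
  let ?I = "Idl\<^bsub>F2Psi\<^esub> Psi_relations"
  let ?Q = "quot_alg F2Psi ?I"
  let ?l = "\<lambda>b. {z \<in> carrier Lambda2'. reduce z = b}" and ?p = "\<lambda>b. {f \<in> carrier F2Psi. lin_ext path_val f = b}"
  interpret C: ring "corner lam_e" by (rule ring_corner[OF lam_e_idem])
  interpret F: ring F2Psi by (rule ring_F2Psi)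
  define h where "h = ?p \<circ> inv_into (carrier (corner lam_e)) ?l"
  have h: "h \<in> ring_iso Lambda2'_mod2 ?Q"
    unfolding h_def by (rule ring_iso_set_trans[OF ring_iso_set_sym[OF C.ring_axioms reduce_iso] path_quot_iso])
  have p0: "?p 0 = ?I" by (simp add: Idl_Psi_relations)
  have two: "two_Lambda2' = ?l 0" by (rule reduce_zero[symmetric])
  have bij: "bij_betw ?l (carrier (corner lam_e)) (carrier Lambda2'_mod2)"
    using ring_iso_memE(5)[OF reduce_iso] .
  have h_l: "h (?l b) = ?p b" if "b \<in> carrier (corner lam_e)" for b
    unfolding h_def o_def using bij_betw_inv_into_left[OF bij that] by simp
  have "h (c \<odot>\<^bsub>Lambda2'_mod2\<^esub> X) = c \<odot>\<^bsub>?Q\<^esub> h X" if X: "X \<in> carrier Lambda2'_mod2" for c X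
  proof -
    obtain b where b: "b \<in> carrier (corner lam_e)" "X = ?l b"
      using X bij_betw_imp_surj_on[OF bij] by blast
    obtain f where f: "f \<in> carrier F2Psi" "lin_ext path_val f = b" using lin_ext_path_val_surj[OF b(1)] by blast
    have smult: "c \<odot>\<^bsub>F2Psi\<^esub> g = (if c = 1 then g else \<zero>\<^bsub>F2Psi\<^esub>)" for g
      by (cases c) (simp_all add: F2Psi_def path_alg_def del: mult_bit_eq_and)
    \<comment> \<open>A scalar multiple of a coset is a union of cosets; they all have the same
      value, so the union is a single fibre.\<close>
    have "c \<odot>\<^bsub>?Q\<^esub> ?p b = (\<Union>g\<in>?p b. ?I +>\<^bsub>F2Psi\<^esub> (c \<odot>\<^bsub>F2Psi\<^esub> g))" by simp
    also have "\<dots> = (\<Union>g\<in>?p b. ?p (if c = 1 then b else 0))"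
    proof (rule SUP_cong[OF refl])
      fix g assume g: "g \<in> ?p b"
      have "lin_ext path_val \<zero>\<^bsub>F2Psi\<^esub> = 0" by (simp add: F2Psi_sel)
      then show "?I +>\<^bsub>F2Psi\<^esub> (c \<odot>\<^bsub>F2Psi\<^esub> g) = ?p (if c = 1 then b else 0)"
        unfolding smult using g F2Psi_quot_iso(2)[of g] F2Psi_quot_iso(2)[OF F.zero_closed] by auto
    qed
    also have "\<dots> = ?p (if c = 1 then b else 0)" using f by auto
    finally have "c \<odot>\<^bsub>?Q\<^esub> ?p b = ?p (if c = 1 then b else 0)" .
    moreover have "c \<odot>\<^bsub>Lambda2'_mod2\<^esub> X = ?l (if c = 1 then b else 0)"
      by (simp add: Lambda2'_mod2_sel b two)
    ultimately show ?thesis using h_l[OF b(1)] h_l[of 0] b(2) by (cases c) simp_all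
  qed
  then show ?thesis unfolding alg_iso_def using h by blast
qed

theorem corollary12:
  assumes "infinite (UNIV :: 'm set)"
  shows "alg_iso Lambda2'_mod2 (quot_alg F2Psi (Idl\<^bsub>F2Psi\<^esub> Psi_relations)) \<noteq> {}
    \<and> morita_equivalent TYPE('m)
        (double_burnside (sym_group 3) :: (bit, ((nat \<Rightarrow> nat) biset_class \<Rightarrow> bit) set) module)
        Lambda2'_mod2"
proof
  interpret burnside_rep "sym_group 3" s3_perm s3_val s3_reps "\<lambda>x U. sig_coef x (signature U)"
    by (rule burnside_rep_s3)
  let ?pq = "[(lam_e, lam_e), (Lam 0 0 1 0 0 0 0 0 0 0 0 0 0 0 0 0 0 0 0 0 0 0, Lam 0 0 0 0 0 0 1 0 0 0 0 0 0 0 0 0 0 0 0 0 0 0),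
    (Lam 0 0 0 0 0 1 0 0 0 0 0 0 0 0 0 0 0 0 0 0 0 0, Lam 0 0 0 0 0 0 0 1 0 0 0 0 0 0 0 0 0 0 0 0 0 0)]"
  show "morita_equivalent TYPE('m)
      (double_burnside (sym_group 3) :: (bit, ((nat \<Rightarrow> nat) biset_class \<Rightarrow> bit) set) module) Lambda2'_mod2"
  proof (rule morita_equivalent_corner[OF lam_e_idem _ _ double_burnside_iso(2) ring_Lambda2'_mod2
        double_burnside_iso(1) reduce_iso assms])
    show "(\<Sum>(p, q)\<leftarrow>?pq. p * lam_e * q) = 1"
      using lam_e_full by (simp add: add.assoc)
    show "finite {x. lam_e * x = x}" by (rule finite_subset[OF subset_UNIV finite_bit_lam])
  qed
qed (rule alg_iso_quotients)

end
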